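(* Let $(M,\Pi)$ be a Poisson manifold and $S\subset M$ an embedded symplectic leaf. If the Poisson structure $\Pi$ is unimodular in a neighborhood of $S$, then there exists a coupling neighborhood $N$ of $S$ such that the transverse Poisson structure $P$ of $S$ on $N$ is also unimodular, i.e. $\operatorname{Mod}(N,P)=0$.
   Context: Everything is smooth. For a Poisson bivector field $\Pi$ on $M$, $\Pi^\sharp:T^*M\to TM$ is given by $\langle\beta,\Pi^\sharp\alpha\rangle=\Pi(\alpha,\beta)$. $H^1_\Pi(M)=\{X: L_X\Pi=0\}/\{\Pi^\sharp df: f\in C^\infty(M)\}$. If $M$ is orientable with volume form $\Omega$, the modular vector field $Z_\Pi^\Omega$ is defined by $Z_\Pi^\Omega(f)=\operatorname{div}^\Omega(\Pi^\sharp df)$; its class $\operatorname{Mod}(M,\Pi)=[Z_\Pi^\Omega]\in H^1_\Pi(M)$ does not depend on $\Omega$. A Poisson manifold is unimodular if it is orientable and its modular class is zero. $\Pi$ is unimodular in a neighborhood of $S$ if there is an open neighborhood $U$ of $S$ such that $(U,\Pi|_U)$ is unimodular. Coupling neighborhood: an open neighborhood $N$ of $S$ in $M$ with a surjective submersion $\pi:N\to S$ such that $\pi\circ\iota=\operatorname{Id}_S$ ($\iota:S\hookrightarrow N$ the inclusion), and, with $\mathbb{V}=\ker d\pi$, $\mathbb{V}^0$ its annihilator and $\mathbb{H}=\Pi^\sharp(\mathbb{V}^0)$, one has $\operatorname{rank}\mathbb{H}=\dim S$ and $\mathbb{H}\cap\mathbb{V}=\{0\}$; equivalently $TN=\mathbb{H}\oplus\mathbb{V}$.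 Then $\Pi|_N=\Pi_H+P$ with $\Pi_H\in\Gamma(\wedge^2\mathbb{H})$ and $P\in\Gamma(\wedge^2\mathbb{V})$ a vertical Poisson bivector on $N$ vanishing at the points of $S$, called the transverse Poisson structure of the leaf $S$. Every embedded symplectic leaf admits a coupling neighborhood (known fact). *)

theory Defs
  imports "HOL-Analysis.Analysis"
begin

section \<open>Smooth manifolds\<close>

text \<open>A map on an open subset of a Euclidean space is of class \<open>C^k\<close>.\<close>

fun C_k_on :: "nat \<Rightarrow> 'e::real_normed_vector set \<Rightarrow> ('e \<Rightarrow> 'b::real_normed_vector) \<Rightarrow> bool" where
  "C_k_on 0 U f \<longleftrightarrow> continuous_on U f"
| "C_k_on (Suc k) U f \<longleftrightarrow>
     (\<forall>x\<in>U. f differentiable (at x)) \<and>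
     (\<forall>v. C_k_on k U (\<lambda>x. frechet_derivative f (at x) v))"

text \<open>Smoothness on an arbitrary subset means local extendability to a smooth map on an
  open set. On open sets this is the usual notion; it is used below on relatively open
  subsets of linear subspaces.\<close>

definition smooth_on :: "'e::real_normed_vector set \<Rightarrow> ('e \<Rightarrow> 'b::real_normed_vector) \<Rightarrow> bool" where
  "smooth_on D f \<longleftrightarrow>
     (\<forall>x\<in>D. \<exists>U g. open U \<and> x \<in> U \<and> (\<forall>k. C_k_on k U g) \<and> (\<forall>y\<in>D \<inter> U. g y = f y))"

type_synonym ('a, 'e) chart = "'a set \<times> ('a \<Rightarrow> 'e)"

text \<open>The model space of an \<open>n\<close>-dimensional chart is an \<open>n\<close>-dimensional linear subspace of
  the Euclidean space \<open>'e\<close>. This keeps the dimension a term and admits \<open>n = 0\<close>, which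
  is impossible with the type \<open>'e\<close> itself as the model space.\<close>

definition is_chart :: "nat \<Rightarrow> ('a::topological_space, 'e::euclidean_space) chart \<Rightarrow> bool" where
  "is_chart n = (\<lambda>(U, \<phi>). open U \<and>
     (\<exists>E. subspace E \<and> dim E = n \<and> openin (top_of_set E) (\<phi> ` U)) \<and>
     homeomorphism U (\<phi> ` U) \<phi> (inv_into U \<phi>))"

definition smooth_transition :: "('a, 'e::euclidean_space) chart \<Rightarrow> ('a, 'e) chart \<Rightarrow> bool" where
  "smooth_transition = (\<lambda>(U, \<phi>) (V, \<psi>). smooth_on (\<phi> ` (U \<inter> V)) (\<psi> \<circ> inv_into U \<phi>))"

text \<open>The underlying set of the manifold is the whole type \<open>'a\<close>; the Hausdorff and second
  countability requirements are carried by its sort.\<close>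

definition smooth_manifold ::
    "nat \<Rightarrow> ('a::{t2_space, second_countable_topology}, 'e::euclidean_space) chart set \<Rightarrow> bool" where
  "smooth_manifold n A \<longleftrightarrow>
     (\<forall>c\<in>A. is_chart n c) \<and> (\<Union>c\<in>A. fst c) = UNIV \<and>
     (\<forall>c\<in>A. \<forall>d\<in>A. smooth_transition c d)"

definition maximal_atlas ::
    "nat \<Rightarrow> ('a::topological_space, 'e::euclidean_space) chart set \<Rightarrow> ('a, 'e) chart set" where
  "maximal_atlas n A =
     {c. is_chart n c \<and> (\<forall>d\<in>A. smooth_transition c d \<and> smooth_transition d c)}"

definition smooth_fun ::
    "('a::topological_space, 'e::euclidean_space) chart set \<Rightarrow> 'a set \<Rightarrow> ('a \<Rightarrow> real) \<Rightarrow> bool" where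
  "smooth_fun A W f \<longleftrightarrow> (\<forall>(U, \<phi>)\<in>A. smooth_on (\<phi> ` (U \<inter> W)) (f \<circ> inv_into U \<phi>))"

definition smooth_near ::
    "('a::topological_space, 'e::euclidean_space) chart set \<Rightarrow> 'a \<Rightarrow> ('a \<Rightarrow> real) \<Rightarrow> bool" where
  "smooth_near A x f \<longleftrightarrow> (\<exists>V. open V \<and> x \<in> V \<and> smooth_fun A V f)"

definition smooth_self_map ::
    "('a::topological_space, 'e::euclidean_space) chart set \<Rightarrow> 'a set \<Rightarrow> ('a \<Rightarrow> 'a) \<Rightarrow> bool" where
  "smooth_self_map A W F \<longleftrightarrow> continuous_on W F \<and>
     (\<forall>(U, \<phi>)\<in>A. \<forall>(V, \<psi>)\<in>A.
        smooth_on (\<phi> ` (U \<inter> W \<inter> F -` V)) (\<psi> \<circ> F \<circ> inv_into U \<phi>))"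


section \<open>Tangent and cotangent spaces\<close>

type_synonym 'a tvec = "('a \<Rightarrow> real) \<Rightarrow> real"
type_synonym 'a covec = "'a tvec \<Rightarrow> real"
type_synonym 'a bivec = "'a covec \<Rightarrow> 'a covec \<Rightarrow> real"
type_synonym 'a vfield = "'a \<Rightarrow> 'a tvec"
type_synonym 'a bivfield = "'a \<Rightarrow> 'a bivec"
type_synonym 'a form = "'a \<Rightarrow> 'a tvec list \<Rightarrow> real"

text \<open>Tangent vectors are derivations of the algebra of germs at \<open>x\<close> of smooth functions.
  They are made \<open>0\<close> on functions that are not smooth near \<open>x\<close>, so that equality of
  tangent vectors is equality of functions. As germs are used, the tangent spaces of an open
  submanifold are those of the manifold.\<close>

definition tangent_space ::
    "('a::topological_space, 'e::euclidean_space) chart set \<Rightarrow> 'a \<Rightarrow> 'a tvec set" where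
  "tangent_space A x = {v.
     (\<forall>f. \<not> smooth_near A x f \<longrightarrow> v f = 0) \<and>
     (\<forall>f g. smooth_near A x f \<and> (\<forall>\<^sub>F y in nhds x. f y = g y) \<longrightarrow> v f = v g) \<and>
     (\<forall>f g. smooth_near A x f \<and> smooth_near A x g \<longrightarrow> v (\<lambda>y. f y + g y) = v f + v g) \<and>
     (\<forall>r f. smooth_near A x f \<longrightarrow> v (\<lambda>y. r * f y) = r * v f) \<and>
     (\<forall>f g. smooth_near A x f \<and> smooth_near A x g \<longrightarrow>
        v (\<lambda>y. f y * g y) = v f * g x + f x * v g)}"

definition cotangent_space ::
    "('a::topological_space, 'e::euclidean_space) chart set \<Rightarrow> 'a \<Rightarrow> 'a covec set" where
  "cotangent_space A x = {\<alpha>.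
     (\<forall>v. v \<notin> tangent_space A x \<longrightarrow> \<alpha> v = 0) \<and>
     (\<forall>u\<in>tangent_space A x. \<forall>v\<in>tangent_space A x. \<alpha> (\<lambda>f. u f + v f) = \<alpha> u + \<alpha> v) \<and>
     (\<forall>r. \<forall>v\<in>tangent_space A x. \<alpha> (\<lambda>f. r * v f) = r * \<alpha> v)}"

definition differential ::
    "('a::topological_space, 'e::euclidean_space) chart set \<Rightarrow> ('a \<Rightarrow> real) \<Rightarrow> 'a \<Rightarrow> 'a covec" where
  "differential A f x = (\<lambda>v. if v \<in> tangent_space A x then v f else 0)"

definition annihilator ::
    "('a::topological_space, 'e::euclidean_space) chart set \<Rightarrow> 'a \<Rightarrow> 'a tvec set \<Rightarrow> 'a covec set" where
  "annihilator A x E = {\<alpha> \<in> cotangent_space A x. \<forall>v\<in>E. \<alpha> v = 0}"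

definition pushforward ::
    "('a::topological_space, 'e::euclidean_space) chart set \<Rightarrow> ('a \<Rightarrow> 'a) \<Rightarrow> 'a \<Rightarrow> 'a tvec \<Rightarrow> 'a tvec"
  where
  "pushforward A F x v = (\<lambda>g. if smooth_near A (F x) g then v (\<lambda>y. g (F y)) else 0)"

text \<open>Vector fields are evaluated on functions pointwise, \<open>(X f)(x) = X x f\<close>. Values of fields
  and forms outside the open set under consideration are irrelevant.\<close>

definition vector_field ::
    "('a::topological_space, 'e::euclidean_space) chart set \<Rightarrow> 'a set \<Rightarrow> 'a vfield \<Rightarrow> bool" where
  "vector_field A W X \<longleftrightarrow> (\<forall>x\<in>W. X x \<in> tangent_space A x) \<and>
     (\<forall>V f. open V \<and> V \<subseteq> W \<and> smooth_fun A V f \<longrightarrow> smooth_fun A V (\<lambda>x. X x f))"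

definition lie_bracket ::
    "('a::topological_space, 'e::euclidean_space) chart set \<Rightarrow> 'a vfield \<Rightarrow> 'a vfield \<Rightarrow> 'a vfield" where
  "lie_bracket A X Y = (\<lambda>x f.
     if smooth_near A x f then X x (\<lambda>y. Y y f) - Y x (\<lambda>y. X y f) else 0)"

definition embedded_submanifold ::
    "nat \<Rightarrow> nat \<Rightarrow> ('a::topological_space, 'e::euclidean_space) chart set \<Rightarrow> 'a set \<Rightarrow> bool" where
  "embedded_submanifold n k A S \<longleftrightarrow>
     (\<forall>x\<in>S. \<exists>(U, \<phi>)\<in>maximal_atlas n A. x \<in> U \<and>
        (\<exists>E L. subspace E \<and> dim E = n \<and> openin (top_of_set E) (\<phi> ` U) \<and>
               subspace L \<and> L \<subseteq> E \<and> dim L = k \<and> \<phi> ` (U \<inter> S) = \<phi> ` U \<inter> L))"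

text \<open>The tangent space of an embedded submanifold \<open>S\<close>, as a subspace of that of the ambient
  manifold: the derivations that factor through restriction of germs to \<open>S\<close>.\<close>

definition submanifold_tangent ::
    "('a::topological_space, 'e::euclidean_space) chart set \<Rightarrow> 'a set \<Rightarrow> 'a \<Rightarrow> 'a tvec set" where
  "submanifold_tangent A S x = {v \<in> tangent_space A x.
     \<forall>f. smooth_near A x f \<and> (\<forall>\<^sub>F y in nhds x. y \<in> S \<longrightarrow> f y = 0) \<longrightarrow> v f = 0}"


section \<open>Poisson structures\<close>

text \<open>The second exterior power of a subspace \<open>E\<close> of the tangent space at \<open>x\<close>: sums of
  \<open>u \<and> v\<close> with \<open>u, v \<in> E\<close>, regarded as bilinear forms on covectors by
  \<open>(u \<and> v)(\<alpha>, \<beta>) = \<alpha>(u) \<beta>(v) - \<alpha>(v) \<beta>(u)\<close>.\<close>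

definition bivectors ::
    "('a::topological_space, 'e::euclidean_space) chart set \<Rightarrow> 'a \<Rightarrow> 'a tvec set \<Rightarrow> 'a bivec set" where
  "bivectors A x E = {w. \<exists>ps. set ps \<subseteq> E \<times> E \<and>
     (\<forall>\<alpha>\<in>cotangent_space A x. \<forall>\<beta>\<in>cotangent_space A x.
        w \<alpha> \<beta> = (\<Sum>(u, v)\<leftarrow>ps. \<alpha> u * \<beta> v - \<alpha> v * \<beta> u))}"

definition poisson_bracket ::
    "('a::topological_space, 'e::euclidean_space) chart set \<Rightarrow> 'a bivfield \<Rightarrow>
     ('a \<Rightarrow> real) \<Rightarrow> ('a \<Rightarrow> real) \<Rightarrow> 'a \<Rightarrow> real" where
  "poisson_bracket A \<Lambda> f g = (\<lambda>x. \<Lambda> x (differential A f x) (differential A g x))"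

definition bivector_field ::
    "('a::topological_space, 'e::euclidean_space) chart set \<Rightarrow> 'a set \<Rightarrow> 'a bivfield \<Rightarrow> bool" where
  "bivector_field A W \<Lambda> \<longleftrightarrow> (\<forall>x\<in>W. \<Lambda> x \<in> bivectors A x (tangent_space A x)) \<and>
     (\<forall>V f g. open V \<and> V \<subseteq> W \<and> smooth_fun A V f \<and> smooth_fun A V g \<longrightarrow>
        smooth_fun A V (poisson_bracket A \<Lambda> f g))"

definition poisson_bivector ::
    "('a::topological_space, 'e::euclidean_space) chart set \<Rightarrow> 'a set \<Rightarrow> 'a bivfield \<Rightarrow> bool" where
  "poisson_bivector A W \<Lambda> \<longleftrightarrow> bivector_field A W \<Lambda> \<and>
     (\<forall>V f g h. open V \<and> V \<subseteq> W \<and> smooth_fun A V f \<and> smooth_fun A V g \<and> smooth_fun A V h \<longrightarrow>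
        (\<forall>x\<in>V. poisson_bracket A \<Lambda> f (poisson_bracket A \<Lambda> g h) x
             + poisson_bracket A \<Lambda> g (poisson_bracket A \<Lambda> h f) x
             + poisson_bracket A \<Lambda> h (poisson_bracket A \<Lambda> f g) x = 0))"

text \<open>The tangent vector \<open>\<Lambda>\<^sup>\<sharp> \<alpha>\<close> determined by \<open>\<langle>\<beta>, \<Lambda>\<^sup>\<sharp> \<alpha>\<rangle> = \<Lambda>(\<alpha>, \<beta>)\<close>,
  with \<open>\<beta> = df\<close>.\<close>

definition sharp ::
    "('a::topological_space, 'e::euclidean_space) chart set \<Rightarrow> 'a bivfield \<Rightarrow> 'a \<Rightarrow> 'a covec \<Rightarrow> 'a tvec"
  where
  "sharp A \<Lambda> x \<alpha> = (\<lambda>f. if smooth_near A x f then \<Lambda> x \<alpha> (differential A f x) else 0)"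

definition hamiltonian_field ::
    "('a::topological_space, 'e::euclidean_space) chart set \<Rightarrow> 'a bivfield \<Rightarrow> ('a \<Rightarrow> real) \<Rightarrow> 'a vfield"
  where
  "hamiltonian_field A \<Lambda> f = (\<lambda>x. sharp A \<Lambda> x (differential A f x))"

text \<open>\<open>y\<close> is the endpoint of an integral curve over \<open>[0, 1]\<close>, starting at \<open>x\<close>, of the
  Hamiltonian vector field of a global smooth function.\<close>

definition hamiltonian_step ::
    "('a::topological_space, 'e::euclidean_space) chart set \<Rightarrow> 'a bivfield \<Rightarrow> 'a \<Rightarrow> 'a \<Rightarrow> bool" where
  "hamiltonian_step A \<Lambda> x y \<longleftrightarrow>
     (\<exists>f \<gamma>. smooth_fun A UNIV f \<and> continuous_on {0..1::real} \<gamma> \<and> \<gamma> 0 = x \<and> \<gamma> 1 = y \<and>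
        (\<forall>t\<in>{0..1}. \<forall>g. smooth_near A (\<gamma> t) g \<longrightarrow>
           ((\<lambda>s. g (\<gamma> s)) has_real_derivative hamiltonian_field A \<Lambda> f (\<gamma> t) g)
             (at t within {0..1})))"

text \<open>Symplectic leaves are the classes of points joined by finite concatenations of such
  curves (the relation is symmetric, as \<open>f\<close> may be replaced by \<open>- f\<close>).\<close>

definition symplectic_leaf ::
    "('a::topological_space, 'e::euclidean_space) chart set \<Rightarrow> 'a bivfield \<Rightarrow> 'a set \<Rightarrow> bool" where
  "symplectic_leaf A \<Lambda> S \<longleftrightarrow> (\<exists>x. S = {y. (hamiltonian_step A \<Lambda>)\<^sup>*\<^sup>* x y})"

text \<open>The intrinsic manifold structure of a leaf is the one tangent to the characteristic
  distribution; the leaf is embedded if the structure induced from the manifold is that one.\<close>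

definition embedded_symplectic_leaf ::
    "nat \<Rightarrow> ('a::topological_space, 'e::euclidean_space) chart set \<Rightarrow> 'a bivfield \<Rightarrow> 'a set \<Rightarrow> bool"
  where
  "embedded_symplectic_leaf n A \<Lambda> S \<longleftrightarrow>
     symplectic_leaf A \<Lambda> S \<and> (\<exists>k. embedded_submanifold n k A S) \<and>
     (\<forall>x\<in>S. submanifold_tangent A S x = sharp A \<Lambda> x ` cotangent_space A x)"


section \<open>The modular class\<close>

definition volume_form ::
    "('a::topological_space, 'e::euclidean_space) chart set \<Rightarrow> nat \<Rightarrow> 'a set \<Rightarrow> 'a form \<Rightarrow> bool" where
  "volume_form A n W \<Omega> \<longleftrightarrow>
     (\<forall>x\<in>W. \<forall>vs. length vs = n \<and> set vs \<subseteq> tangent_space A x \<longrightarrow>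
        (\<forall>i<n. \<forall>u\<in>tangent_space A x. \<forall>v\<in>tangent_space A x.
           \<Omega> x (vs[i := (\<lambda>f. u f + v f)]) = \<Omega> x (vs[i := u]) + \<Omega> x (vs[i := v])) \<and>
        (\<forall>i<n. \<forall>r. \<forall>v\<in>tangent_space A x.
           \<Omega> x (vs[i := (\<lambda>f. r * v f)]) = r * \<Omega> x (vs[i := v])) \<and>
        (\<forall>i<n. \<forall>j<n. i \<noteq> j \<and> vs ! i = vs ! j \<longrightarrow> \<Omega> x vs = 0)) \<and>
     (\<forall>V Ys. open V \<and> V \<subseteq> W \<and> length Ys = n \<and> (\<forall>Y\<in>set Ys. vector_field A V Y) \<longrightarrow>
        smooth_fun A V (\<lambda>x. \<Omega> x (map (\<lambda>Y. Y x) Ys))) \<and>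
     (\<forall>x\<in>W. \<exists>vs. length vs = n \<and> set vs \<subseteq> tangent_space A x \<and> \<Omega> x vs \<noteq> 0)"

text \<open>The value at \<open>x\<close> of \<open>(L\<^sub>X \<Omega>)(Y\<^sub>1, \<dots>, Y\<^sub>n)\<close>.\<close>

definition lie_derivative_form ::
    "('a::topological_space, 'e::euclidean_space) chart set \<Rightarrow> 'a vfield \<Rightarrow> 'a form \<Rightarrow>
     'a vfield list \<Rightarrow> 'a \<Rightarrow> real" where
  "lie_derivative_form A X \<Omega> Ys x =
     X x (\<lambda>y. \<Omega> y (map (\<lambda>Y. Y y) Ys)) -
     (\<Sum>i<length Ys. \<Omega> x ((map (\<lambda>Y. Y x) Ys)[i := lie_bracket A X (Ys ! i) x]))"

text \<open>\<open>L\<^sub>X \<Omega> = div(X) \<Omega>\<close>, tested on local vector fields.\<close>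

definition divergence ::
    "('a::topological_space, 'e::euclidean_space) chart set \<Rightarrow> nat \<Rightarrow> 'a form \<Rightarrow> 'a vfield \<Rightarrow> 'a \<Rightarrow> real"
  where
  "divergence A n \<Omega> X x = (THE r. \<forall>V Ys.
     open V \<and> x \<in> V \<and> length Ys = n \<and> (\<forall>Y\<in>set Ys. vector_field A V Y) \<longrightarrow>
     lie_derivative_form A X \<Omega> Ys x = r * \<Omega> x (map (\<lambda>Y. Y x) Ys))"

definition modular_field ::
    "('a::topological_space, 'e::euclidean_space) chart set \<Rightarrow> nat \<Rightarrow> 'a bivfield \<Rightarrow> 'a form \<Rightarrow> 'a vfield"
  where
  "modular_field A n \<Lambda> \<Omega> = (\<lambda>x f.
     if smooth_near A x f then divergence A n \<Omega> (hamiltonian_field A \<Lambda> f) x else 0)"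

text \<open>Vector fields \<open>X\<close> on \<open>W\<close> with \<open>L\<^sub>X \<Lambda> = 0\<close>, where
  \<open>(L\<^sub>X \<Lambda>)(df, dg) = X(\<Lambda>(df, dg)) - \<Lambda>(d(X f), dg) - \<Lambda>(df, d(X g))\<close>.\<close>

definition poisson_fields ::
    "('a::topological_space, 'e::euclidean_space) chart set \<Rightarrow> 'a set \<Rightarrow> 'a bivfield \<Rightarrow> 'a vfield set"
  where
  "poisson_fields A W \<Lambda> = {X. vector_field A W X \<and>
     (\<forall>V f g. open V \<and> V \<subseteq> W \<and> smooth_fun A V f \<and> smooth_fun A V g \<longrightarrow>
        (\<forall>x\<in>V. X x (poisson_bracket A \<Lambda> f g)
              - poisson_bracket A \<Lambda> (\<lambda>y. X y f) g x
              - poisson_bracket A \<Lambda> f (\<lambda>y. X y g) x = 0))}"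

text \<open>The equivalence relation whose classes are the elements of the first Poisson cohomology
  of \<open>(W, \<Lambda>)\<close>; its zero is the class of the vector field \<open>0\<close>.\<close>

definition cohomologous ::
    "('a::topological_space, 'e::euclidean_space) chart set \<Rightarrow> 'a set \<Rightarrow> 'a bivfield \<Rightarrow>
     ('a vfield \<times> 'a vfield) set" where
  "cohomologous A W \<Lambda> = {(X, Y). X \<in> poisson_fields A W \<Lambda> \<and> Y \<in> poisson_fields A W \<Lambda> \<and>
     (\<exists>f. smooth_fun A W f \<and>
        (\<forall>x\<in>W. (\<lambda>g. X x g - Y x g) = hamiltonian_field A \<Lambda> f x))}"

definition poisson_class ::
    "('a::topological_space, 'e::euclidean_space) chart set \<Rightarrow> 'a set \<Rightarrow> 'a bivfield \<Rightarrow>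
     'a vfield \<Rightarrow> 'a vfield set" where
  "poisson_class A W \<Lambda> X = cohomologous A W \<Lambda> `` {X}"

definition modular_class ::
    "('a::topological_space, 'e::euclidean_space) chart set \<Rightarrow> nat \<Rightarrow> 'a set \<Rightarrow> 'a bivfield \<Rightarrow>
     'a form \<Rightarrow> 'a vfield set" where
  "modular_class A n W \<Lambda> \<Omega> = poisson_class A W \<Lambda> (modular_field A n \<Lambda> \<Omega>)"

text \<open>\<open>W\<close> is orientable, i.e. carries a volume form \<open>\<Omega>\<close>, and the modular class, which does
  not depend on \<open>\<Omega>\<close>, is zero.\<close>

definition unimodular ::
    "('a::topological_space, 'e::euclidean_space) chart set \<Rightarrow> nat \<Rightarrow> 'a set \<Rightarrow> 'a bivfield \<Rightarrow> bool" where
  "unimodular A n W \<Lambda> \<longleftrightarrow>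
     (\<exists>\<Omega>. volume_form A n W \<Omega> \<and>
        modular_class A n W \<Lambda> \<Omega> = poisson_class A W \<Lambda> (\<lambda>x f. 0))"


section \<open>Coupling neighborhoods\<close>

definition vertical ::
    "('a::topological_space, 'e::euclidean_space) chart set \<Rightarrow> ('a \<Rightarrow> 'a) \<Rightarrow> 'a \<Rightarrow> 'a tvec set" where
  "vertical A p x = {v \<in> tangent_space A x. pushforward A p x v = (\<lambda>g. 0)}"

definition horizontal ::
    "('a::topological_space, 'e::euclidean_space) chart set \<Rightarrow> 'a bivfield \<Rightarrow> ('a \<Rightarrow> 'a) \<Rightarrow>
     'a \<Rightarrow> 'a tvec set" where
  "horizontal A \<Lambda> p x = sharp A \<Lambda> x ` annihilator A x (vertical A p x)"

text \<open>The submersion \<open>p : N \<rightarrow> S\<close> is regarded as a map into the ambient manifold with values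
  in the embedded submanifold \<open>S\<close>.\<close>

definition coupling_neighborhood ::
    "('a::topological_space, 'e::euclidean_space) chart set \<Rightarrow> 'a bivfield \<Rightarrow> 'a set \<Rightarrow>
     'a set \<Rightarrow> ('a \<Rightarrow> 'a) \<Rightarrow> bool" where
  "coupling_neighborhood A \<Lambda> S N p \<longleftrightarrow>
     open N \<and> S \<subseteq> N \<and> smooth_self_map A N p \<and> p ` N = S \<and> (\<forall>x\<in>S. p x = x) \<and>
     (\<forall>x\<in>N. pushforward A p x ` tangent_space A x = submanifold_tangent A S (p x)) \<and>
     (\<forall>x\<in>N. horizontal A \<Lambda> p x \<inter> vertical A p x = {\<lambda>f. 0} \<and>
        (\<forall>v\<in>tangent_space A x. \<exists>h\<in>horizontal A \<Lambda> p x. \<exists>w\<in>vertical A p x.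
           v = (\<lambda>f. h f + w f)))"

definition transverse_poisson ::
    "('a::topological_space, 'e::euclidean_space) chart set \<Rightarrow> 'a bivfield \<Rightarrow> 'a set \<Rightarrow>
     'a set \<Rightarrow> ('a \<Rightarrow> 'a) \<Rightarrow> 'a bivfield \<Rightarrow> bool" where
  "transverse_poisson A \<Lambda> S N p P \<longleftrightarrow>
     (\<exists>\<Lambda>H. bivector_field A N \<Lambda>H \<and>
        (\<forall>x\<in>N. \<Lambda>H x \<in> bivectors A x (horizontal A \<Lambda> p x)) \<and>
        (\<forall>x\<in>N. \<forall>\<alpha>\<in>cotangent_space A x. \<forall>\<beta>\<in>cotangent_space A x.
           \<Lambda> x \<alpha> \<beta> = \<Lambda>H x \<alpha> \<beta> + P x \<alpha> \<beta>)) \<and>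
     poisson_bivector A N P \<and>
     (\<forall>x\<in>N. P x \<in> bivectors A x (vertical A p x)) \<and>
     (\<forall>x\<in>S. \<forall>\<alpha>\<in>cotangent_space A x. \<forall>\<beta>\<in>cotangent_space A x. P x \<alpha> \<beta> = 0)"

end

theory Submission
  imports Defs "Jordan_Normal_Form.Determinant" "HOL-Real_Asymp.Real_Asymp"
begin

text \<open>A smooth retraction \<open>p\<close> onto \<open>S\<close> is glued from projections in adapted charts. Let \<open>u i\<close> be
  coordinates on \<open>S\<close> pulled back along \<open>p\<close>, and \<open>M i j = {u i, u j}\<close>. As \<open>S\<close> is a symplectic leaf,
  \<open>M\<close> is invertible near \<open>S\<close>; where it is invertible, \<open>p\<close> is a coupling projection and the bracket of
  the vertical part \<open>P\<close> of \<open>\<Lambda>\<close> is the Dirac bracket of the family \<open>u\<close>.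

  If the modular class of \<open>\<Lambda>\<close> vanishes, a volume form can be rescaled so that all Hamiltonian vector
  fields of \<open>\<Lambda>\<close> are divergence free. By the Jacobi identity the \<open>P\<close>-Hamiltonian vector field of \<open>f\<close>
  then has divergence \<open>- {f, ln \<bar>det M\<bar>}\<^sub>P / 2\<close>. Multiplying the volume form at \<open>y\<close> by the square root
  of \<open>\<bar>det M y / det M (p y)\<bar>\<close>, which does not depend on the coordinates on \<open>S\<close>, makes it zero, since
  functions pulled back along \<open>p\<close> are Casimir functions of \<open>P\<close>.\<close>

text \<open>Any smooth retraction works because transversality of the Hamiltonian fields of the
  \<open>u i\<close> to the fibres is an open condition that holds on the leaf; the delicate point
  is the volume form. The \<open>P\<close>-Hamiltonian field of \<open>f\<close> is that of
  \<open>f\<close> for \<open>\<Lambda>\<close> minus a combination of those of the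
  \<open>u j\<close>, with coefficients \<open>co f j\<close>. If all fields of
  \<open>\<Lambda>\<close> are divergence free, its divergence is minus the sum of the brackets of
  \<open>u j\<close> with \<open>co f j\<close>. Now \<open>co f j\<close> is built from brackets of
  \<open>f\<close> with the \<open>u i\<close> and from the inverse \<open>C\<close> of
  \<open>M\<close>. Differentiating the brackets gives, by skew symmetry of \<open>C\<close> and the
  Jacobi identity, half the bracket of \<open>f\<close> with \<open>ln |det M|\<close>.
  Differentiating \<open>C\<close>, with \<open>dC = - C dM C\<close>, gives the same identity for
  the functions \<open>u a\<close>: exactly the correction that turns this bracket into the Dirac
  bracket. The half explains the square root, which geometry also demands: \<open>det M\<close>
  changes by the square of a Jacobian. As the \<open>u i\<close> exist only locally,
  \<open>P\<close> and the density are defined without coordinates and computed on patches.\<close>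

no_notation Matrix.scalar_prod (infix \<open>\<bullet>\<close> 70)
hide_const (open) Matrix.orthogonal
hide_fact (open) Matrix.orthogonal_def

section \<open>Calculus of maps of class \<open>C^k\<close>\<close>

text \<open>On an open set the derivative at a point depends only on the values in the set, so
  agreement passes to derivatives of every order.\<close>

lemma C_k_on_cong:
  assumes "open U" "\<And>x. x \<in> U \<Longrightarrow> f x = g x" "C_k_on k U f"
  shows "C_k_on k U g"
  using assms(2,3)
proof (induction k arbitrary: f g)
  case 0
  then show ?case using continuous_on_cong[of U U f g] by simp
next
  case (Suc k)
  have D: "(g has_derivative frechet_derivative f (at x)) (at x)" if "x \<in> U" for x
  proof (rule has_derivative_transform_within_open[OF _ assms(1) that])
    show "(f has_derivative frechet_derivative f (at x)) (at x)"
      using Suc.prems that by (simp add: frechet_derivative_works[symmetric])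
  qed (use Suc.prems in auto)
  then have E: "frechet_derivative g (at x) = frechet_derivative f (at x)" if "x \<in> U" for x
    using frechet_derivative_at that by metis
  show ?case
  proof (simp, intro conjI ballI allI)
    show "g differentiable at x" if "x \<in> U" for x
      using D that by (auto simp: differentiable_def)
    show "C_k_on k U (\<lambda>x. frechet_derivative g (at x) v)" for v
      by (rule Suc.IH[of "\<lambda>x. frechet_derivative f (at x) v"]) (use E Suc.prems in auto)
  qed
qed

text \<open>The definition of \<open>C_k_on\<close> refers to the choice operator
  \<open>frechet_derivative\<close>; with this rule any explicit derivative \<open>F\<close> can
  take its place.\<close>

lemma C_k_on_SucI:
  assumes "open U" "\<And>x. x \<in> U \<Longrightarrow> (f has_derivative F x) (at x)"
    "\<And>v. C_k_on k U (\<lambda>x. F x v)"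
  shows "C_k_on (Suc k) U f"
proof (simp, intro conjI ballI allI)
  show "f differentiable at x" if "x \<in> U" for x
    using assms(2) that by (auto simp: differentiable_def)
  show "C_k_on k U (\<lambda>x. frechet_derivative f (at x) v)" for v
    by (rule C_k_on_cong[OF assms(1) _ assms(3)]) (use frechet_derivative_at[OF assms(2)] in simp)
qed

lemma C_k_on_subset: "C_k_on k U f \<Longrightarrow> V \<subseteq> U \<Longrightarrow> C_k_on k V f"
  by (induction k arbitrary: f) (auto intro: continuous_on_subset)

lemma C_k_on_imp_continuous_on: "C_k_on k U f \<Longrightarrow> continuous_on U f"
  by (cases k)
    (auto intro!: continuous_at_imp_continuous_on differentiable_imp_continuous_within)

lemma C_k_on_SucD: "C_k_on (Suc k) U f \<Longrightarrow> C_k_on k U f"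
proof (induction k arbitrary: f)
  case 0
  then show ?case using C_k_on_imp_continuous_on by (metis C_k_on.simps(1))
qed auto

lemma C_k_on_const [simp]: "open U \<Longrightarrow> C_k_on k U (\<lambda>_. c)"
proof (induction k arbitrary: c)
  case (Suc k)
  show ?case by (rule C_k_on_SucI[where F="\<lambda>_ _. 0"]) (use Suc in auto)
qed simp

lemma C_k_on_bounded_linear:
  assumes "bounded_linear L" "open U"
  shows "C_k_on k U f \<Longrightarrow> C_k_on k U (\<lambda>x. L (f x))"
proof (induction k arbitrary: f)
  case 0
  then show ?case using assms by (auto intro: bounded_linear.continuous_on)
next
  case (Suc k)
  show ?case
  proof (rule C_k_on_SucI[OF assms(2), where F="\<lambda>x v. L (frechet_derivative f (at x) v)"])
    show "((\<lambda>x. L (f x)) has_derivative (\<lambda>v. L (frechet_derivative f (at x) v))) (at x)"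
      if "x \<in> U" for x
      using Suc.prems that
      by (auto intro!: bounded_linear.has_derivative[OF assms(1)]
          simp: frechet_derivative_works[symmetric])
  qed (use Suc in auto)
qed

lemma C_k_on_linear: "bounded_linear L \<Longrightarrow> open U \<Longrightarrow> C_k_on k U L"
  by (rule C_k_on_bounded_linear[where f="\<lambda>x. x", simplified])
    (auto, induction k, auto intro!: continuous_on_id C_k_on_SucI[where F="\<lambda>_ v. v"])

lemma C_k_on_id [simp]: "open U \<Longrightarrow> C_k_on k U (\<lambda>x. x)"
  using C_k_on_linear bounded_linear_ident by blast

lemma C_k_on_add:
  assumes "open U"
  shows "C_k_on k U f \<Longrightarrow> C_k_on k U g \<Longrightarrow> C_k_on k U (\<lambda>x. f x + g x)"
proof (induction k arbitrary: f g)
  case 0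
  then show ?case by (auto intro: continuous_intros)
next
  case (Suc k)
  show ?case
    by (rule C_k_on_SucI[OF assms,
        where F="\<lambda>x v. frechet_derivative f (at x) v + frechet_derivative g (at x) v"])
      (use Suc in \<open>auto intro!: has_derivative_add simp: frechet_derivative_works[symmetric]\<close>)
qed

lemma C_k_on_diff:
  "open U \<Longrightarrow> C_k_on k U f \<Longrightarrow> C_k_on k U g \<Longrightarrow> C_k_on k U (\<lambda>x. f x - g x)"
  using C_k_on_add[of U k f "\<lambda>x. - g x"]
    C_k_on_bounded_linear[OF bounded_linear_minus[OF bounded_linear_ident], of U k g] by simp

lemma C_k_on_sum:
  "open U \<Longrightarrow> (\<And>i. i \<in> I \<Longrightarrow> C_k_on k U (f i)) \<Longrightarrow> C_k_on k U (\<lambda>x. \<Sum>i\<in>I. f i x)"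
  by (induction I rule: infinite_finite_induct) (auto intro: C_k_on_add)

lemma C_k_on_bilinear:
  assumes B: "bounded_bilinear B" and "open U"
  shows "C_k_on k U f \<Longrightarrow> C_k_on k U g \<Longrightarrow> C_k_on k U (\<lambda>x. B (f x) (g x))"
proof (induction k arbitrary: f g)
  case 0
  then show ?case using bounded_bilinear.continuous_on[OF B] by auto
next
  case (Suc k)
  show ?case
  proof (rule C_k_on_SucI[OF assms(2), where F="\<lambda>x v. B (f x) (frechet_derivative g (at x) v)
      + B (frechet_derivative f (at x) v) (g x)"])
    show "((\<lambda>x. B (f x) (g x)) has_derivative (\<lambda>v. B (f x) (frechet_derivative g (at x) v)
        + B (frechet_derivative f (at x) v) (g x))) (at x)" if "x \<in> U" for x
      using Suc.prems that
      by (auto intro!: bounded_bilinear.FDERIV[OF B] simp: frechet_derivative_works[symmetric])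
    show "C_k_on k U (\<lambda>x. B (f x) (frechet_derivative g (at x) v)
        + B (frechet_derivative f (at x) v) (g x))" for v
      using Suc.prems C_k_on_SucD[OF Suc.prems(1)] C_k_on_SucD[OF Suc.prems(2)]
      by (auto intro!: C_k_on_add assms Suc.IH)
  qed
qed

lemmas C_k_on_mult = C_k_on_bilinear[OF bounded_bilinear_mult]
lemmas C_k_on_scaleR = C_k_on_bilinear[OF bounded_bilinear_scaleR]

text \<open>\<open>C_k_on\<close> differentiates in fixed directions only, while the chain rule
  evaluates the derivative of \<open>g\<close> in the moving direction \<open>?F x v\<close>.
  Expanding this direction in \<open>Basis\<close> leaves derivatives of \<open>g\<close> in fixed
  directions with smooth coefficients, to which the induction applies.\<close>

lemma C_k_on_compose:
  fixes f :: "'c::real_normed_vector \<Rightarrow> 'd::euclidean_space" and g :: "'d \<Rightarrow> 'b::real_normed_vector"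
  assumes "open U" "open V" "f ` U \<subseteq> V"
  shows "C_k_on k V g \<Longrightarrow> C_k_on k U f \<Longrightarrow> C_k_on k U (\<lambda>x. g (f x))"
  using assms(3)
proof (induction k arbitrary: f g)
  case 0
  then show ?case using continuous_on_compose2 by auto
next
  case (Suc k)
  let ?G = "\<lambda>y. frechet_derivative g (at y)" and ?F = "\<lambda>x. frechet_derivative f (at x)"
  show ?case
  proof (rule C_k_on_SucI[OF assms(1), where F="\<lambda>x v. \<Sum>b\<in>Basis. (?F x v \<bullet> b) *\<^sub>R ?G (f x) b"])
    fix x assume x: "x \<in> U"
    have G: "(g has_derivative ?G (f x)) (at (f x))" and F: "(f has_derivative ?F x) (at x)"
      using Suc.prems x by (auto simp: frechet_derivative_works[symmetric])
    interpret linear "?G (f x)" by (rule has_derivative_linear[OF G])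
    have *: "?G (f x) w = (\<Sum>b\<in>Basis. (w \<bullet> b) *\<^sub>R ?G (f x) b)" for w
      using sum[of "\<lambda>b. (w \<bullet> b) *\<^sub>R b" Basis] by (simp add: euclidean_representation scale)
    show "((\<lambda>x. g (f x)) has_derivative (\<lambda>v. \<Sum>b\<in>Basis. (?F x v \<bullet> b) *\<^sub>R ?G (f x) b)) (at x)"
      unfolding *[symmetric] using diff_chain_at[OF F G] by (simp only: o_def)
  next
    fix v
    show "C_k_on k U (\<lambda>x. \<Sum>b\<in>Basis. (?F x v \<bullet> b) *\<^sub>R ?G (f x) b)"
    proof (intro C_k_on_sum assms C_k_on_scaleR)
      fix b :: 'd
      show "C_k_on k U (\<lambda>x. ?F x v \<bullet> b)"
        by (rule C_k_on_bounded_linear[OF bounded_linear_inner_left assms(1)]) (use Suc.prems(2) in simp)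
      show "C_k_on k U (\<lambda>x. ?G (f x) b)"
        by (rule Suc.IH[OF _ C_k_on_SucD[OF Suc.prems(2)] Suc.prems(3)]) (use Suc.prems(1) in simp)
    qed
  qed
qed

lemma C_k_on_real_SucI:
  fixes f :: "real \<Rightarrow> real"
  assumes "open U" "\<And>x. x \<in> U \<Longrightarrow> (f has_real_derivative f' x) (at x)" "C_k_on k U f'"
  shows "C_k_on (Suc k) U f"
  by (rule C_k_on_SucI[OF assms(1), where F="\<lambda>x v. f' x * v"])
    (use assms in \<open>auto simp: has_field_derivative_def intro!: C_k_on_mult\<close>)

lemma C_k_on_exp: "C_k_on k UNIV (exp :: real \<Rightarrow> real)"
  by (induction k) (auto intro!: C_k_on_real_SucI[where f'=exp] continuous_intros DERIV_exp
    simp del: C_k_on.simps(2))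

lemma C_k_on_inverse: "C_k_on k (- {0}) (inverse :: real \<Rightarrow> real)"
proof (induction k)
  case (Suc k)
  have "C_k_on k (- {0}) (\<lambda>x::real. - 1 * (inverse x * inverse x))"
    by (intro C_k_on_mult C_k_on_const Suc) auto
  then show ?case
    by (intro C_k_on_real_SucI[where f'="\<lambda>x. - 1 * (inverse x * inverse x)"])
      (auto intro!: derivative_eq_intros)
qed (auto intro!: continuous_intros)

lemma C_k_on_ln_abs: "C_k_on k (- {0}) (\<lambda>x::real. ln \<bar>x\<bar>)"
proof (cases k)
  case (Suc j)
  have "((\<lambda>x. ln \<bar>x\<bar>) has_real_derivative inverse x) (at x)" if "x \<noteq> 0" for x :: real
  proof (cases "x > 0")
    case True
    have "(ln has_real_derivative inverse x) (at x)" using True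
      by (auto intro!: derivative_eq_intros simp: divide_simps)
    then show ?thesis
      by (rule has_field_derivative_transform_within_open[where S="{0<..}"]) (use True in auto)
  next
    case False
    then have "((\<lambda>x. ln (- x)) has_real_derivative inverse x) (at x)"
      using that by (auto intro!: derivative_eq_intros simp: divide_simps)
    then show ?thesis
      by (rule has_field_derivative_transform_within_open[where S="{..<0}"]) (use False that in auto)
  qed
  then show ?thesis unfolding Suc
    by (intro C_k_on_real_SucI[where f'=inverse] C_k_on_inverse) auto
qed (auto intro!: continuous_intros)

subsection \<open>A smooth step function\<close>

text \<open>The power \<open>m\<close> is there to make the family closed under differentiation: the
  derivative of the \<open>m\<close>-th function combines those with indices \<open>m + 2\<close>
  and \<open>m + 1\<close>. At 0 the exponential beats every power.\<close>

lemma C_k_on_exp_inverse: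
  "C_k_on k UNIV (\<lambda>t::real. if t \<le> 0 then 0 else exp (- inverse t) * inverse t ^ m)"
proof (induction k arbitrary: m)
  case 0
  have "isCont (\<lambda>t::real. if t \<le> 0 then 0 else exp (- inverse t) * inverse t ^ m) t" for t
  proof (cases "t = 0")
    case True
    have "((\<lambda>t::real. exp (- inverse t) * inverse t ^ m) \<longlongrightarrow> 0) (at_right 0)"
      by real_asymp
    then have "((\<lambda>t::real. if t \<le> 0 then 0 else exp (- inverse t) * inverse t ^ m) \<longlongrightarrow> 0) (at_right 0)"
      by (rule Lim_transform_eventually) (auto simp: eventually_at_filter)
    moreover have "((\<lambda>t::real. if t \<le> 0 then 0 else exp (- inverse t) * inverse t ^ m) \<longlongrightarrow> 0) (at_left 0)"
      by (rule Lim_transform_eventually[OF tendsto_const]) (auto simp: eventually_at_filter)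
    ultimately show ?thesis
      using filterlim_split_at by (auto simp: True isCont_def)
  next
    case False
    then show ?thesis
    proof (cases "t < 0")
      case True
      then have "\<forall>\<^sub>F s in nhds t. (if s \<le> 0 then 0 else exp (- inverse s) * inverse s ^ m) = 0"
        by (auto simp: eventually_nhds intro!: exI[of _ "{..<0}"])
      then show ?thesis using isCont_cong by force
    next
      case f: False
      then have "\<forall>\<^sub>F s in nhds t. (if s \<le> 0 then 0 else exp (- inverse s) * inverse s ^ m)
          = exp (- inverse s) * inverse s ^ m"
        using False by (auto simp: eventually_nhds intro!: exI[of _ "{0<..}"])
      moreover have "isCont (\<lambda>s. exp (- inverse s) * inverse s ^ m) t"
        using False by (auto intro!: continuous_intros)
      ultimately show ?thesis using isCont_cong by force
    qed
  qed
  then show ?case by (auto intro: continuous_at_imp_continuous_on)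
next
  case (Suc k)
  let ?e = "\<lambda>m t::real. if t \<le> 0 then 0 else exp (- inverse t) * inverse t ^ m"
  have D: "(?e m has_real_derivative (?e (m + 2) t + (- real m) * ?e (m + 1) t)) (at t)" for t
  proof -
    consider "t < 0" | "t = 0" | "t > 0" by linarith
    then show ?thesis
    proof cases
      case 1
      have "((\<lambda>_. 0) has_real_derivative 0) (at t)" by simp
      then have "(?e m has_real_derivative 0) (at t)"
        by (rule has_field_derivative_transform_within_open[where S="{..<0}"]) (use 1 in auto)
      then show ?thesis using 1 by simp
    next
      case 2
      have "((\<lambda>h::real. exp (- inverse h) * inverse h ^ m / h) \<longlongrightarrow> 0) (at_right 0)"
        by real_asymp
      then have "((\<lambda>h. ?e m h / h) \<longlongrightarrow> 0) (at_right 0)"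
        by (rule Lim_transform_eventually) (auto simp: eventually_at_filter)
      moreover have "((\<lambda>h. ?e m h / h) \<longlongrightarrow> 0) (at_left 0)"
        by (rule Lim_transform_eventually[OF tendsto_const]) (auto simp: eventually_at_filter)
      ultimately have "((\<lambda>h. ?e m h / h) \<longlongrightarrow> 0) (at 0)"
        using filterlim_split_at by blast
      then show ?thesis using 2 by (simp add: DERIV_def cong: if_cong)
    next
      case 3
      have "((\<lambda>t. exp (- inverse t) * inverse t ^ m) has_real_derivative
          (?e (m + 2) t + (- real m) * ?e (m + 1) t)) (at t)"
        using 3 by (auto intro!: derivative_eq_intros simp: field_simps power2_eq_square)
          (cases m; simp add: field_simps)
      then show ?thesis
        by (rule has_field_derivative_transform_within_open[where S="{0<..}"]) (use 3 in auto)
    qed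
  qed
  show ?case
    by (rule C_k_on_real_SucI[OF open_UNIV D]) (intro C_k_on_add C_k_on_mult Suc.IH C_k_on_const; simp)
qed

lemma smooth_step_exists:
  fixes a b :: real
  assumes "a < b"
  obtains \<theta> :: "real \<Rightarrow> real" where "\<And>k. C_k_on k UNIV \<theta>" "\<And>t. 0 \<le> \<theta> t" "\<And>t. \<theta> t \<le> 1"
    "\<And>t. t \<le> a \<Longrightarrow> \<theta> t = 0" "\<And>t. b \<le> t \<Longrightarrow> \<theta> t = 1"
proof -
  define e where "e = (\<lambda>t::real. if t \<le> 0 then 0 else exp (- inverse t))"
  have e: "C_k_on k UNIV e" for k
    using C_k_on_exp_inverse[of k 0] by (simp add: e_def cong: if_cong)
  have e_pos: "e t \<ge> 0" "t > 0 \<Longrightarrow> e t > 0" for t by (auto simp: e_def)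
  \<comment> \<open>As \<open>a < b\<close>, at least one of \<open>t - a\<close> and
    \<open>b - t\<close> is positive, so the denominator of \<open>\<theta>\<close> never
    vanishes.\<close>
  have pos: "e (t - a) + e (b - t) > 0" for t
    using e_pos(1)[of "t - a"] e_pos(1)[of "b - t"] e_pos(2)[of "t - a"] e_pos(2)[of "b - t"] assms
    by (cases "t > a") (auto intro: add_pos_nonneg add_nonneg_pos)
  define \<theta> where "\<theta> = (\<lambda>t. e (t - a) * inverse (e (t - a) + e (b - t)))"
  have 1: "C_k_on k UNIV (\<lambda>t. e (t - a))" and 2: "C_k_on k UNIV (\<lambda>t. e (b - t))" for k
    by (rule C_k_on_compose[OF open_UNIV open_UNIV subset_UNIV e];
        intro C_k_on_diff C_k_on_id C_k_on_const open_UNIV)+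
  have "C_k_on k UNIV \<theta>" for k
    unfolding \<theta>_def
  proof (intro C_k_on_mult[OF open_UNIV 1])
    show "C_k_on k UNIV (\<lambda>t. inverse (e (t - a) + e (b - t)))"
    proof (rule C_k_on_compose[OF _ _ _ C_k_on_inverse])
      show "range (\<lambda>t. e (t - a) + e (b - t)) \<subseteq> - {0}"
        using pos by (auto simp: less_le)
    qed (auto intro: C_k_on_add 1 2)
  qed
  moreover have "0 \<le> \<theta> t" "\<theta> t \<le> 1" for t
    using pos[of t] e_pos(1)[of "t - a"] e_pos(1)[of "b - t"]
    by (simp_all add: \<theta>_def divide_inverse[symmetric] divide_le_eq)
  moreover have "\<theta> t = 0" if "t \<le> a" for t using that by (simp add: \<theta>_def e_def)
  moreover have "\<theta> t = 1" if "b \<le> t" for t using that pos[of t] by (simp add: \<theta>_def e_def)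
  ultimately show ?thesis by (rule that)
qed

section \<open>Hadamard's lemma\<close>

lemma ball_segment:
  fixes a z :: "'e::real_normed_vector"
  assumes "z \<in> ball a r" "t \<in> {0..1::real}"
  shows "a + t *\<^sub>R (z - a) \<in> ball a r"
proof -
  have "t * norm (z - a) \<le> 1 * norm (z - a)" by (rule mult_right_mono) (use assms(2) in auto)
  then show ?thesis using assms by (simp add: dist_norm norm_minus_commute)
qed

lemma continuous_on_segment:
  fixes G :: "'e::real_normed_vector \<Rightarrow> real"
  assumes "continuous_on (ball a r) G"
  shows "continuous_on (ball a r \<times> {0..1}) (\<lambda>(z, t). t ^ m * G (a + t *\<^sub>R (z - a)))"
  unfolding case_prod_beta
  by (intro continuous_intros continuous_on_compose2[OF assms]) (use ball_segment in force)

text \<open>Differentiation under the integral sign. Each derivative in \<open>z\<close> brings out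
  a factor \<open>t\<close>, and the general power \<open>t ^ m\<close> absorbs it in the
  induction.\<close>

lemma leibniz_segment:
  fixes G :: "'e::euclidean_space \<Rightarrow> real"
  assumes G: "\<And>k. C_k_on k (ball a r) G"
  shows "C_k_on k (ball a r) (\<lambda>z. integral {0..1} (\<lambda>t. t ^ m * G (a + t *\<^sub>R (z - a))))"
  using G
proof (induction k arbitrary: m G)
  case 0
  have "continuous_on (ball a r) G" using "0"[of 0] by simp
  from continuous_on_segment[OF this, of m] show ?case
    using integral_continuous_on_param[of "ball a r" 0 1 "\<lambda>z t. t ^ m * G (a + t *\<^sub>R (z - a))"]
    by (simp del: mem_ball)
next
  case (Suc k)
    note seg = ball_segment and cont = continuous_on_segment
    have cG: "continuous_on (ball a r) G" using Suc.prems[of 0] by simp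
    have DG: "(G has_derivative frechet_derivative G (at y)) (at y)" if "y \<in> ball a r" for y
      using Suc.prems[of 1] that by (simp add: frechet_derivative_works[symmetric])
    have cDG: "continuous_on (ball a r) (\<lambda>y. frechet_derivative G (at y) v)" for v
      using Suc.prems[of 1] by simp
    have bl: "bounded_linear (\<lambda>v. t ^ m * t * frechet_derivative G (at y) v)"
      if "y \<in> ball a r" for t y
      by (intro bounded_linear_mult_right[THEN bounded_linear_compose]
          has_derivative_bounded_linear[OF DG[OF that]])
    \<comment> \<open>The Leibniz rule wants the derivative as a continuous map into bounded linear
      operators; its continuity is then checked direction by direction.\<close>
    define F where "F z t = Blinfun (\<lambda>v. t ^ m * t * frechet_derivative G (at (a + t *\<^sub>R (z - a))) v)" for z t
    have F: "blinfun_apply (F z t) = (\<lambda>v. t ^ m * t * frechet_derivative G (at (a + t *\<^sub>R (z - a))) v)"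
      if "z \<in> ball a r" "t \<in> {0..1}" for z t
      unfolding F_def by (rule bounded_linear_Blinfun_apply[OF bl[OF seg[OF that]]])
    have contF: "continuous_on (ball a r \<times> cbox 0 1) (\<lambda>(z, t). F z t)"
    proof (rule continuous_on_blinfun_componentwise)
      fix i :: 'e
      show "continuous_on (ball a r \<times> cbox 0 1) (\<lambda>x. blinfun_apply (case x of (z, t) \<Rightarrow> F z t) i)"
        unfolding cbox_interval
        by (rule continuous_on_eq[OF cont[OF cDG, of "Suc m" i]]) (auto simp: F)
    qed
    have D: "((\<lambda>z. integral (cbox 0 1) (\<lambda>t. t ^ m * G (a + t *\<^sub>R (z - a)))) has_derivative
        blinfun_apply (integral (cbox 0 1) (F z))) (at z within ball a r)" if z: "z \<in> ball a r" for z
    proof (rule leibniz_rule[OF _ _ contF z])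
      fix z t assume z: "z \<in> ball a r" and t: "t \<in> cbox 0 (1::real)"
      have "((\<lambda>z. a + t *\<^sub>R (z - a)) has_derivative (\<lambda>v. t *\<^sub>R v)) (at z)"
        by (auto intro!: derivative_eq_intros)
      from diff_chain_at[OF this DG[OF seg[OF z]]] t
      have "((\<lambda>z. G (a + t *\<^sub>R (z - a))) has_derivative
          (\<lambda>v. frechet_derivative G (at (a + t *\<^sub>R (z - a))) (t *\<^sub>R v))) (at z)"
        by (simp add: o_def)
      then have "((\<lambda>z. t ^ m * G (a + t *\<^sub>R (z - a))) has_derivative
          (\<lambda>v. t ^ m * frechet_derivative G (at (a + t *\<^sub>R (z - a))) (t *\<^sub>R v))) (at z)"
        by (rule has_derivative_mult_right)
      moreover have "frechet_derivative G (at (a + t *\<^sub>R (z - a))) (t *\<^sub>R v)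
          = t * frechet_derivative G (at (a + t *\<^sub>R (z - a))) v" for v
        using linear_scale[OF has_derivative_linear[OF DG[OF seg[OF z]]]] t by simp
      ultimately show "((\<lambda>z. t ^ m * G (a + t *\<^sub>R (z - a))) has_derivative
          blinfun_apply (F z t)) (at z within ball a r)"
        using F[OF z] t by (simp add: mult.assoc has_derivative_at_withinI)
    next
      fix z assume z: "z \<in> ball a r"
      have "continuous_on {0..1} (\<lambda>t. t ^ m * G (a + t *\<^sub>R (z - a)))"
        by (rule continuous_on_compose2[OF cont[OF cG, of m], of _ "\<lambda>t. (z, t)", simplified])
          (use z in \<open>auto intro!: continuous_intros\<close>)
      then show "(\<lambda>t. t ^ m * G (a + t *\<^sub>R (z - a))) integrable_on cbox 0 1"
        by (simp add: integrable_continuous_real)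
    qed simp
    have I: "blinfun_apply (integral (cbox 0 1) (F z)) v
        = integral {0..1} (\<lambda>t. t ^ Suc m * frechet_derivative G (at (a + t *\<^sub>R (z - a))) v)"
      if z: "z \<in> ball a r" for z v
    proof -
      have "continuous_on {0..1} (F z)"
        by (rule continuous_on_compose2[OF contF, of _ "\<lambda>t. (z, t)", simplified])
          (use z in \<open>auto intro!: continuous_intros\<close>)
      then have "F z integrable_on cbox 0 1" by (simp add: integrable_continuous_real)
      from blinfun_apply_integral[OF this, of v]
      have "blinfun_apply (integral (cbox 0 1) (F z)) v = integral {0..1} (\<lambda>t. blinfun_apply (F z t) v)"
        by simp
      also have "\<dots> = integral {0..1} (\<lambda>t. t ^ Suc m * frechet_derivative G (at (a + t *\<^sub>R (z - a))) v)"
        by (rule integral_cong) (use z in \<open>auto simp: F\<close>)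
      finally show ?thesis .
    qed
    show ?case
    proof (rule C_k_on_SucI)
      show "((\<lambda>z. integral {0..1} (\<lambda>t. t ^ m * G (a + t *\<^sub>R (z - a)))) has_derivative
          blinfun_apply (integral (cbox 0 1) (F z))) (at z)" if "z \<in> ball a r" for z
        using D[OF that] at_within_open[OF that] by simp
    next
      fix v
      show "C_k_on k (ball a r) (\<lambda>z. blinfun_apply (integral (cbox 0 1) (F z)) v)"
        by (rule C_k_on_cong[OF open_ball I[symmetric]])
          (assumption, rule Suc.IH, use Suc.prems[of "Suc _"] in simp)
    qed simp
qed

text \<open>Integrate the derivative of \<open>G\<close> along the segment from \<open>a\<close> to
  \<open>z\<close>. The factors \<open>H\<close> are indexed by directions rather than by
  coordinates, so that they serve both for an orthonormal basis of the model subspace of a chart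
  and, with the single direction 1, for functions of one real variable.\<close>

lemma Hadamard:
  fixes G :: "'e::euclidean_space \<Rightarrow> real"
  assumes G: "\<And>k. C_k_on k (ball a r) G"
  obtains H where "\<And>k b. C_k_on k (ball a r) (H b)"
    "\<And>z (I :: nat set) b c. z \<in> ball a r \<Longrightarrow> finite I \<Longrightarrow> z - a = (\<Sum>i\<in>I. c i *\<^sub>R b i) \<Longrightarrow>
       G z = G a + (\<Sum>i\<in>I. c i * H (b i) z)"
proof
  let ?D = "\<lambda>y. frechet_derivative G (at y)"
  let ?H = "\<lambda>b z. integral {0..1} (\<lambda>t. t ^ 0 * ?D (a + t *\<^sub>R (z - a)) b)"
  show "C_k_on k (ball a r) (?H b)" for k b
  proof (rule leibniz_segment[where m=0 and G="\<lambda>y. ?D y b"])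
    show "C_k_on k (ball a r) (\<lambda>y. ?D y b)" for k using G[of "Suc k"] by simp
  qed
  fix z :: 'e and I :: "nat set" and b :: "nat \<Rightarrow> 'e" and c assume z: "z \<in> ball a r" and B: "finite I" "z - a = (\<Sum>i\<in>I. c i *\<^sub>R b i)"
  note seg = ball_segment[OF z]
  have DG: "(G has_derivative ?D y) (at y)" if "y \<in> ball a r" for y
    using G[of 1] that by (simp add: frechet_derivative_works[symmetric])
  have "((\<lambda>t. G (a + t *\<^sub>R (z - a))) has_vector_derivative ?D (a + t *\<^sub>R (z - a)) (z - a))
      (at t within {0..1})" if t: "t \<in> {0..1}" for t
  proof -
    have "((\<lambda>t. a + t *\<^sub>R (z - a)) has_derivative (\<lambda>s. s *\<^sub>R (z - a))) (at t)"
      by (auto intro!: derivative_eq_intros)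
    from diff_chain_at[OF this DG[OF seg[OF t]]]
    have "((\<lambda>t. G (a + t *\<^sub>R (z - a))) has_derivative
        (\<lambda>s. ?D (a + t *\<^sub>R (z - a)) (s *\<^sub>R (z - a)))) (at t)" by (simp only: o_def)
    moreover have "?D (a + t *\<^sub>R (z - a)) (s *\<^sub>R (z - a)) = s *\<^sub>R ?D (a + t *\<^sub>R (z - a)) (z - a)" for s
      by (rule linear_scale[OF has_derivative_linear[OF DG[OF seg[OF t]]]])
    ultimately show ?thesis
      by (simp only: has_vector_derivative_def has_derivative_at_withinI)
  qed
  from fundamental_theorem_of_calculus[OF _ this]
  have I: "((\<lambda>t. ?D (a + t *\<^sub>R (z - a)) (z - a)) has_integral G z - G a) {0..1}"
    by simp
  moreover have "((\<lambda>t. \<Sum>i\<in>I. c i * (t ^ 0 * ?D (a + t *\<^sub>R (z - a)) (b i))) has_integral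
      (\<Sum>i\<in>I. c i * ?H (b i) z)) {0..1}"
  proof (intro has_integral_sum B has_integral_mult_right integrable_integral integrable_continuous_real)
    fix i
    have c: "continuous_on (ball a r) (\<lambda>y. ?D y (b i))" using G[of 1] by simp
    have "continuous_on {0..1} (\<lambda>t. ?D (a + t *\<^sub>R (z - a)) (b i))"
    proof (rule continuous_on_compose2[OF c])
      show "continuous_on {0..1} (\<lambda>t. a + t *\<^sub>R (z - a))" by (intro continuous_intros)
    qed (use seg in blast)
    then show "continuous_on {0..1} (\<lambda>t. t ^ 0 * ?D (a + t *\<^sub>R (z - a)) (b i))"
      by (simp only: power_0 mult_1)
  qed
  moreover have "(\<Sum>i\<in>I. c i * (t ^ 0 * ?D (a + t *\<^sub>R (z - a)) (b i))) = ?D (a + t *\<^sub>R (z - a)) (z - a)"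
    if t: "t \<in> {0..1}" for t
  proof -
    interpret linear "?D (a + t *\<^sub>R (z - a))" by (rule has_derivative_linear[OF DG[OF seg[OF t]]])
    have "?D (a + t *\<^sub>R (z - a)) (\<Sum>i\<in>I. c i *\<^sub>R b i) = (\<Sum>i\<in>I. c i * ?D (a + t *\<^sub>R (z - a)) (b i))"
      by (simp only: sum scale real_scaleR_def)
    then show ?thesis by (simp only: B(2)[symmetric] power_0 mult_1)
  qed
  ultimately have "((\<lambda>t. ?D (a + t *\<^sub>R (z - a)) (z - a)) has_integral (\<Sum>i\<in>I. c i * ?H (b i) z)) {0..1}"
    by (simp only: cong: has_integral_cong)
  from has_integral_unique[OF this I] show "G z = G a + (\<Sum>i\<in>I. c i * ?H (b i) z)" by simp
qed

section \<open>Determinants of square matrices of variable size\<close>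

text \<open>The size is a term because the dimensions of the manifold and of the leaf are terms;
  entries come as functions so that they can vary with a point.\<close>

definition nmat :: "nat \<Rightarrow> (nat \<Rightarrow> nat \<Rightarrow> real) \<Rightarrow> real mat" where
  "nmat k M = mat k k (\<lambda>(i, j). M i j)"

definition ndet :: "nat \<Rightarrow> (nat \<Rightarrow> nat \<Rightarrow> real) \<Rightarrow> real" where
  "ndet k M = Determinant.det (nmat k M)"

definition nadj :: "nat \<Rightarrow> (nat \<Rightarrow> nat \<Rightarrow> real) \<Rightarrow> nat \<Rightarrow> nat \<Rightarrow> real" where
  "nadj k M i j = adj_mat (nmat k M) $$ (i, j)"

lemma nmat_carrier [simp]: "nmat k M \<in> carrier_mat k k"
  and nmat_index [simp]: "i < k \<Longrightarrow> j < k \<Longrightarrow> nmat k M $$ (i, j) = M i j"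
  and nmat_dim [simp]: "dim_row (nmat k M) = k" "dim_col (nmat k M) = k"
  by (auto simp: nmat_def)

lemma ndet_cong: "(\<And>i j. i < k \<Longrightarrow> j < k \<Longrightarrow> M i j = N i j) \<Longrightarrow> ndet k M = ndet k N"
  unfolding ndet_def by (rule arg_cong[of _ _ Determinant.det]) auto

lemma ndet_permutes:
  "ndet k M = (\<Sum>p | p permutes {..<k}. of_int (sign p) * (\<Prod>i<k. M i (p i)))"
proof -
  have "p i < k" if "p permutes {0..<k}" "i < k" for p i
    using permutes_in_image[OF that(1), of i] that(2) by simp
  then show ?thesis
    by (auto simp: ndet_def det_def'[OF nmat_carrier] atLeast0LessThan intro!: sum.cong prod.cong)
qed

lemma nadj_mult:
  assumes "i < k" "j < k"
  shows "(\<Sum>l<k. nadj k M i l * M l j) = (if i = j then ndet k M else 0)"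
    and "(\<Sum>l<k. M i l * nadj k M l j) = (if i = j then ndet k M else 0)"
proof -
  note adj = adj_mat[OF nmat_carrier, of k M]
  have "(adj_mat (nmat k M) * nmat k M) $$ (i, j) = (if i = j then ndet k M else 0)"
    "(nmat k M * adj_mat (nmat k M)) $$ (i, j) = (if i = j then ndet k M else 0)"
    using assms by (simp_all only: adj) (auto simp: ndet_def)
  then show "(\<Sum>l<k. nadj k M i l * M l j) = (if i = j then ndet k M else 0)"
    "(\<Sum>l<k. M i l * nadj k M l j) = (if i = j then ndet k M else 0)"
    using assms adj(1) by (simp_all add: scalar_prod_def nadj_def atLeast0LessThan)
qed

lemma nadj_minor:
  assumes "i < k" "j < k"
  shows "nadj k M i j = (- 1) ^ (j + i) *
    ndet (k - 1) (\<lambda>a b. M (if a < j then a else Suc a) (if b < i then b else Suc b))"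
proof -
  have "mat_delete (nmat k M) j i
      = nmat (k - 1) (\<lambda>a b. M (if a < j then a else Suc a) (if b < i then b else Suc b))"
    by (rule eq_matI) (auto simp: mat_delete_def)
  then show ?thesis using assms by (simp add: nadj_def adj_mat_def cofactor_def ndet_def)
qed

text \<open>The entries \<open>nadj k M j i\<close> are signed minors without row \<open>i\<close>,
  so they do not notice the replacement; what remains is the expansion along that row.\<close>

lemma ndet_replace_row:
  assumes "i < k"
  shows "ndet k (M(i := r)) = (\<Sum>j<k. r j * nadj k M j i)"
proof -
  have "nadj k (M(i := r)) j i = nadj k M j i" if "j < k" for j
    unfolding nadj_minor[OF that assms] by (auto intro!: ndet_cong)
  then show ?thesis
    using nadj_mult(2)[OF assms assms, of "M(i := r)"] by simp
qed

lemma ndet_mult: "ndet k (\<lambda>i j. \<Sum>l<k. M i l * N l j) = ndet k M * ndet k N"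
proof -
  have "nmat k M * nmat k N = nmat k (\<lambda>i j. \<Sum>l<k. M i l * N l j)"
    by (rule eq_matI) (auto simp: scalar_prod_def atLeast0LessThan)
  then show ?thesis
    using det_mult[of "nmat k M" k "nmat k N"] by (simp add: ndet_def)
qed

lemma ndet_transpose: "ndet k (\<lambda>i j. M j i) = ndet k M"
proof -
  have "transpose_mat (nmat k M) = nmat k (\<lambda>i j. M j i)" by (rule eq_matI) auto
  then show ?thesis using Determinant.det_transpose[of "nmat k M" k] by (simp add: ndet_def)
qed

text \<open>This is how the bracket matrix of a family of functions reacts to a change of
  coordinates. The square of the Jacobian is the reason why the square root of the determinant is
  the right density.\<close>

lemma ndet_congruence:
  "ndet k (\<lambda>i j. \<Sum>a<k. \<Sum>b<k. J i a * M a b * J j b) = (ndet k J)\<^sup>2 * ndet k M"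
proof -
  have "ndet k (\<lambda>i j. \<Sum>a<k. \<Sum>b<k. J i a * M a b * J j b)
      = ndet k (\<lambda>i j. \<Sum>a<k. J i a * (\<Sum>b<k. M a b * J j b))"
    by (simp only: sum_distrib_left mult.assoc)
  also have "\<dots> = ndet k J * (ndet k M * ndet k (\<lambda>i j. J j i))"
    by (simp only: ndet_mult)
  finally show ?thesis by (simp add: ndet_transpose[of k J] power2_eq_square)
qed

lemma ndet_eq_0D:
  assumes "ndet k M = 0"
  obtains c i where "i < k" "c i \<noteq> (0::real)" "\<And>j. j < k \<Longrightarrow> (\<Sum>i<k. c i * M i j) = 0"
proof -
  have "Determinant.det (nmat k (\<lambda>i j. M j i)) = 0"
    using assms ndet_transpose[of k M] by (simp add: ndet_def)
  then obtain v where v: "v \<in> carrier_vec k" "v \<noteq> 0\<^sub>v k"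
      "nmat k (\<lambda>i j. M j i) *\<^sub>v v = 0\<^sub>v k"
    using det_0_iff_vec_prod_zero[OF nmat_carrier] by blast
  from v(1,2) obtain i where i: "i < k" "v $ i \<noteq> 0"
    using eq_vecI[of v "0\<^sub>v k"] by auto
  have "(\<Sum>i<k. v $ i * M i j) = 0" if "j < k" for j
  proof -
    have "(nmat k (\<lambda>i j. M j i) *\<^sub>v v) $ j = 0" using that v(3) by simp
    then show ?thesis using that v(1)
      by (simp add: scalar_prod_def atLeast0LessThan mult.commute)
  qed
  with i show ?thesis by (rule that)
qed

text \<open>Infinitesimal version of \<open>det (M (1 + t K)) = det M * det (1 + t K)\<close>. It is
  the source of the trace in the coordinate formula for the divergence.\<close>

lemma sum_ndet_replace_row_mult:
  "(\<Sum>i<k. ndet k (M(i := (\<lambda>j. \<Sum>l<k. M i l * K l j)))) = (\<Sum>l<k. K l l) * ndet k M"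
proof -
  have "(\<Sum>i<k. ndet k (M(i := (\<lambda>j. \<Sum>l<k. M i l * K l j))))
      = (\<Sum>i<k. \<Sum>j<k. \<Sum>l<k. K l j * (nadj k M j i * M i l))"
    by (simp add: ndet_replace_row sum_distrib_left sum_distrib_right mult_ac)
  also have "\<dots> = (\<Sum>j<k. \<Sum>l<k. K l j * (\<Sum>i<k. nadj k M j i * M i l))"
    by (subst sum.swap, rule sum.cong[OF refl], subst sum.swap) (simp add: sum_distrib_left)
  also have "\<dots> = (\<Sum>j<k. \<Sum>l<k. if j = l then K l j * ndet k M else 0)"
    by (intro sum.cong refl) (auto simp: nadj_mult)
  finally show ?thesis by (simp add: sum_distrib_right)
qed

section \<open>Smooth functions on manifolds\<close>

text \<open>The condition of \<open>smooth_on\<close> at one point, to be matched with germs. The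
  set \<open>D\<close> is arbitrary since the image of a chart is open only in a subspace.\<close>

definition smooth_at :: "'e::real_normed_vector set \<Rightarrow> 'e \<Rightarrow> ('e \<Rightarrow> 'b::real_normed_vector) \<Rightarrow> bool" where
  "smooth_at D x f \<longleftrightarrow>
     (\<exists>U g. open U \<and> x \<in> U \<and> (\<forall>k. C_k_on k U g) \<and> (\<forall>y\<in>D \<inter> U. g y = f y))"

lemma smooth_on_iff_smooth_at: "smooth_on D f \<longleftrightarrow> (\<forall>x\<in>D. smooth_at D x f)"
  by (simp add: smooth_on_def smooth_at_def)

lemma smooth_atI:
  "open U \<Longrightarrow> x \<in> U \<Longrightarrow> (\<And>k. C_k_on k U g) \<Longrightarrow> (\<And>y. y \<in> D \<Longrightarrow> y \<in> U \<Longrightarrow> g y = f y) \<Longrightarrow> smooth_at D x f"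
  unfolding smooth_at_def by blast

lemma smooth_at_subset: "smooth_at D x f \<Longrightarrow> D' \<subseteq> D \<Longrightarrow> smooth_at D' x f"
  unfolding smooth_at_def by blast

lemma smooth_at_cong_local:
  assumes "smooth_at (D \<inter> V) x f" "open V" "x \<in> V" "\<And>y. y \<in> D \<Longrightarrow> y \<in> V \<Longrightarrow> f y = g y"
  shows "smooth_at D x g"
proof -
  obtain U h where U: "open U" "x \<in> U" "\<And>k. C_k_on k U h" "\<And>y. y \<in> D \<inter> V \<inter> U \<Longrightarrow> h y = f y"
    using assms(1) unfolding smooth_at_def by blast
  show ?thesis
    by (rule smooth_atI[of "U \<inter> V" x h])
      (use U assms in \<open>auto intro: C_k_on_subset[OF U(3)]\<close>)
qed

lemma smooth_at_compose:
  fixes f :: "'c::real_normed_vector \<Rightarrow> 'd::euclidean_space" and g :: "'d \<Rightarrow> 'b::real_normed_vector"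
  assumes "smooth_at D x f" "smooth_at D' (f x) g" "x \<in> D" "f ` D \<subseteq> D'"
  shows "smooth_at D x (\<lambda>y. g (f y))"
proof -
  obtain U F where U: "open U" "x \<in> U" "\<And>k. C_k_on k U F" "\<And>y. y \<in> D \<inter> U \<Longrightarrow> F y = f y"
    using assms(1) unfolding smooth_at_def by blast
  obtain V G where V: "open V" "f x \<in> V" "\<And>k. C_k_on k V G" "\<And>y. y \<in> D' \<inter> V \<Longrightarrow> G y = g y"
    using assms(2) unfolding smooth_at_def by blast
  have "open (U \<inter> F -` V)"
    using continuous_open_preimage[OF C_k_on_imp_continuous_on[OF U(3)[of 0]] U(1) V(1)] by simp
  show ?thesis
  proof (rule smooth_atI[of "U \<inter> F -` V" x "\<lambda>y. G (F y)"])
    show "C_k_on k (U \<inter> F -` V) (\<lambda>y. G (F y))" for k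
      by (rule C_k_on_compose[OF \<open>open (U \<inter> F -` V)\<close> V(1) _ V(3) C_k_on_subset[OF U(3)]]) auto
    show "x \<in> U \<inter> F -` V" using U V assms(3) by auto
    show "G (F y) = g (f y)" if "y \<in> D" "y \<in> U \<inter> F -` V" for y
      using that U(4)[of y] V(4)[of "f y"] assms(4) by auto
  qed fact
qed

lemma smooth_at_C_k: "open U \<Longrightarrow> x \<in> U \<Longrightarrow> (\<And>k. C_k_on k U g) \<Longrightarrow> smooth_at D x g"
  by (rule smooth_atI) auto

lemma smooth_at_binary:
  fixes D :: "'c::real_normed_vector set"
  assumes "smooth_at D x f" "smooth_at D x g"
    and "\<And>k U f g. open (U :: 'c set) \<Longrightarrow> C_k_on k U f \<Longrightarrow> C_k_on k U g \<Longrightarrow> C_k_on k U (\<lambda>x. B (f x) (g x))"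
  shows "smooth_at D x (\<lambda>y. B (f y) (g y))"
proof -
  obtain U F where U: "open U" "x \<in> U" "\<And>k. C_k_on k U F" "\<And>y. y \<in> D \<inter> U \<Longrightarrow> F y = f y"
    using assms(1) unfolding smooth_at_def by blast
  obtain V G where V: "open V" "x \<in> V" "\<And>k. C_k_on k V G" "\<And>y. y \<in> D \<inter> V \<Longrightarrow> G y = g y"
    using assms(2) unfolding smooth_at_def by blast
  have "C_k_on k (U \<inter> V) (\<lambda>y. B (F y) (G y))" for k
    by (rule assms(3)[OF open_Int[OF U(1) V(1)] C_k_on_subset[OF U(3)] C_k_on_subset[OF V(3)]]) auto
  then show ?thesis
    by (intro smooth_atI[of "U \<inter> V" x "\<lambda>y. B (F y) (G y)"]) (use U V in auto)
qed

lemmas smooth_at_add = smooth_at_binary[where B="(+)", OF _ _ C_k_on_add]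
lemmas smooth_at_mult = smooth_at_binary[where B="(*)", OF _ _ C_k_on_mult]

lemma smooth_at_const: "smooth_at D x (\<lambda>_. c)"
  by (rule smooth_at_C_k[of UNIV]) auto

lemma smooth_at_sum:
  "(\<And>i. i \<in> I \<Longrightarrow> smooth_at D x (f i)) \<Longrightarrow> smooth_at D x (\<lambda>y. \<Sum>i\<in>I. f i y)"
  by (induction I rule: infinite_finite_induct) (auto intro: smooth_at_add smooth_at_const)

lemma smooth_at_scaleR_const:
  assumes "smooth_at D x f"
  shows "smooth_at D x (\<lambda>y. f y *\<^sub>R c)"
proof -
  obtain U F where U: "open U" "x \<in> U" "\<And>k. C_k_on k U F" "\<And>y. y \<in> D \<inter> U \<Longrightarrow> F y = f y"
    using assms(1) unfolding smooth_at_def by blast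
  then show ?thesis
    by (intro smooth_atI[of U x "\<lambda>y. F y *\<^sub>R c"] C_k_on_scaleR) auto
qed

lemma smooth_at_components:
  fixes f :: "'c::real_normed_vector \<Rightarrow> 'd::euclidean_space"
  assumes "\<And>b. b \<in> Basis \<Longrightarrow> smooth_at D x (\<lambda>y. f y \<bullet> b)"
  shows "smooth_at D x f"
proof -
  have "smooth_at D x (\<lambda>y. \<Sum>b\<in>Basis. (f y \<bullet> b) *\<^sub>R b)"
    by (intro smooth_at_sum smooth_at_scaleR_const assms)
  then show ?thesis unfolding euclidean_representation .
qed

section \<open>Germs of smooth functions\<close>

locale smooth_mfd =
  fixes n :: nat and A :: "('a::{t2_space, second_countable_topology}, 'e::euclidean_space) chart set"
  assumes smooth_manifold: "smooth_manifold n A"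
begin

abbreviation "max_atlas \<equiv> maximal_atlas n A"
abbreviation "smooth_germ \<equiv> smooth_near A"

lemma atlas_subset: "A \<subseteq> max_atlas"
  using smooth_manifold by (auto simp: smooth_manifold_def maximal_atlas_def)

lemma atlas_covers: obtains U \<phi> where "(U, \<phi>) \<in> A" "x \<in> U"
proof -
  have "x \<in> (\<Union>c\<in>A. fst c)" using smooth_manifold by (simp add: smooth_manifold_def)
  then show ?thesis using that by auto
qed

context
  fixes U \<phi>
  assumes chart: "(U, \<phi>) \<in> max_atlas"
begin

lemma is_chart_chart: "is_chart n (U, \<phi>)"
  using chart by (simp add: maximal_atlas_def)

lemma chart_open: "open U"
  and chart_homeomorphism: "homeomorphism U (\<phi> ` U) \<phi> (inv_into U \<phi>)"
  using is_chart_chart by (auto simp: is_chart_def)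

lemma chart_inv [simp]: "x \<in> U \<Longrightarrow> inv_into U \<phi> (\<phi> x) = x"
  using chart_homeomorphism homeomorphism_apply1 by metis

lemma chart_inj: "x \<in> U \<Longrightarrow> y \<in> U \<Longrightarrow> \<phi> x = \<phi> y \<Longrightarrow> x = y"
  by (metis chart_inv)

lemma chart_isCont: "x \<in> U \<Longrightarrow> isCont \<phi> x"
  using chart_homeomorphism chart_open
  by (auto simp: homeomorphism_def continuous_on_eq_continuous_at)

lemma chart_image_openin:
  assumes "open V"
  obtains W where "open W" "\<phi> ` (U \<inter> V) = \<phi> ` U \<inter> W"
proof -
  have "openin (top_of_set U) (U \<inter> V)" using assms by (simp add: openin_open_Int)
  then have "openin (top_of_set (\<phi> ` U)) (\<phi> ` (U \<inter> V))"
    using homeomorphism_imp_open_map[OF chart_homeomorphism] by blast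
  then show ?thesis using that by (auto simp: openin_open)
qed

lemma chart_preimage_open:
  assumes "open W"
  shows "open (U \<inter> \<phi> -` W)"
  using chart_homeomorphism continuous_open_preimage[OF _ chart_open assms]
  by (simp add: homeomorphism_def)

text \<open>One chart suffices because the transition maps between it and the charts of
  \<open>A\<close> are smooth in both directions: the transition into \<open>A\<close> gives the
  implication to the right, the transition out of \<open>A\<close> the one to the left.\<close>

lemma smooth_near_iff_chart:
  assumes x: "x \<in> U"
  shows "smooth_germ x f \<longleftrightarrow> smooth_at (\<phi> ` U) (\<phi> x) (\<lambda>z. f (inv_into U \<phi> z))"
proof
  assume "smooth_germ x f"
  then obtain V where V: "open V" "x \<in> V" "smooth_fun A V f" by (auto simp: smooth_near_def)
  obtain W \<psi> where W: "(W, \<psi>) \<in> A" "x \<in> W" by (rule atlas_covers)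
  have Wm: "(W, \<psi>) \<in> max_atlas" using W atlas_subset by auto
  have invW: "inv_into W \<psi> (\<psi> y) = y" if "y \<in> W" for y
    using smooth_mfd.is_chart_chart[OF smooth_mfd_axioms Wm] that
    by (auto simp: is_chart_def homeomorphism_def)
  have oW: "open W" using smooth_mfd.is_chart_chart[OF smooth_mfd_axioms Wm] by (simp add: is_chart_def)
  obtain Q where Q: "open Q" "\<phi> ` (U \<inter> (V \<inter> W)) = \<phi> ` U \<inter> Q"
    using chart_image_openin[of "V \<inter> W"] V(1) oW by auto
  have "smooth_on (\<phi> ` (U \<inter> W)) (\<psi> \<circ> inv_into U \<phi>)"
    using chart W(1) by (auto simp: maximal_atlas_def smooth_transition_def)
  then have "smooth_at (\<phi> ` (U \<inter> W)) (\<phi> x) (\<psi> \<circ> inv_into U \<phi>)"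
    using x W by (auto simp: smooth_on_iff_smooth_at)
  then have 1: "smooth_at (\<phi> ` (U \<inter> (V \<inter> W))) (\<phi> x) (\<psi> \<circ> inv_into U \<phi>)"
    by (rule smooth_at_subset) auto
  have "smooth_on (\<psi> ` (W \<inter> V)) (f \<circ> inv_into W \<psi>)"
    using V(3) W(1) by (auto simp: smooth_fun_def)
  then have 2: "smooth_at (\<psi> ` (W \<inter> V)) ((\<psi> \<circ> inv_into U \<phi>) (\<phi> x)) (f \<circ> inv_into W \<psi>)"
    using x W V by (auto simp: smooth_on_iff_smooth_at)
  have "smooth_at (\<phi> ` (U \<inter> (V \<inter> W))) (\<phi> x)
      (\<lambda>z. (f \<circ> inv_into W \<psi>) ((\<psi> \<circ> inv_into U \<phi>) z))"
    by (rule smooth_at_compose[OF 1 2]) (use x V W in auto)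
  then show "smooth_at (\<phi> ` U) (\<phi> x) (\<lambda>z. f (inv_into U \<phi> z))"
    unfolding Q(2)
  proof (rule smooth_at_cong_local)
    show "open Q" by fact
    show "\<phi> x \<in> Q" using Q(2) x V W by auto
    fix z assume "z \<in> \<phi> ` U" "z \<in> Q"
    then obtain y where "y \<in> U \<inter> (V \<inter> W)" "z = \<phi> y" using Q(2) by (metis IntI imageE)
    then show "(f \<circ> inv_into W \<psi>) ((\<psi> \<circ> inv_into U \<phi>) z) = f (inv_into U \<phi> z)"
      by (simp add: invW)
  qed
next
  assume "smooth_at (\<phi> ` U) (\<phi> x) (\<lambda>z. f (inv_into U \<phi> z))"
  then obtain Q g where Q: "open Q" "\<phi> x \<in> Q" "\<And>k. C_k_on k Q g"
      "\<And>z. z \<in> \<phi> ` U \<inter> Q \<Longrightarrow> g z = f (inv_into U \<phi> z)"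
    unfolding smooth_at_def by blast
  let ?V = "U \<inter> \<phi> -` Q"
  have "smooth_fun A ?V f"
    unfolding smooth_fun_def
  proof safe
    fix W \<psi> assume W: "(W, \<psi>) \<in> A"
    then have Wm: "(W, \<psi>) \<in> max_atlas" using atlas_subset by auto
    have invW: "inv_into W \<psi> (\<psi> y) = y" if "y \<in> W" for y
      using smooth_mfd.is_chart_chart[OF smooth_mfd_axioms Wm] that
      by (auto simp: is_chart_def homeomorphism_def)
    have T: "smooth_on (\<psi> ` (W \<inter> U)) (\<phi> \<circ> inv_into W \<psi>)"
      using chart W(1) by (auto simp: maximal_atlas_def smooth_transition_def)
    show "smooth_on (\<psi> ` (W \<inter> ?V)) (f \<circ> inv_into W \<psi>)"
      unfolding smooth_on_iff_smooth_at
    proof safe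
      fix y assume y: "y \<in> W" "y \<in> U" "\<phi> y \<in> Q"
      have 1: "smooth_at (\<psi> ` (W \<inter> ?V)) (\<psi> y) (\<phi> \<circ> inv_into W \<psi>)"
        using T y by (auto simp: smooth_on_iff_smooth_at intro: smooth_at_subset)
      have "smooth_at Q (\<phi> y) g"
        using Q y by (intro smooth_at_C_k)
      then have 2: "smooth_at Q ((\<phi> \<circ> inv_into W \<psi>) (\<psi> y)) g" using y invW by simp
      have "smooth_at (\<psi> ` (W \<inter> ?V)) (\<psi> y) (\<lambda>z. g ((\<phi> \<circ> inv_into W \<psi>) z))"
        by (rule smooth_at_compose[OF 1 2]) (use y invW in auto)
      then show "smooth_at (\<psi> ` (W \<inter> ?V)) (\<psi> y) (f \<circ> inv_into W \<psi>)"
        by (rule smooth_at_cong_local[where V=UNIV, simplified]) (auto simp: invW Q(4))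
    qed
  qed
  then show "smooth_germ x f"
    using x Q(2) chart_preimage_open[OF Q(1)] by (auto simp: smooth_near_def)
qed

end

lemma smooth_fun_iff: "open V \<Longrightarrow> smooth_fun A V f \<longleftrightarrow> (\<forall>x\<in>V. smooth_germ x f)"
proof
  assume "open V" and g: "\<forall>x\<in>V. smooth_germ x f"
  show "smooth_fun A V f"
    unfolding smooth_fun_def
  proof safe
    fix U \<phi> assume U: "(U, \<phi>) \<in> A"
    then have "(U, \<phi>) \<in> max_atlas" using atlas_subset by auto
    then have "smooth_at (\<phi> ` U) (\<phi> x) (f \<circ> inv_into U \<phi>)" if "x \<in> U" "x \<in> V" for x
      using smooth_near_iff_chart that g by (auto simp: o_def)
    then show "smooth_on (\<phi> ` (U \<inter> V)) (f \<circ> inv_into U \<phi>)"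
      by (auto simp: smooth_on_iff_smooth_at intro: smooth_at_subset[where D="\<phi> ` U"])
  qed
qed (auto simp: smooth_near_def)

lemma max_atlas_covers: obtains U \<phi> where "(U, \<phi>) \<in> max_atlas" "x \<in> U"
  using atlas_covers[of x] atlas_subset by blast

lemma smooth_germ_eventually: "smooth_germ x f \<Longrightarrow> \<forall>\<^sub>F y in nhds x. smooth_germ y f"
  by (auto simp: smooth_near_def eventually_nhds)

lemma smooth_germ_transform:
  assumes "smooth_germ x f" "\<forall>\<^sub>F y in nhds x. f y = g y"
  shows "smooth_germ x g"
proof -
  obtain U \<phi> where U: "(U, \<phi>) \<in> max_atlas" "x \<in> U" by (rule max_atlas_covers)
  obtain V where V: "open V" "x \<in> V" "\<And>y. y \<in> V \<Longrightarrow> f y = g y"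
    using assms(2) by (auto simp: eventually_nhds)
  obtain Q where Q: "open Q" "\<phi> ` (U \<inter> V) = \<phi> ` U \<inter> Q"
    using chart_image_openin[OF U(1) V(1)] by auto
  have "smooth_at (\<phi> ` U) (\<phi> x) (\<lambda>z. f (inv_into U \<phi> z))"
    using assms(1) smooth_near_iff_chart[OF U] by blast
  then have "smooth_at (\<phi> ` U \<inter> Q) (\<phi> x) (\<lambda>z. f (inv_into U \<phi> z))"
    by (rule smooth_at_subset) auto
  then have "smooth_at (\<phi> ` U) (\<phi> x) (\<lambda>z. g (inv_into U \<phi> z))"
  proof (rule smooth_at_cong_local)
    show "open Q" "\<phi> x \<in> Q" using Q U V by auto
    fix z assume "z \<in> \<phi> ` U" "z \<in> Q"
    then obtain y where "y \<in> U \<inter> V" "z = \<phi> y" using Q(2) by (metis IntI imageE)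
    then show "f (inv_into U \<phi> z) = g (inv_into U \<phi> z)" using U V(3) by (simp add: chart_inv[OF U(1)])
  qed
  then show ?thesis using smooth_near_iff_chart[OF U] by blast
qed

lemma smooth_germ_cong: "\<forall>\<^sub>F y in nhds x. f y = g y \<Longrightarrow> smooth_germ x f \<longleftrightarrow> smooth_germ x g"
  using smooth_germ_transform[of x f g] smooth_germ_transform[of x g f]
  by (auto simp: eq_commute)

lemma smooth_germ_const [simp, intro]: "smooth_germ x (\<lambda>_. c)"
  by (rule max_atlas_covers[of x]) (auto simp: smooth_near_iff_chart smooth_at_const)

lemma smooth_germ_add [intro]: "smooth_germ x f \<Longrightarrow> smooth_germ x g \<Longrightarrow> smooth_germ x (\<lambda>y. f y + g y)"
  by (rule max_atlas_covers[of x]) (auto simp: smooth_near_iff_chart intro: smooth_at_add)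

lemma smooth_germ_mult [intro]: "smooth_germ x f \<Longrightarrow> smooth_germ x g \<Longrightarrow> smooth_germ x (\<lambda>y. f y * g y)"
  by (rule max_atlas_covers[of x]) (auto simp: smooth_near_iff_chart intro: smooth_at_mult)

lemma smooth_germ_minus [intro]: "smooth_germ x f \<Longrightarrow> smooth_germ x (\<lambda>y. - f y)"
  using smooth_germ_mult[OF smooth_germ_const[of x "- 1"], of f] by simp

lemma smooth_germ_diff [intro]: "smooth_germ x f \<Longrightarrow> smooth_germ x g \<Longrightarrow> smooth_germ x (\<lambda>y. f y - g y)"
  using smooth_germ_add[OF _ smooth_germ_minus, of x f g] by simp

lemma smooth_germ_sum [intro]:
  "(\<And>i. i \<in> I \<Longrightarrow> smooth_germ x (f i)) \<Longrightarrow> smooth_germ x (\<lambda>y. \<Sum>i\<in>I. f i y)"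
  by (induction I rule: infinite_finite_induct) auto

lemma smooth_germ_prod [intro]:
  "(\<And>i. i \<in> I \<Longrightarrow> smooth_germ x (f i)) \<Longrightarrow> smooth_germ x (\<lambda>y. \<Prod>i\<in>I. f i y)"
  by (induction I rule: infinite_finite_induct) auto

text \<open>\<open>D\<close> need not be open, so \<open>g\<close> may be a function that is given
  on the image of a chart only.\<close>

lemma smooth_germ_compose:
  fixes w :: "'a \<Rightarrow> 'd::euclidean_space" and g :: "'d \<Rightarrow> real"
  assumes w: "\<And>b. b \<in> Basis \<Longrightarrow> smooth_germ x (\<lambda>y. w y \<bullet> b)"
    and D: "\<forall>\<^sub>F y in nhds x. w y \<in> D" and g: "smooth_at D (w x) g"
  shows "smooth_germ x (\<lambda>y. g (w y))"
proof -
  obtain U \<phi> where U: "(U, \<phi>) \<in> max_atlas" "x \<in> U" by (rule max_atlas_covers)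
  obtain V where V: "open V" "x \<in> V" "\<And>y. y \<in> V \<Longrightarrow> w y \<in> D"
    using D by (auto simp: eventually_nhds)
  obtain Q where Q: "open Q" "\<phi> ` (U \<inter> V) = \<phi> ` U \<inter> Q"
    using chart_image_openin[OF U(1) V(1)] by auto
  have "smooth_at (\<phi> ` U) (\<phi> x) (\<lambda>z. w (inv_into U \<phi> z))"
    by (rule smooth_at_components) (use w smooth_near_iff_chart[OF U] in auto)
  then have "smooth_at (\<phi> ` U \<inter> Q) (\<phi> x) (\<lambda>z. w (inv_into U \<phi> z))"
    by (rule smooth_at_subset) auto
  then have "smooth_at (\<phi> ` U \<inter> Q) (\<phi> x) (\<lambda>z. g (w (inv_into U \<phi> z)))"
    by (rule smooth_at_compose) (use g U V Q(2)[symmetric] chart_inv[OF U(1)] in auto)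
  then have "smooth_at (\<phi> ` U) (\<phi> x) (\<lambda>z. g (w (inv_into U \<phi> z)))"
    by (rule smooth_at_cong_local) (use Q U V in auto)
  then show ?thesis using smooth_near_iff_chart[OF U] by blast
qed

lemma smooth_germ_isCont:
  assumes "smooth_germ x f"
  shows "isCont f x"
proof -
  obtain U \<phi> where U: "(U, \<phi>) \<in> max_atlas" "x \<in> U" by (rule max_atlas_covers)
  obtain Q g where Q: "open Q" "\<phi> x \<in> Q" "\<And>k. C_k_on k Q g"
      "\<And>z. z \<in> \<phi> ` U \<inter> Q \<Longrightarrow> g z = f (inv_into U \<phi> z)"
    using assms unfolding smooth_near_iff_chart[OF U] smooth_at_def by blast
  have "isCont g (\<phi> x)"
    using Q(1,2) Q(3)[of 0] by (simp add: continuous_on_eq_continuous_at)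
  from continuous_at_compose[OF chart_isCont[OF U] this]
  have "isCont (\<lambda>y. g (\<phi> y)) x" by (simp add: o_def)
  moreover have "\<forall>\<^sub>F y in nhds x. g (\<phi> y) = f y"
    unfolding eventually_nhds using chart_preimage_open[OF U(1) Q(1)] U Q(2,4)
    by (intro exI[of _ "U \<inter> \<phi> -` Q"]) (auto simp: chart_inv[OF U(1)])
  ultimately show ?thesis by (simp add: isCont_cong)
qed

lemma smooth_germ_compose_real:
  assumes f: "smooth_germ x f" and "open G" "f x \<in> G" "\<And>k. C_k_on k G (g :: real \<Rightarrow> real)"
  shows "smooth_germ x (\<lambda>y. g (f y))"
proof (rule smooth_germ_compose[where D=G and w=f and g=g])
  show "\<forall>\<^sub>F y in nhds x. f y \<in> G"
    using smooth_germ_isCont[OF f] assms(2,3)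
    by (metis continuous_within eventually_nhds_conv_at tendsto_def topological_tendstoD)
  show "smooth_at G (f x) g" by (rule smooth_at_C_k[of G]) (use assms in auto)
qed (use f in auto)

lemma smooth_germ_exp: "smooth_germ x f \<Longrightarrow> smooth_germ x (\<lambda>y. exp (f y))"
  by (rule smooth_germ_compose_real[where G=UNIV]) (auto intro: C_k_on_exp)

lemma smooth_germ_inverse: "smooth_germ x f \<Longrightarrow> f x \<noteq> 0 \<Longrightarrow> smooth_germ x (\<lambda>y. inverse (f y))"
  by (rule smooth_germ_compose_real[where G="- {0}"]) (auto intro: C_k_on_inverse)

lemma smooth_germ_divide: "smooth_germ x f \<Longrightarrow> smooth_germ x g \<Longrightarrow> g x \<noteq> 0 \<Longrightarrow> smooth_germ x (\<lambda>y. f y / g y)"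
  by (auto simp: divide_inverse intro: smooth_germ_inverse)

lemma smooth_germ_ln_abs: "smooth_germ x f \<Longrightarrow> f x \<noteq> 0 \<Longrightarrow> smooth_germ x (\<lambda>y. ln \<bar>f y\<bar>)"
  by (rule smooth_germ_compose_real[where G="- {0}" and g="\<lambda>t. ln \<bar>t\<bar>"]) (auto intro: C_k_on_ln_abs)

lemma smooth_germ_ndet:
  "(\<And>i j. i < k \<Longrightarrow> j < k \<Longrightarrow> smooth_germ x (\<lambda>y. M y i j)) \<Longrightarrow> smooth_germ x (\<lambda>y. ndet k (M y))"
  unfolding ndet_permutes
  by (intro smooth_germ_sum smooth_germ_mult smooth_germ_prod smooth_germ_const)
    (use permutes_in_image in fastforce)

lemma smooth_germ_nadj:
  assumes "\<And>i j. i < k \<Longrightarrow> j < k \<Longrightarrow> smooth_germ x (\<lambda>y. M y i j)" "i < k" "j < k"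
  shows "smooth_germ x (\<lambda>y. nadj k (M y) i j)"
  unfolding nadj_minor[OF assms(2,3)]
  by (intro smooth_germ_mult smooth_germ_const smooth_germ_ndet) (use assms(1) in auto)

lemma smooth_germ_chart:
  assumes "(U, \<phi>) \<in> max_atlas" "x \<in> U"
  shows "smooth_germ x (\<lambda>y. \<phi> y \<bullet> b)"
  unfolding smooth_near_iff_chart[OF assms]
proof (rule smooth_at_cong_local[where V=UNIV])
  show "smooth_at (\<phi> ` U \<inter> UNIV) (\<phi> x) (\<lambda>z. z \<bullet> b)"
    by (rule smooth_at_C_k[of UNIV]) (auto intro: C_k_on_linear bounded_linear_inner_left)
qed (auto simp: chart_inv[OF assms(1)])

end

section \<open>Coordinates\<close>

text \<open>Orthonormal bases of \<open>L\<close> and of its orthogonal complement in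
  \<open>E\<close> are joined, that of \<open>L\<close> first. In a submanifold chart the
  coordinates with index below \<open>k\<close> then describe the submanifold and the others cut it
  out.\<close>

lemma adapted_orthonormal_basis:
  fixes E L :: "'e::euclidean_space set"
  assumes E: "subspace E" "dim E = n" and L: "subspace L" "L \<subseteq> E" "dim L = k"
  obtains b :: "nat \<Rightarrow> 'e" where
    "k \<le> n" "\<And>i. i < n \<Longrightarrow> b i \<in> E" "\<And>i. i < k \<Longrightarrow> b i \<in> L"
    "\<And>i j. i < n \<Longrightarrow> j < n \<Longrightarrow> b i \<bullet> b j = (if i = j then 1 else 0)"
    "\<And>z. z \<in> E \<Longrightarrow> (\<Sum>i<n. (z \<bullet> b i) *\<^sub>R b i) = z"
    "\<And>z. z \<in> E \<Longrightarrow> z \<in> L \<longleftrightarrow> (\<forall>i. k \<le> i \<and> i < n \<longrightarrow> z \<bullet> b i = 0)"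
proof -
  define L' where "L' = {y \<in> E. \<forall>x\<in>L. orthogonal x y}"
  have "subspace L'"
    using E(1) unfolding L'_def subspace_def by (auto simp: orthogonal_clauses)
  have dims: "dim L' + k = n"
    using dim_subspace_orthogonal_to_vectors[OF L(1) E(1) L(2)] E(2) L(3) by (simp add: L'_def)
  obtain B1 where B1: "B1 \<subseteq> L" "pairwise orthogonal B1" "\<And>x. x \<in> B1 \<Longrightarrow> norm x = 1"
      "independent B1" "card B1 = k" "span B1 = L"
    using orthonormal_basis_subspace[OF L(1)] L(3) by metis
  obtain B2 where B2: "B2 \<subseteq> L'" "pairwise orthogonal B2" "\<And>x. x \<in> B2 \<Longrightarrow> norm x = 1"
      "independent B2" "card B2 = dim L'" "span B2 = L'"
    using orthonormal_basis_subspace[OF \<open>subspace L'\<close>] by metis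
  have fin: "finite B1" "finite B2" using B1 B2 independent_imp_finite by auto
  obtain b1 where b1: "bij_betw b1 {0..<k} B1" using ex_bij_betw_nat_finite[OF fin(1)] B1(5) by auto
  obtain b2 where b2: "bij_betw b2 {0..<dim L'} B2" using ex_bij_betw_nat_finite[OF fin(2)] B2(5) by auto
  define b where "b = (\<lambda>i. if i < k then b1 i else b2 (i - k))"
  have b1_in: "b i \<in> B1" if "i < k" for i
    using that b1 by (auto simp: b_def bij_betw_def)
  have b2_in: "b i \<in> B2" if "k \<le> i" "i < n" for i
    using that b2 dims by (auto simp: b_def bij_betw_def)
  have b1_ex: "\<exists>i<k. b i = x" if "x \<in> B1" for x
    using that b1 by (force simp: b_def bij_betw_def)
  have b2_ex: "\<exists>i. k \<le> i \<and> i < n \<and> b i = x" if x: "x \<in> B2" for x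
  proof -
    obtain j where "j < dim L'" "b2 j = x" using x b2 by (force simp: bij_betw_def)
    then show ?thesis using dims by (intro exI[of _ "j + k"]) (auto simp: b_def)
  qed
  have b1_inj: "b i \<noteq> b j" if "i < k" "j < k" "i \<noteq> j" for i j
    using that b1 by (auto simp: b_def bij_betw_def inj_on_def)
  have b2_inj: "b i \<noteq> b j" if "k \<le> i" "k \<le> j" "i < n" "j < n" "i \<noteq> j" for i j
  proof -
    have "i - k \<in> {0..<dim L'}" "j - k \<in> {0..<dim L'}" "i - k \<noteq> j - k" using that dims by auto
    then show ?thesis using that b2 by (auto simp: b_def bij_betw_def inj_on_def)
  qed
  have cross: "x \<bullet> y = 0" if "x \<in> L" "y \<in> L'" for x y
    using that by (auto simp: L'_def orthogonal_def)
  have orth: "b i \<bullet> b j = (if i = j then 1 else 0)" if "i < n" "j < n" for i j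
  proof (cases "i = j")
    case True
    have "norm (b i) = 1" using that b1_in[of i] b2_in[of i] B1(3) B2(3) by (cases "i < k") auto
    then show ?thesis using True by (simp add: norm_eq_1)
  next
    case False
    consider "i < k" "j < k" | "i < k" "k \<le> j" | "k \<le> i" "j < k" | "k \<le> i" "k \<le> j" by linarith
    then have "b i \<bullet> b j = 0"
    proof cases
      case 1
      then show ?thesis using B1(2) b1_in b1_inj False by (auto simp: pairwise_def orthogonal_def)
    next
      case 2
      then show ?thesis using cross b1_in b2_in B1(1) B2(1) that by blast
    next
      case 3
      then show ?thesis using cross[of "b j" "b i"] b1_in b2_in B1(1) B2(1) that
        by (auto simp: inner_commute)
    next
      case 4
      then show ?thesis using B2(2) b2_in b2_inj False that by (auto simp: pairwise_def orthogonal_def)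
    qed
    then show ?thesis using False by simp
  qed
  have bE: "b i \<in> E" if "i < n" for i
    using that b1_in[of i] b2_in[of i] B1(1) B2(1) L(2) by (cases "i < k") (auto simp: L'_def)
  have rep: "(\<Sum>i<n. (z \<bullet> b i) *\<^sub>R b i) = z" if z: "z \<in> E" for z
  proof -
    \<comment> \<open>The remainder is orthogonal to all basis vectors: orthogonality to
      \<open>L\<close> puts it into \<open>L'\<close>, and orthogonality to \<open>L'\<close> then
      makes it orthogonal to itself.\<close>
    define r where "r = z - (\<Sum>i<n. (z \<bullet> b i) *\<^sub>R b i)"
    have rE: "r \<in> E"
      unfolding r_def using z bE E(1) by (intro subspace_diff subspace_sum subspace_scale) auto
    have "(\<Sum>i<n. (z \<bullet> b i) *\<^sub>R b i) \<bullet> b j = z \<bullet> b j" if "j < n" for j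
    proof -
      have "(\<Sum>i<n. (z \<bullet> b i) *\<^sub>R b i) \<bullet> b j = (\<Sum>i<n. if i = j then z \<bullet> b i else 0)"
        unfolding inner_sum_left by (rule sum.cong) (use that orth in auto)
      then show ?thesis using that by simp
    qed
    then have r0: "r \<bullet> b j = 0" if "j < n" for j
      using that by (simp add: r_def inner_diff_left)
    have "orthogonal r x" if "x \<in> L" for x
    proof (rule orthogonal_to_span)
      show "x \<in> span B1" using that B1(6) by simp
      show "orthogonal r y" if "y \<in> B1" for y
        using b1_ex[OF that] r0 dims by (auto simp: orthogonal_def)
    qed
    then have rL: "r \<in> L'" using rE by (auto simp: L'_def orthogonal_commute)
    have "orthogonal r r"
    proof (rule orthogonal_to_span)
      show "r \<in> span B2" using rL B2(6) by simp
      show "orthogonal r y" if "y \<in> B2" for y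
        using b2_ex[OF that] r0 by (auto simp: orthogonal_def)
    qed
    then show ?thesis by (simp add: orthogonal_self r_def)
  qed
  have iff: "z \<in> L \<longleftrightarrow> (\<forall>i. k \<le> i \<and> i < n \<longrightarrow> z \<bullet> b i = 0)" if z: "z \<in> E" for z
  proof
    assume "z \<in> L"
    then show "\<forall>i. k \<le> i \<and> i < n \<longrightarrow> z \<bullet> b i = 0" using cross b2_in B2(1) by blast
  next
    assume 0: "\<forall>i. k \<le> i \<and> i < n \<longrightarrow> z \<bullet> b i = 0"
    have "(\<Sum>i<n. (z \<bullet> b i) *\<^sub>R b i) \<in> L"
    proof (rule subspace_sum[OF L(1)])
      fix i assume "i \<in> {..<n}"
      then show "(z \<bullet> b i) *\<^sub>R b i \<in> L"
        using 0 b1_in[of i] B1(1) L(1) by (cases "i < k") (auto simp: subspace_scale subspace_0)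
    qed
    then show "z \<in> L" using rep[OF z] by simp
  qed
  have kn: "k \<le> n" using dims by simp
  have bL: "b i \<in> L" if "i < k" for i using b1_in[OF that] B1(1) by blast
  show ?thesis by (rule that[OF kn bE bL orth rep iff])
qed

section \<open>Coordinate frames obtained from charts\<close>

context smooth_mfd
begin

lemma tangent_spaceI:
  assumes "\<And>f. \<not> smooth_germ x f \<Longrightarrow> v f = 0"
    "\<And>f g. smooth_germ x f \<Longrightarrow> \<forall>\<^sub>F y in nhds x. f y = g y \<Longrightarrow> v f = v g"
    "\<And>f g. smooth_germ x f \<Longrightarrow> smooth_germ x g \<Longrightarrow> v (\<lambda>y. f y + g y) = v f + v g"
    "\<And>r f. smooth_germ x f \<Longrightarrow> v (\<lambda>y. r * f y) = r * v f"
    "\<And>f g. smooth_germ x f \<Longrightarrow> smooth_germ x g \<Longrightarrow> v (\<lambda>y. f y * g y) = v f * g x + f x * v g"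
  shows "v \<in> tangent_space A x"
  unfolding tangent_space_def mem_Collect_eq
  by (intro conjI allI impI; (elim conjE)?; rule assms; assumption)

lemma tangent_spaceD:
  assumes "v \<in> tangent_space A x"
  shows "\<And>f. \<not> smooth_germ x f \<Longrightarrow> v f = 0"
    "\<And>f g. smooth_germ x f \<Longrightarrow> \<forall>\<^sub>F y in nhds x. f y = g y \<Longrightarrow> v f = v g"
    "\<And>f g. smooth_germ x f \<Longrightarrow> smooth_germ x g \<Longrightarrow> v (\<lambda>y. f y + g y) = v f + v g"
    "\<And>r f. smooth_germ x f \<Longrightarrow> v (\<lambda>y. r * f y) = r * v f"
    "\<And>f g. smooth_germ x f \<Longrightarrow> smooth_germ x g \<Longrightarrow> v (\<lambda>y. f y * g y) = v f * g x + f x * v g"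
proof -
  note T = assms[unfolded tangent_space_def mem_Collect_eq]
  note T2 = T[THEN conjunct2] and T3 = T[THEN conjunct2, THEN conjunct2]
    and T4 = T[THEN conjunct2, THEN conjunct2, THEN conjunct2]
  show "\<And>f. \<not> smooth_germ x f \<Longrightarrow> v f = 0" by (rule T[THEN conjunct1, rule_format])
  show "\<And>f g. smooth_germ x f \<Longrightarrow> \<forall>\<^sub>F y in nhds x. f y = g y \<Longrightarrow> v f = v g"
    by (rule T2[THEN conjunct1, rule_format, OF conjI])
  show "\<And>f g. smooth_germ x f \<Longrightarrow> smooth_germ x g \<Longrightarrow> v (\<lambda>y. f y + g y) = v f + v g"
    by (rule T3[THEN conjunct1, rule_format, OF conjI])
  show "\<And>r f. smooth_germ x f \<Longrightarrow> v (\<lambda>y. r * f y) = r * v f"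
    by (rule T4[THEN conjunct1, rule_format])
  show "\<And>f g. smooth_germ x f \<Longrightarrow> smooth_germ x g \<Longrightarrow> v (\<lambda>y. f y * g y) = v f * g x + f x * v g"
    by (rule T4[THEN conjunct2, rule_format, OF conjI])
qed

lemma vector_field_iff:
  assumes "open V"
  shows "vector_field A V Y \<longleftrightarrow> (\<forall>x\<in>V. Y x \<in> tangent_space A x) \<and>
    (\<forall>x\<in>V. \<forall>f. smooth_germ x f \<longrightarrow> smooth_germ x (\<lambda>y. Y y f))"
proof -
  have "smooth_germ x (\<lambda>y. Y y f)" if *: "vector_field A V Y" "x \<in> V" "smooth_germ x f" for x f
  proof -
    obtain W where W: "open W" "x \<in> W" "smooth_fun A W f" using *(3) by (auto simp: smooth_near_def)
    have f: "smooth_fun A (W \<inter> V) f" using W assms by (simp add: smooth_fun_iff open_Int)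
    have "smooth_fun A (W \<inter> V) (\<lambda>y. Y y f)"
      using *(1) f open_Int[OF W(1) assms] unfolding vector_field_def by blast
    then show ?thesis using W *(2) assms by (auto simp: smooth_near_def)
  qed
  then show ?thesis by (auto simp: vector_field_def smooth_fun_iff)
qed

text \<open>The last clause is the conclusion of Hadamard's lemma. It is the analytic input behind
  the expansion of derivations in a frame, so that later arguments can work with functions and
  derivations instead of charts.\<close>

definition coordinates :: "'a set \<Rightarrow> (nat \<Rightarrow> 'a \<Rightarrow> real) \<Rightarrow> (nat \<Rightarrow> 'a vfield) \<Rightarrow> bool" where
  "coordinates V X D \<longleftrightarrow> open V \<and> (\<forall>x\<in>V. \<forall>i<n. smooth_germ x (X i)) \<and>
     (\<forall>i<n. vector_field A V (D i)) \<and>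
     (\<forall>x\<in>V. \<forall>i<n. \<forall>j<n. D i x (X j) = (if i = j then 1 else 0)) \<and>
     (\<forall>x\<in>V. \<forall>f. smooth_germ x f \<longrightarrow> (\<exists>g. (\<forall>i<n. smooth_germ x (g i)) \<and>
        (\<forall>\<^sub>F y in nhds x. f y = f x + (\<Sum>i<n. (X i y - X i x) * g i y))))"

text \<open>The directional derivative read in a chart. It is meaningful for \<open>b\<close> in the
  model subspace, where the line through the image point stays in the image of the chart for small
  \<open>t\<close>.\<close>

definition chart_deriv :: "('a, 'e) chart \<Rightarrow> 'e \<Rightarrow> 'a vfield" where
  "chart_deriv c b x f = (if smooth_germ x f
     then deriv (\<lambda>t. f (inv_into (fst c) (snd c) (snd c x + t *\<^sub>R b))) 0 else 0)"

context
  fixes U \<phi> E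
  assumes chart: "(U, \<phi>) \<in> max_atlas"
    and E: "subspace E" "openin (top_of_set E) (\<phi> ` U)"
begin

lemma smooth_germ_extension:
  assumes "x \<in> U" "smooth_germ x f"
  obtains r G where "r > 0" "\<And>k. C_k_on k (ball (\<phi> x) r) G" "E \<inter> ball (\<phi> x) r \<subseteq> \<phi> ` U"
    "\<And>y. y \<in> U \<Longrightarrow> \<phi> y \<in> ball (\<phi> x) r \<Longrightarrow> G (\<phi> y) = f y"
proof -
  obtain Q G where Q: "open Q" "\<phi> x \<in> Q" "\<And>k. C_k_on k Q G"
      "\<And>z. z \<in> \<phi> ` U \<inter> Q \<Longrightarrow> G z = f (inv_into U \<phi> z)"
    using assms unfolding smooth_near_iff_chart[OF chart assms(1)] smooth_at_def by blast
  obtain W where W: "open W" "\<phi> ` U = E \<inter> W" using E(2) by (auto simp: openin_open)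
  have "open (Q \<inter> W)" "\<phi> x \<in> Q \<inter> W" using Q W assms(1) by auto
  then obtain r where r: "r > 0" "ball (\<phi> x) r \<subseteq> Q \<inter> W" using openE by blast
  show ?thesis
  proof (rule that[OF r(1)])
    show "C_k_on k (ball (\<phi> x) r) G" for k using Q(3) r(2) C_k_on_subset by blast
    show "E \<inter> ball (\<phi> x) r \<subseteq> \<phi> ` U" using r(2) W(2) by auto
    show "G (\<phi> y) = f y" if "y \<in> U" "\<phi> y \<in> ball (\<phi> x) r" for y
      using that Q(4)[of "\<phi> y"] r(2) by (auto simp: chart_inv[OF chart])
  qed
qed

text \<open>The line \<open>\<phi> x + t *\<^sub>R b\<close> stays in \<open>E\<close>, hence for
  small \<open>t\<close> in the image of the chart, where \<open>G\<close> agrees with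
  \<open>f\<close>. So the derivative does not depend on the chosen extension
  \<open>G\<close>.\<close>

lemma chart_deriv_works:
  assumes x: "x \<in> U" and b: "b \<in> E" and r: "E \<inter> ball (\<phi> x) r \<subseteq> \<phi> ` U" "open Q" "\<phi> x \<in> Q" "r > 0"
    and G: "\<And>k. C_k_on k Q G" "\<And>y. y \<in> U \<Longrightarrow> \<phi> y \<in> Q \<Longrightarrow> G (\<phi> y) = f y"
  shows "((\<lambda>t. f (inv_into U \<phi> (\<phi> x + t *\<^sub>R b))) has_real_derivative
    frechet_derivative G (at (\<phi> x)) b) (at 0)"
proof -
  have DG: "(G has_derivative frechet_derivative G (at (\<phi> x))) (at (\<phi> x))"
    using G(1)[of 1] r(3) by (simp add: frechet_derivative_works[symmetric])
  let ?c = "\<lambda>t. \<phi> x + t *\<^sub>R b"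
  have c: "(?c has_derivative (\<lambda>t. t *\<^sub>R b)) (at 0)" by (auto intro!: derivative_eq_intros)
  have "((\<lambda>t. G (?c t)) has_derivative (\<lambda>t. frechet_derivative G (at (\<phi> x)) (t *\<^sub>R b))) (at 0)"
    using diff_chain_at[OF c] DG by (simp add: o_def)
  then have D: "((\<lambda>t. G (?c t)) has_real_derivative frechet_derivative G (at (\<phi> x)) b) (at 0)"
    using linear_scale[OF has_derivative_linear[OF DG]]
    by (simp add: has_field_derivative_def mult_commute_abs)
  have "isCont ?c 0" by (intro continuous_intros)
  then have op: "open (?c -` (Q \<inter> ball (\<phi> x) r))"
    using r by (intro open_vimage open_Int) (auto intro!: continuous_intros)
  show ?thesis
  proof (rule has_field_derivative_transform_within_open[OF D op])
    show "0 \<in> ?c -` (Q \<inter> ball (\<phi> x) r)" using r by simp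
    fix t assume t: "t \<in> ?c -` (Q \<inter> ball (\<phi> x) r)"
    have "?c t \<in> E"
      using E x b openin_imp_subset[OF E(2)] by (intro subspace_add subspace_scale) auto
    then obtain y where "y \<in> U" "?c t = \<phi> y" using t r(1) by auto
    then show "G (?c t) = f (inv_into U \<phi> (?c t))"
      using G(2)[of y] t by (simp add: chart_inv[OF chart])
  qed
qed

lemma chart_deriv_eq:
  assumes x: "x \<in> U" and b: "b \<in> E" and Q: "open Q" "\<phi> x \<in> Q"
    and G: "\<And>k. C_k_on k Q G" "\<And>y. y \<in> U \<Longrightarrow> \<phi> y \<in> Q \<Longrightarrow> G (\<phi> y) = f y"
  shows "smooth_germ x f" "chart_deriv (U, \<phi>) b x f = frechet_derivative G (at (\<phi> x)) b"
proof -
  show f: "smooth_germ x f"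
    unfolding smooth_near_iff_chart[OF chart x]
    by (rule smooth_atI[OF Q G(1)]) (use G(2) in \<open>auto simp: chart_inv[OF chart]\<close>)
  obtain r where "r > 0" "E \<inter> ball (\<phi> x) r \<subseteq> \<phi> ` U"
    using smooth_germ_extension[OF x f] by metis
  from DERIV_imp_deriv[OF chart_deriv_works[OF x b this(2) Q this(1) G]]
  show "chart_deriv (U, \<phi>) b x f = frechet_derivative G (at (\<phi> x)) b"
    using f by (simp add: chart_deriv_def)
qed

lemma chart_deriv_DERIV:
  assumes "x \<in> U" "b \<in> E" "smooth_germ x f"
  shows "((\<lambda>t. f (inv_into U \<phi> (\<phi> x + t *\<^sub>R b))) has_real_derivative chart_deriv (U, \<phi>) b x f) (at 0)"
proof -
  obtain r G where "r > 0" "\<And>k. C_k_on k (ball (\<phi> x) r) G" "E \<inter> ball (\<phi> x) r \<subseteq> \<phi> ` U"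
    "\<And>y. y \<in> U \<Longrightarrow> \<phi> y \<in> ball (\<phi> x) r \<Longrightarrow> G (\<phi> y) = f y"
    using smooth_germ_extension[OF assms(1,3)] by metis
  then have D: "((\<lambda>t. f (inv_into U \<phi> (\<phi> x + t *\<^sub>R b))) has_real_derivative
      frechet_derivative G (at (\<phi> x)) b) (at 0)"
    by (intro chart_deriv_works[where r=r and Q="ball (\<phi> x) r"] assms) auto
  from D DERIV_imp_deriv[OF D] show ?thesis using assms(3) by (simp add: chart_deriv_def)
qed

text \<open>For \<open>b\<close> in \<open>L\<close> the line through \<open>\<phi> x\<close> stays
  in \<open>L\<close>, so for small \<open>t\<close> it runs inside the image of \<open>S\<close>,
  and \<open>f\<close> vanishes along it.\<close>

lemma chart_deriv_tangential:
  assumes L: "subspace L" "L \<subseteq> E" "\<phi> ` (U \<inter> S) = \<phi> ` U \<inter> L" and b: "b \<in> L"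
    and x: "x \<in> U" "x \<in> S" and f: "smooth_germ x f" "\<forall>\<^sub>F y in nhds x. y \<in> S \<longrightarrow> f y = 0"
  shows "chart_deriv (U, \<phi>) b x f = 0"
proof -
  obtain V where V: "open V" "x \<in> V" "\<And>y. y \<in> V \<Longrightarrow> y \<in> S \<Longrightarrow> f y = 0"
    using f(2) by (auto simp: eventually_nhds)
  obtain W where W: "open W" "\<phi> ` (U \<inter> V) = \<phi> ` U \<inter> W"
    using chart_image_openin[OF chart V(1)] by metis
  obtain Q where Q: "open Q" "\<phi> ` U = E \<inter> Q" using E(2) by (auto simp: openin_open)
  let ?c = "\<lambda>t. \<phi> x + t *\<^sub>R b"
  have op: "open (?c -` (Q \<inter> W))"
    using W Q by (intro open_vimage open_Int) (auto intro!: continuous_intros)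
  have xQW: "\<phi> x \<in> Q \<inter> W" using W Q x V(2) by blast
  have "\<phi> x \<in> \<phi> ` (U \<inter> S)" using x by auto
  then have xL: "\<phi> x \<in> L" using L(3) by auto
  have "((\<lambda>t. f (inv_into U \<phi> (?c t))) has_real_derivative 0) (at 0)"
  proof (rule has_field_derivative_transform_within_open[OF DERIV_const op])
    show "0 \<in> ?c -` (Q \<inter> W)" using xQW by simp
    fix t assume t: "t \<in> ?c -` (Q \<inter> W)"
    have cL: "?c t \<in> L" using L(1) xL b by (intro subspace_add subspace_scale)
    then have "?c t \<in> \<phi> ` U" using t Q(2) L(2) by auto
    then have "?c t \<in> \<phi> ` (U \<inter> S)" "?c t \<in> \<phi> ` (U \<inter> V)" using cL t L(3) W(2) by auto
    then obtain y z where "y \<in> U" "y \<in> S" "?c t = \<phi> y" "z \<in> U" "z \<in> V" "?c t = \<phi> z" by auto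
    moreover from this have "y = z" by (intro chart_inj[OF chart]) auto
    ultimately show "0 = f (inv_into U \<phi> (?c t))"
      using V(3)[of y] by (simp add: chart_inv[OF chart])
  qed
  then show ?thesis
    using DERIV_unique chart_deriv_DERIV[OF x(1) subsetD[OF L(2) b] f(1)] by blast
qed

lemma vector_field_chart_deriv:
  assumes b: "b \<in> E"
  shows "vector_field A U (chart_deriv (U, \<phi>) b)"
  unfolding vector_field_iff[OF chart_open[OF chart]]
proof safe
  fix x assume x: "x \<in> U"
  note D = chart_deriv_DERIV[OF x b]
  let ?D = "chart_deriv (U, \<phi>) b x"
  have x0: "inv_into U \<phi> (\<phi> x + 0 *\<^sub>R b) = x" using x by (simp add: chart_inv[OF chart])
  show "?D \<in> tangent_space A x"
  proof (rule tangent_spaceI)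
    show "?D f = ?D g" if f: "smooth_germ x f" and eq: "\<forall>\<^sub>F y in nhds x. f y = g y" for f g
    proof -
      obtain r G where r: "r > 0" "\<And>k. C_k_on k (ball (\<phi> x) r) G" "E \<inter> ball (\<phi> x) r \<subseteq> \<phi> ` U"
          "\<And>y. y \<in> U \<Longrightarrow> \<phi> y \<in> ball (\<phi> x) r \<Longrightarrow> G (\<phi> y) = f y"
        using smooth_germ_extension[OF x f] by metis
      obtain V where V: "open V" "x \<in> V" "\<And>y. y \<in> V \<Longrightarrow> f y = g y"
        using eq by (auto simp: eventually_nhds)
      obtain W where W: "open W" "\<phi> ` (U \<inter> V) = \<phi> ` U \<inter> W"
        using chart_image_openin[OF chart V(1)] by metis
      have sub: "y \<in> V" if "y \<in> U" "\<phi> y \<in> W" for y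
      proof -
        have "\<phi> y \<in> \<phi> ` (U \<inter> V)" using that W(2) by auto
        then show ?thesis using chart_inj[OF chart that(1)] by auto
      qed
      \<comment> \<open>On this smaller set \<open>G\<close> extends \<open>g\<close> as well as
        \<open>f\<close>, so both derivatives are computed from \<open>G\<close>.\<close>
      have CG: "C_k_on k (ball (\<phi> x) r \<inter> W) G" for k by (rule C_k_on_subset[OF r(2)]) auto
      have Q: "open (ball (\<phi> x) r \<inter> W)" "\<phi> x \<in> ball (\<phi> x) r \<inter> W" using r(1) W x V(2) by auto
      have "?D f = frechet_derivative G (at (\<phi> x)) b"
        by (rule chart_deriv_eq(2)[OF x b Q CG]) (use r(4) in auto)
      moreover have "?D g = frechet_derivative G (at (\<phi> x)) b"
        by (rule chart_deriv_eq(2)[OF x b Q CG]) (use r(4) V(3) sub in auto)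
      ultimately show ?thesis by simp
    qed
    show "?D (\<lambda>y. f y + g y) = ?D f + ?D g" if "smooth_germ x f" "smooth_germ x g" for f g
      using DERIV_unique[OF D[OF smooth_germ_add[OF that]] DERIV_add[OF D[OF that(1)] D[OF that(2)]]] .
    show "?D (\<lambda>y. r * f y) = r * ?D f" if "smooth_germ x f" for f r
      using DERIV_unique[OF D[OF smooth_germ_mult[OF smooth_germ_const that]] DERIV_cmult[OF D[OF that]]] .
    show "?D (\<lambda>y. f y * g y) = ?D f * g x + f x * ?D g" if "smooth_germ x f" "smooth_germ x g" for f g
      using DERIV_unique[OF D[OF smooth_germ_mult[OF that]] DERIV_mult[OF D[OF that(1)] D[OF that(2)]]]
      by (simp add: x0[simplified])
  qed (simp add: chart_deriv_def)
  show "smooth_germ x (\<lambda>y. chart_deriv (U, \<phi>) b y f)" if f: "smooth_germ x f" for f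
  proof -
    obtain r G where r: "r > 0" "\<And>k. C_k_on k (ball (\<phi> x) r) G" "E \<inter> ball (\<phi> x) r \<subseteq> \<phi> ` U"
        "\<And>y. y \<in> U \<Longrightarrow> \<phi> y \<in> ball (\<phi> x) r \<Longrightarrow> G (\<phi> y) = f y"
      using smooth_germ_extension[OF x f] by metis
    have eq: "chart_deriv (U, \<phi>) b y f = frechet_derivative G (at (\<phi> y)) b"
      if "y \<in> U" "\<phi> y \<in> ball (\<phi> x) r" for y
      by (rule chart_deriv_eq(2)[OF that(1) b open_ball that(2) r(2)]) (use r(4) in auto)
    show ?thesis
    proof (rule chart_deriv_eq(1)[OF x b open_ball, of "\<phi> x" r "\<lambda>z. frechet_derivative G (at z) b"])
      show "C_k_on k (ball (\<phi> x) r) (\<lambda>z. frechet_derivative G (at z) b)" for k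
        using r(2)[of "Suc k"] by simp
    qed (use eq r(1) in auto)
  qed
qed

lemma chart_coordinates:
  assumes b: "\<And>i. i < n \<Longrightarrow> b i \<in> E"
    "\<And>i j. i < n \<Longrightarrow> j < n \<Longrightarrow> b i \<bullet> b j = (if i = j then 1 else 0)"
    "\<And>z. z \<in> E \<Longrightarrow> (\<Sum>i<n. (z \<bullet> b i) *\<^sub>R b i) = z"
  shows "coordinates U (\<lambda>i y. \<phi> y \<bullet> b i) (\<lambda>i. chart_deriv (U, \<phi>) (b i))"
  unfolding coordinates_def
proof (intro conjI ballI allI impI)
  show "open U" by (rule chart_open[OF chart])
  show "smooth_germ x (\<lambda>y. \<phi> y \<bullet> b i)" if "x \<in> U" "i < n" for x i
    by (rule smooth_germ_chart[OF chart that(1)])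
  show "vector_field A U (chart_deriv (U, \<phi>) (b i))" if "i < n" for i
    by (rule vector_field_chart_deriv[OF b(1)[OF that]])
  show "chart_deriv (U, \<phi>) (b i) x (\<lambda>y. \<phi> y \<bullet> b j) = (if i = j then 1 else 0)"
    if *: "x \<in> U" "i < n" "j < n" for x i j
  proof -
    have "chart_deriv (U, \<phi>) (b i) x (\<lambda>y. \<phi> y \<bullet> b j) = frechet_derivative (\<lambda>z. z \<bullet> b j) (at (\<phi> x)) (b i)"
      by (rule chart_deriv_eq(2)[OF *(1) b(1)[OF *(2)] open_UNIV])
        (auto intro: C_k_on_linear bounded_linear_inner_left)
    also have "frechet_derivative (\<lambda>z. z \<bullet> b j) (at (\<phi> x)) = (\<lambda>z. z \<bullet> b j)"
      by (rule frechet_derivative_at[symmetric]) (intro bounded_linear_imp_has_derivative bounded_linear_inner_left)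
    finally show ?thesis using b(2)[OF *(2,3)] by simp
  qed
  fix x f assume x: "x \<in> U" and f: "smooth_germ x f"
  obtain r G where r: "r > 0" "\<And>k. C_k_on k (ball (\<phi> x) r) G" "E \<inter> ball (\<phi> x) r \<subseteq> \<phi> ` U"
      "\<And>y. y \<in> U \<Longrightarrow> \<phi> y \<in> ball (\<phi> x) r \<Longrightarrow> G (\<phi> y) = f y"
    using smooth_germ_extension[OF x f] by metis
  \<comment> \<open>Hadamard's lemma is applied to the extension \<open>G\<close> in the ambient
    Euclidean space. The increments \<open>\<phi> y - \<phi> x\<close> lie in \<open>E\<close>, so
    only the \<open>n\<close> directions \<open>b i\<close> occur.\<close>
  show "\<exists>g. (\<forall>i<n. smooth_germ x (g i)) \<and>
      (\<forall>\<^sub>F y in nhds x. f y = f x + (\<Sum>i<n. (\<phi> y \<bullet> b i - \<phi> x \<bullet> b i) * g i y))"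
  proof (rule Hadamard[OF r(2)])
  fix H assume H: "\<And>k b. C_k_on k (ball (\<phi> x) r) (H b)"
    "\<And>z (I :: nat set) b c. z \<in> ball (\<phi> x) r \<Longrightarrow> finite I \<Longrightarrow> z - \<phi> x = (\<Sum>i\<in>I. c i *\<^sub>R b i) \<Longrightarrow>
       G z = G (\<phi> x) + (\<Sum>i\<in>I. c i * H (b i) z)"
  have g: "smooth_germ x (\<lambda>y. H (b i) (\<phi> y))" for i
    using chart_deriv_eq(1)[OF x subspace_0[OF E(1)] open_ball, of "\<phi> x" r "H (b i)"] H(1) r(1) by auto
  have "f y = f x + (\<Sum>i<n. (\<phi> y \<bullet> b i - \<phi> x \<bullet> b i) * H (b i) (\<phi> y))"
    if y: "y \<in> U \<inter> \<phi> -` ball (\<phi> x) r" for y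
  proof -
    have "\<phi> y \<in> \<phi> ` U" by (rule imageI) (use y in simp)
    moreover have "\<phi> x \<in> \<phi> ` U" by (rule imageI[OF x])
    ultimately have "\<phi> y \<in> E" "\<phi> x \<in> E" using openin_imp_subset[OF E(2)] by blast+
    then have "\<phi> y - \<phi> x \<in> E" by (rule subspace_diff[OF E(1)])
    then have "\<phi> y - \<phi> x = (\<Sum>i<n. (\<phi> y \<bullet> b i - \<phi> x \<bullet> b i) *\<^sub>R b i)"
      using b(3)[of "\<phi> y - \<phi> x"] by (simp add: inner_diff_left)
    from H(2)[OF _ finite_lessThan this]
    have "G (\<phi> y) = G (\<phi> x) + (\<Sum>i<n. (\<phi> y \<bullet> b i - \<phi> x \<bullet> b i) * H (b i) (\<phi> y))"
      using y by blast
    moreover have "G (\<phi> y) = f y" by (rule r(4)) (use y in auto)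
    moreover have "G (\<phi> x) = f x" by (rule r(4)) (use x r(1) in auto)
    ultimately show ?thesis by linarith
  qed
  moreover have "x \<in> U \<inter> \<phi> -` ball (\<phi> x) r" using x r(1) by simp
  ultimately have "\<forall>\<^sub>F y in nhds x. f y = f x + (\<Sum>i<n. (\<phi> y \<bullet> b i - \<phi> x \<bullet> b i) * H (b i) (\<phi> y))"
    unfolding eventually_nhds using chart_preimage_open[OF chart open_ball] by blast
  with g show ?thesis
    by (intro exI[of _ "\<lambda>i y. H (b i) (\<phi> y)"] conjI allI impI)
  qed
qed

end

section \<open>Coordinates adapted to a submanifold\<close>

definition adapted_coordinates ::
    "nat \<Rightarrow> 'a set \<Rightarrow> 'a set \<Rightarrow> (nat \<Rightarrow> 'a \<Rightarrow> real) \<Rightarrow> (nat \<Rightarrow> 'a vfield) \<Rightarrow> bool" where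
  "adapted_coordinates k S V X D \<longleftrightarrow> coordinates V X D \<and> k \<le> n \<and>
     (\<forall>y\<in>V. y \<in> S \<longleftrightarrow> (\<forall>i. k \<le> i \<and> i < n \<longrightarrow> X i y = 0)) \<and>
     (\<forall>y\<in>V \<inter> S. \<forall>i<k. D i y \<in> submanifold_tangent A S y)"

lemma coordinates_exist:
  obtains V X D where "coordinates V X D" "x \<in> V"
proof -
  obtain U \<phi> where U: "(U, \<phi>) \<in> max_atlas" "x \<in> U" by (rule max_atlas_covers)
  obtain E where E: "subspace E" "dim E = n" "openin (top_of_set E) (\<phi> ` U)"
    using is_chart_chart[OF U(1)] by (auto simp: is_chart_def)
  \<comment> \<open>The zero subspace plays the part of \<open>L\<close>: only an orthonormal basis
    of \<open>E\<close> is wanted.\<close>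
  have 0: "subspace {0::'e}" by (rule subspace_single_0)
  have 00: "{0} \<subseteq> E" using subspace_0[OF E(1)] by simp
  show ?thesis
  proof (rule adapted_orthonormal_basis[OF E(1,2) 0 00 refl])
    fix b :: "nat \<Rightarrow> 'e" assume b:
      "\<And>i. i < n \<Longrightarrow> b i \<in> E" "\<And>i j. i < n \<Longrightarrow> j < n \<Longrightarrow> b i \<bullet> b j = (if i = j then 1 else 0)"
      "\<And>z. z \<in> E \<Longrightarrow> (\<Sum>i<n. (z \<bullet> b i) *\<^sub>R b i) = z"
    show thesis by (rule that[OF chart_coordinates[OF U(1) E(1,3) b] U(2)])
  qed
qed

lemma adapted_coordinates_exist:
  assumes "embedded_submanifold n k A S" "x \<in> S"
  obtains V X D where "adapted_coordinates k S V X D" "x \<in> V"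
proof -
  obtain c where c: "c \<in> max_atlas" "case c of (U, \<phi>) \<Rightarrow> x \<in> U \<and>
      (\<exists>E L. subspace E \<and> dim E = n \<and> openin (top_of_set E) (\<phi> ` U) \<and>
        subspace L \<and> L \<subseteq> E \<and> dim L = k \<and> \<phi> ` (U \<inter> S) = \<phi> ` U \<inter> L)"
    using bspec[OF assms(1)[unfolded embedded_submanifold_def] assms(2)] by (rule bexE)
  obtain U \<phi> where c': "c = (U, \<phi>)" by (rule prod.exhaust)
  from c obtain E L where U: "(U, \<phi>) \<in> max_atlas" "x \<in> U"
    and E: "subspace E" "dim E = n" "openin (top_of_set E) (\<phi> ` U)"
    and L: "subspace L" "L \<subseteq> E" "dim L = k" and S: "\<phi> ` (U \<inter> S) = \<phi> ` U \<inter> L"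
    unfolding c' prod.case by (elim conjE exE)
  show ?thesis
  proof (rule adapted_orthonormal_basis[OF E(1,2) L])
  fix b :: "nat \<Rightarrow> 'e" assume bL: "\<And>i. i < k \<Longrightarrow> b i \<in> L" and b:
    "k \<le> n" "\<And>i. i < n \<Longrightarrow> b i \<in> E" "\<And>i j. i < n \<Longrightarrow> j < n \<Longrightarrow> b i \<bullet> b j = (if i = j then 1 else 0)"
    "\<And>z. z \<in> E \<Longrightarrow> (\<Sum>i<n. (z \<bullet> b i) *\<^sub>R b i) = z"
    "\<And>z. z \<in> E \<Longrightarrow> z \<in> L \<longleftrightarrow> (\<forall>i. k \<le> i \<and> i < n \<longrightarrow> z \<bullet> b i = 0)"
  have SL: "y \<in> S \<longleftrightarrow> \<phi> y \<in> L" if "y \<in> U" for y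
  proof
    assume "\<phi> y \<in> L"
    then have "\<phi> y \<in> \<phi> ` (U \<inter> S)" using that S by auto
    then show "y \<in> S" using chart_inj[OF U(1) that] by auto
  qed (use that S in auto)
  have "y \<in> S \<longleftrightarrow> (\<forall>i. k \<le> i \<and> i < n \<longrightarrow> \<phi> y \<bullet> b i = 0)" if "y \<in> U" for y
    using SL[OF that] b(5)[of "\<phi> y"] imageI[OF that, of \<phi>] openin_imp_subset[OF E(3)] by blast
  moreover have "chart_deriv (U, \<phi>) (b i) y \<in> submanifold_tangent A S y"
    if "i < k" "y \<in> U" "y \<in> S" for i y
    using chart_deriv_tangential[OF U(1) E(1,3) L(1,2) S bL[OF that(1)] that(2,3)]
      vector_field_chart_deriv[OF U(1) E(1,3), of "b i"] bL[OF that(1)] L(2) that(2)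
    by (auto simp: submanifold_tangent_def vector_field_def)
  ultimately have "adapted_coordinates k S U (\<lambda>i y. \<phi> y \<bullet> b i) (\<lambda>i. chart_deriv (U, \<phi>) (b i))"
    using chart_coordinates[OF U(1) E(1,3) b(2,3,4)] b(1) by (auto simp: adapted_coordinates_def)
  then show thesis by (rule that[OF _ U(2)])
  qed
qed

section \<open>Tangent vectors and covectors\<close>

lemma coordinatesD:
  assumes "coordinates V X D"
  shows "open V" "\<And>x i. x \<in> V \<Longrightarrow> i < n \<Longrightarrow> smooth_germ x (X i)"
    "\<And>i. i < n \<Longrightarrow> vector_field A V (D i)"
    "\<And>x i. x \<in> V \<Longrightarrow> i < n \<Longrightarrow> D i x \<in> tangent_space A x"
    "\<And>x i j. x \<in> V \<Longrightarrow> i < n \<Longrightarrow> j < n \<Longrightarrow> D i x (X j) = (if i = j then 1 else 0)"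
    "\<And>x i f. x \<in> V \<Longrightarrow> i < n \<Longrightarrow> smooth_germ x f \<Longrightarrow> smooth_germ x (\<lambda>y. D i y f)"
  using assms by (auto simp: coordinates_def vector_field_iff)

lemma zero_in_tangent_space [simp]: "(\<lambda>f. 0) \<in> tangent_space A x"
  by (rule tangent_spaceI) auto

lemma tangent_space_add:
  "v \<in> tangent_space A x \<Longrightarrow> w \<in> tangent_space A x \<Longrightarrow> (\<lambda>f. v f + w f) \<in> tangent_space A x"
  by (rule tangent_spaceI) (auto simp: tangent_spaceD algebra_simps dest: tangent_spaceD(2))

lemma tangent_space_scale:
  "v \<in> tangent_space A x \<Longrightarrow> (\<lambda>f. r * v f) \<in> tangent_space A x"
  by (rule tangent_spaceI) (auto simp: tangent_spaceD algebra_simps dest: tangent_spaceD(2))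

lemma tangent_space_diff:
  "v \<in> tangent_space A x \<Longrightarrow> w \<in> tangent_space A x \<Longrightarrow> (\<lambda>f. v f - w f) \<in> tangent_space A x"
  using tangent_space_add[OF _ tangent_space_scale[of w x "- 1"], of v] by simp

lemma tangent_space_sum:
  "(\<And>i. i \<in> I \<Longrightarrow> v i \<in> tangent_space A x) \<Longrightarrow> (\<lambda>f. \<Sum>i\<in>I. v i f) \<in> tangent_space A x"
  by (induction I rule: infinite_finite_induct) (auto intro: tangent_space_add)

context
  fixes x v
  assumes v: "v \<in> tangent_space A x"
begin

lemmas tangent_not_smooth = tangent_spaceD(1)[OF v]
lemmas tangent_cong = tangent_spaceD(2)[OF v]
lemmas tangent_add = tangent_spaceD(3)[OF v]
lemmas tangent_scale = tangent_spaceD(4)[OF v]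
lemmas tangent_mult = tangent_spaceD(5)[OF v]

lemma tangent_const: "v (\<lambda>_. c) = 0"
proof -
  have "v (\<lambda>_. 1) = 0" using tangent_mult[of "\<lambda>_. 1" "\<lambda>_. 1"] by simp
  then show ?thesis using tangent_scale[of "\<lambda>_. 1" c] by simp
qed

lemma tangent_minus: "smooth_germ x f \<Longrightarrow> v (\<lambda>y. - f y) = - v f"
  using tangent_scale[of f "- 1"] by simp

lemma tangent_diff: "smooth_germ x f \<Longrightarrow> smooth_germ x g \<Longrightarrow> v (\<lambda>y. f y - g y) = v f - v g"
  using tangent_add[of f "\<lambda>y. - g y"] tangent_minus[of g] smooth_germ_minus[of x g] by simp

lemma tangent_sum:
  "finite I \<Longrightarrow> (\<And>i. i \<in> I \<Longrightarrow> smooth_germ x (f i)) \<Longrightarrow> v (\<lambda>y. \<Sum>i\<in>I. f i y) = (\<Sum>i\<in>I. v (f i))"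
  by (induction I rule: finite_induct) (auto simp: tangent_const tangent_add smooth_germ_sum)

lemma tangent_prod:
  "finite I \<Longrightarrow> (\<And>i. i \<in> I \<Longrightarrow> smooth_germ x (f i)) \<Longrightarrow>
    v (\<lambda>y. \<Prod>i\<in>I. f i y) = (\<Sum>i\<in>I. v (f i) * (\<Prod>j\<in>I - {i}. f j x))"
proof (induction I rule: finite_induct)
  case (insert i I)
  have "v (\<lambda>y. \<Prod>j\<in>insert i I. f j y) = v (f i) * (\<Prod>j\<in>I. f j x) + f i x * v (\<lambda>y. \<Prod>j\<in>I. f j y)"
    using insert by (auto simp: tangent_mult smooth_germ_prod)
  also have "v (\<lambda>y. \<Prod>j\<in>I. f j y) = (\<Sum>i\<in>I. v (f i) * (\<Prod>j\<in>I - {i}. f j x))"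
    by (rule insert.IH) (use insert.prems in auto)
  also have "f i x * \<dots> = (\<Sum>l\<in>I. v (f l) * (\<Prod>j\<in>insert i I - {l}. f j x))"
    unfolding sum_distrib_left
  proof (rule sum.cong[OF refl])
    fix l assume "l \<in> I"
    then have "insert i I - {l} = insert i (I - {l})" using insert.hyps(2) by auto
    then show "f i x * (v (f l) * (\<Prod>j\<in>I - {l}. f j x)) = v (f l) * (\<Prod>j\<in>insert i I - {l}. f j x)"
      using insert.hyps by simp
  qed
  finally show ?case
    by (simp only: sum.insert[OF insert.hyps] Diff_insert_absorb[OF insert.hyps(2)])
qed (simp add: tangent_const)

lemma tangent_eventually_zero: "\<forall>\<^sub>F y in nhds x. f y = 0 \<Longrightarrow> v f = 0"
  using tangent_cong[of "\<lambda>_. 0" f] tangent_const[of 0] by (auto elim: eventually_mono)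

text \<open>By Hadamard's lemma in one variable, \<open>g (f y) - g (f x)\<close> is
  \<open>f y - f x\<close> times a smooth factor whose value at \<open>x\<close> is
  \<open>d\<close>; the product rule sees nothing else.\<close>

lemma tangent_chain:
  fixes g :: "real \<Rightarrow> real"
  assumes f: "smooth_germ x f" and G: "open G" "f x \<in> G" "\<And>k. C_k_on k G g"
    and D: "(g has_real_derivative d) (at (f x))"
  shows "v (\<lambda>y. g (f y)) = d * v f"
proof -
  obtain r where r: "r > 0" "ball (f x) r \<subseteq> G" using G openE by blast
  have gr: "C_k_on k (ball (f x) r) g" for k by (rule C_k_on_subset[OF G(3) r(2)])
  show ?thesis
  proof (rule Hadamard[OF gr])
    fix H assume H: "\<And>k b. C_k_on k (ball (f x) r) (H b)"
      "\<And>z (I :: nat set) b c. z \<in> ball (f x) r \<Longrightarrow> finite I \<Longrightarrow> z - f x = (\<Sum>i\<in>I. c i *\<^sub>R b i) \<Longrightarrow>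
       g z = g (f x) + (\<Sum>i\<in>I. c i * H (b i) z)"
    have gH: "g z = g (f x) + (z - f x) * H 1 z" if "z \<in> ball (f x) r" for z
      using H(2)[OF that, of "{0}" "\<lambda>_. z - f x" "\<lambda>_. 1"] by simp
    have "((\<lambda>z. g (f x) + (z - f x) * H 1 z) has_real_derivative d) (at (f x))"
      by (rule has_field_derivative_transform_within_open[OF D open_ball _ gH]) (use r in auto)
    then have "((\<lambda>z. (g (f x) + (z - f x) * H 1 z - g (f x)) / (z - f x)) \<longlongrightarrow> d) (at (f x))"
      by (simp add: has_field_derivative_iff)
    then have "(H 1 \<longlongrightarrow> d) (at (f x))"
      by (rule Lim_transform_eventually) (simp add: eventually_at_filter)
    moreover have "isCont (H 1) (f x)"
      using H(1)[of 0 1] r(1) by (simp add: continuous_on_eq_continuous_at)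
    ultimately have Hd: "H 1 (f x) = d"
      using tendsto_unique[of "at (f x)" "H 1"] by (auto simp: isCont_def)
    have sH: "smooth_germ x (\<lambda>y. H 1 (f y))"
      by (rule smooth_germ_compose_real[OF f open_ball _ H(1)]) (use r in simp)
    have "\<forall>\<^sub>F y in nhds x. f y \<in> ball (f x) r"
      using smooth_germ_isCont[OF f] r(1)
      by (intro topological_tendstoD) (auto simp: isCont_def tendsto_at_iff_tendsto_nhds)
    then have "\<forall>\<^sub>F y in nhds x. g (f y) = g (f x) + (f y - f x) * H 1 (f y)"
      by (rule eventually_mono) (rule gH)
    moreover have "smooth_germ x (\<lambda>y. g (f y))"
      by (rule smooth_germ_compose_real[OF f G])
    ultimately have "v (\<lambda>y. g (f y)) = v (\<lambda>y. g (f x) + (f y - f x) * H 1 (f y))"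
      by (intro tangent_cong)
    also have "\<dots> = v f * H 1 (f x)"
      using f sH by (simp add: tangent_add tangent_mult tangent_diff tangent_const smooth_germ_mult smooth_germ_diff)
    finally show ?thesis by (simp add: Hd)
  qed
qed

lemma tangent_ln_abs:
  assumes f: "smooth_germ x f" "f x \<noteq> 0"
  shows "v (\<lambda>y. ln \<bar>f y\<bar>) = v f / f x"
proof -
  have "((\<lambda>t. ln \<bar>t\<bar>) has_real_derivative inverse (f x)) (at (f x))"
  proof (cases "f x > 0")
    case True
    have "(ln has_real_derivative inverse (f x)) (at (f x))" using True
      by (auto intro!: derivative_eq_intros simp: divide_simps)
    then show ?thesis
      by (rule has_field_derivative_transform_within_open[where S="{0<..}"]) (use True in auto)
  next
    case False
    then have "((\<lambda>t. ln (- t)) has_real_derivative inverse (f x)) (at (f x))"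
      using f(2) by (auto intro!: derivative_eq_intros simp: divide_simps)
    then show ?thesis
      by (rule has_field_derivative_transform_within_open[where S="{..<0}"]) (use False f(2) in auto)
  qed
  from tangent_chain[OF f(1) open_Compl[OF closed_singleton] _ C_k_on_ln_abs this] f(2) show ?thesis
    by (simp add: divide_inverse mult.commute)
qed

lemma tangent_ndet:
  assumes M: "\<And>i j. i < k \<Longrightarrow> j < k \<Longrightarrow> smooth_germ x (\<lambda>y. M y i j)"
  shows "v (\<lambda>y. ndet k (M y)) = (\<Sum>i<k. ndet k ((M x)(i := (\<lambda>j. v (\<lambda>y. M y i j)))))"
proof -
  have pk: "p i < k" if "p permutes {..<k}" "i < k" for p i
    using permutes_in_image[OF that(1), of i] that(2) by simp
  have sm: "smooth_germ x (\<lambda>y. \<Prod>i<k. M y i (p i))" if "p permutes {..<k}" for p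
    by (intro smooth_germ_prod M) (auto simp: pk[OF that])
  have "v (\<lambda>y. ndet k (M y))
      = (\<Sum>p | p permutes {..<k}. of_int (sign p) * v (\<lambda>y. \<Prod>i<k. M y i (p i)))"
    unfolding ndet_permutes
    by (subst tangent_sum)
      (auto intro!: smooth_germ_mult sm finite_permutations sum.cong tangent_scale)
  also have "\<dots> = (\<Sum>p | p permutes {..<k}. \<Sum>i<k.
      of_int (sign p) * (v (\<lambda>y. M y i (p i)) * (\<Prod>j\<in>{..<k} - {i}. M x j (p j))))"
    by (intro sum.cong refl, subst tangent_prod) (auto intro!: M simp: pk sum_distrib_left)
  also have "\<dots> = (\<Sum>i<k. \<Sum>p | p permutes {..<k}. of_int (sign p) *
      (\<Prod>j<k. ((M x)(i := (\<lambda>j. v (\<lambda>y. M y i j)))) j (p j)))"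
  proof (subst sum.swap, intro sum.cong refl)
    fix i p assume "i \<in> {..<k}"
    then have "(\<Prod>j<k. ((M x)(i := (\<lambda>j. v (\<lambda>y. M y i j)))) j (p j))
        = v (\<lambda>y. M y i (p i)) * (\<Prod>j\<in>{..<k} - {i}. M x j (p j))"
      by (subst prod.remove[of "{..<k}" i]) (auto intro!: prod.cong)
    then show "of_int (sign p) * (v (\<lambda>y. M y i (p i)) * (\<Prod>j\<in>{..<k} - {i}. M x j (p j)))
        = of_int (sign p) * (\<Prod>j<k. ((M x)(i := (\<lambda>j. v (\<lambda>y. M y i j)))) j (p j))"
      by simp
  qed
  finally show ?thesis by (simp add: ndet_permutes)
qed

end

text \<open>Hadamard's expansion and the product rule turn \<open>v f\<close> into the sum of the
  \<open>v (X i) * g i x\<close>. The same computation for the derivation \<open>D j x\<close>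
  identifies \<open>g j x\<close>.\<close>

lemma tangent_coordinates:
  assumes v: "v \<in> tangent_space A x" and c: "coordinates V X D" "x \<in> V" and f: "smooth_germ x f"
  shows "v f = (\<Sum>i<n. v (X i) * D i x f)"
proof -
  obtain g where g: "\<And>i. i < n \<Longrightarrow> smooth_germ x (g i)"
      "\<forall>\<^sub>F y in nhds x. f y = f x + (\<Sum>i<n. (X i y - X i x) * g i y)"
    using c f unfolding coordinates_def by blast
  have X: "smooth_germ x (X i)" if "i < n" for i using coordinatesD(2)[OF c that] .
  have sm: "smooth_germ x (\<lambda>y. (X i y - X i x) * g i y)" if "i < n" for i
    using g(1) X that by (intro smooth_germ_mult smooth_germ_diff smooth_germ_const)
  have *: "w f = (\<Sum>i<n. w (X i) * g i x)" if w: "w \<in> tangent_space A x" for w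
  proof -
    have "w f = w (\<lambda>y. f x + (\<Sum>i<n. (X i y - X i x) * g i y))"
      by (rule tangent_spaceD(2)[OF w f g(2)])
    also have "\<dots> = w (\<lambda>_. f x) + w (\<lambda>y. \<Sum>i<n. (X i y - X i x) * g i y)"
      by (rule tangent_spaceD(3)[OF w]) (auto intro: sm)
    also have "w (\<lambda>y. \<Sum>i<n. (X i y - X i x) * g i y) = (\<Sum>i<n. w (\<lambda>y. (X i y - X i x) * g i y))"
      by (rule tangent_sum[OF w]) (auto intro: sm)
    also have "\<dots> = (\<Sum>i<n. w (X i) * g i x)"
      by (rule sum.cong) (use g(1) X in
        \<open>auto simp: tangent_spaceD(5)[OF w] tangent_diff[OF w] tangent_const[OF w] smooth_germ_diff\<close>)
    finally show ?thesis by (simp add: tangent_const[OF w])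
  qed
  have "D j x f = g j x" if "j < n" for j
    using *[OF coordinatesD(4)[OF c that]] that coordinatesD(5)[OF c that]
    by (simp add: if_distrib[of "\<lambda>a. a * _"] cong: if_cong)
  then show ?thesis using *[OF v] by simp
qed

lemma tangent_eqI:
  assumes c: "coordinates V X D" "x \<in> V" and "v \<in> tangent_space A x" "w \<in> tangent_space A x"
    and eq: "\<And>i. i < n \<Longrightarrow> v (X i) = w (X i)"
  shows "v = w"
proof
  fix f
  show "v f = w f"
  proof (cases "smooth_germ x f")
    case True
    then show ?thesis using eq tangent_coordinates[OF assms(3) c True] tangent_coordinates[OF assms(4) c True]
      by simp
  next
    case False
    then show ?thesis using assms(3,4) by (simp add: tangent_not_smooth)
  qed
qed

lemma tangent_expand:
  assumes c: "coordinates V X D" "x \<in> V" and v: "v \<in> tangent_space A x"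
  shows "v = (\<lambda>f. \<Sum>i<n. v (X i) * D i x f)"
proof (rule tangent_eqI[OF c v])
  show "(\<lambda>f. \<Sum>i<n. v (X i) * D i x f) \<in> tangent_space A x"
    by (intro tangent_space_sum tangent_space_scale coordinatesD(4)[OF c]) simp
  show "v (X i) = (\<Sum>j<n. v (X j) * D j x (X i))" if "i < n" for i
    using that by (simp add: coordinatesD(5)[OF c] if_distrib[of "\<lambda>a. _ * a"] cong: if_cong)
qed

lemma vector_field_zero: "vector_field A V (\<lambda>x f. 0)"
  by (auto simp: vector_field_def smooth_fun_iff)

context
  fixes x \<alpha>
  assumes \<alpha>: "\<alpha> \<in> cotangent_space A x"
begin

lemma cotangent_outside: "v \<notin> tangent_space A x \<Longrightarrow> \<alpha> v = 0"
  using \<alpha> by (simp add: cotangent_space_def)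

lemma cotangent_add:
  "u \<in> tangent_space A x \<Longrightarrow> v \<in> tangent_space A x \<Longrightarrow> \<alpha> (\<lambda>f. u f + v f) = \<alpha> u + \<alpha> v"
  using \<alpha> by (simp add: cotangent_space_def)

lemma cotangent_scale: "v \<in> tangent_space A x \<Longrightarrow> \<alpha> (\<lambda>f. r * v f) = r * \<alpha> v"
  using \<alpha> by (simp add: cotangent_space_def)

lemma cotangent_zero: "\<alpha> (\<lambda>f. 0) = 0"
  using cotangent_scale[of "\<lambda>f. 0" 0] by simp

lemma cotangent_diff:
  "u \<in> tangent_space A x \<Longrightarrow> v \<in> tangent_space A x \<Longrightarrow> \<alpha> (\<lambda>f. u f - v f) = \<alpha> u - \<alpha> v"
  using cotangent_add[OF _ tangent_space_scale[of v x "- 1"], of u] cotangent_scale[of v "- 1"] by simp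

lemma cotangent_sum:
  "finite I \<Longrightarrow> (\<And>i. i \<in> I \<Longrightarrow> v i \<in> tangent_space A x) \<Longrightarrow>
    \<alpha> (\<lambda>f. \<Sum>i\<in>I. c i * v i f) = (\<Sum>i\<in>I. c i * \<alpha> (v i))"
  by (induction I rule: finite_induct)
    (auto simp: cotangent_zero cotangent_add cotangent_scale tangent_space_sum tangent_space_scale)

end

lemma differential_apply: "v \<in> tangent_space A x \<Longrightarrow> differential A f x v = v f"
  by (simp add: differential_def)

lemma differential_in_cotangent_space [simp]: "differential A f x \<in> cotangent_space A x"
  by (auto simp: cotangent_space_def differential_def tangent_space_add tangent_space_scale)

text \<open>A linear combination of coordinate functions with the values of \<open>\<alpha>\<close>
  on the frame as coefficients does it. Identities between covectors thereby reduce to identities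
  between brackets of functions.\<close>

lemma cotangent_eq_differential:
  assumes \<alpha>: "\<alpha> \<in> cotangent_space A x"
  obtains f where "smooth_germ x f" "\<alpha> = differential A f x"
proof -
  obtain V X D where c: "coordinates V X D" "x \<in> V" by (rule coordinates_exist)
  define f where "f = (\<lambda>y. \<Sum>i<n. \<alpha> (D i x) * X i y)"
  have f: "smooth_germ x f"
    unfolding f_def using coordinatesD(2)[OF c] by (intro smooth_germ_sum smooth_germ_mult) auto
  have "\<alpha> v = differential A f x v" for v
  proof (cases "v \<in> tangent_space A x")
    case True
    have "\<alpha> v = \<alpha> (\<lambda>f. \<Sum>i<n. v (X i) * D i x f)" using tangent_expand[OF c True] by simp
    also have "\<dots> = (\<Sum>i<n. v (X i) * \<alpha> (D i x))"
      by (rule cotangent_sum[OF \<alpha>]) (auto intro: coordinatesD(4)[OF c])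
    also have "\<dots> = v f"
      unfolding f_def
      by (subst tangent_sum[OF True])
        (auto intro!: smooth_germ_mult sum.cong simp: tangent_scale[OF True] coordinatesD(2)[OF c])
    finally show ?thesis using True by (simp add: differential_def)
  qed (simp add: differential_def cotangent_outside[OF \<alpha>])
  then show ?thesis using that f by blast
qed

end

section \<open>Bivector fields and Poisson brackets\<close>

locale bivector_mfd = smooth_mfd +
  fixes W :: "'a set" and \<Lambda> :: "'a bivfield"
  assumes open_W: "open W" and bivector_field: "bivector_field A W \<Lambda>"
begin

abbreviation "pb \<equiv> poisson_bracket A \<Lambda>"
abbreviation "ham \<equiv> hamiltonian_field A \<Lambda>"

context
  fixes x
  assumes x: "x \<in> W"
begin

lemma bivector_rep:
  obtains ps where "set ps \<subseteq> tangent_space A x \<times> tangent_space A x"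
    "\<And>\<alpha> \<beta>. \<alpha> \<in> cotangent_space A x \<Longrightarrow> \<beta> \<in> cotangent_space A x \<Longrightarrow>
      \<Lambda> x \<alpha> \<beta> = (\<Sum>(u, v)\<leftarrow>ps. \<alpha> u * \<beta> v - \<alpha> v * \<beta> u)"
proof -
  have "\<Lambda> x \<in> bivectors A x (tangent_space A x)"
    using bivector_field x by (simp add: bivector_field_def)
  then obtain ps where "set ps \<subseteq> tangent_space A x \<times> tangent_space A x \<and>
      (\<forall>\<alpha>\<in>cotangent_space A x. \<forall>\<beta>\<in>cotangent_space A x.
        \<Lambda> x \<alpha> \<beta> = (\<Sum>(u, v)\<leftarrow>ps. \<alpha> u * \<beta> v - \<alpha> v * \<beta> u))"
    unfolding bivectors_def mem_Collect_eq by (rule exE)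
  then show ?thesis by (intro that[of ps]) auto
qed

lemma bivector_skew:
  assumes "\<alpha> \<in> cotangent_space A x" "\<beta> \<in> cotangent_space A x"
  shows "\<Lambda> x \<alpha> \<beta> = - \<Lambda> x \<beta> \<alpha>"
proof (rule bivector_rep)
  fix ps :: "('a tvec \<times> 'a tvec) list"
  assume ps: "\<And>\<alpha> \<beta>. \<alpha> \<in> cotangent_space A x \<Longrightarrow> \<beta> \<in> cotangent_space A x \<Longrightarrow>
      \<Lambda> x \<alpha> \<beta> = (\<Sum>(u, v)\<leftarrow>ps. \<alpha> u * \<beta> v - \<alpha> v * \<beta> u)"
  have "(\<Sum>(u, v)\<leftarrow>ps. \<alpha> u * \<beta> v - \<alpha> v * \<beta> u) = - (\<Sum>(u, v)\<leftarrow>ps. \<beta> u * \<alpha> v - \<beta> v * \<alpha> u)"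
    by (induction ps) auto
  then show ?thesis using ps assms by simp
qed

lemma sharp_in_tangent_space:
  assumes \<alpha>: "\<alpha> \<in> cotangent_space A x"
  shows "sharp A \<Lambda> x \<alpha> \<in> tangent_space A x"
proof (rule bivector_rep)
  fix ps assume ps: "set ps \<subseteq> tangent_space A x \<times> tangent_space A x"
    "\<And>\<alpha> \<beta>. \<alpha> \<in> cotangent_space A x \<Longrightarrow> \<beta> \<in> cotangent_space A x \<Longrightarrow>
      \<Lambda> x \<alpha> \<beta> = (\<Sum>(u, v)\<leftarrow>ps. \<alpha> u * \<beta> v - \<alpha> v * \<beta> u)"
  have "(\<lambda>f. \<Sum>(u, v)\<leftarrow>ps. \<alpha> u * v f - \<alpha> v * u f) \<in> tangent_space A x"
    using ps(1) by (induction ps) (auto intro!: tangent_space_add tangent_space_diff tangent_space_scale)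
  moreover have "sharp A \<Lambda> x \<alpha> f = (\<Sum>(u, v)\<leftarrow>ps. \<alpha> u * v f - \<alpha> v * u f)" for f
  proof (cases "smooth_germ x f")
    case True
    have "\<Lambda> x \<alpha> (differential A f x)
        = (\<Sum>(u, v)\<leftarrow>ps. \<alpha> u * differential A f x v - \<alpha> v * differential A f x u)"
      using ps(2) \<alpha> by simp
    also have "\<dots> = (\<Sum>(u, v)\<leftarrow>ps. \<alpha> u * v f - \<alpha> v * u f)"
      using ps(1) by (induction ps) (auto simp: differential_apply)
    finally show ?thesis using True by (simp add: sharp_def)
  next
    case False
    have "(\<Sum>(u, v)\<leftarrow>ps. \<alpha> u * v f - \<alpha> v * u f) = 0"
      using ps(1) by (induction ps) (auto simp: tangent_not_smooth[OF _ False])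
    then show ?thesis using False by (simp add: sharp_def)
  qed
  ultimately show ?thesis by presburger
qed

lemma cotangent_sharp:
  assumes "\<alpha> \<in> cotangent_space A x" "\<beta> \<in> cotangent_space A x"
  shows "\<beta> (sharp A \<Lambda> x \<alpha>) = \<Lambda> x \<alpha> \<beta>"
  by (rule cotangent_eq_differential[OF assms(2)])
    (use sharp_in_tangent_space[OF assms(1)] in \<open>simp add: differential_apply sharp_def\<close>)

lemma ham_in_tangent_space [simp]: "ham f x \<in> tangent_space A x"
  unfolding hamiltonian_field_def by (rule sharp_in_tangent_space) simp

lemma ham_apply: "smooth_germ x g \<Longrightarrow> ham f x g = pb f g x"
  by (simp add: hamiltonian_field_def sharp_def poisson_bracket_def)

lemma pb_skew: "pb f g x = - pb g f x"
  unfolding poisson_bracket_def by (rule bivector_skew) auto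

lemma smooth_germ_pb:
  assumes "smooth_germ x f" "smooth_germ x g"
  shows "smooth_germ x (pb f g)"
proof -
  obtain V1 where V1: "open V1" "x \<in> V1" "smooth_fun A V1 f" using assms by (auto simp: smooth_near_def)
  obtain V2 where V2: "open V2" "x \<in> V2" "smooth_fun A V2 g" using assms by (auto simp: smooth_near_def)
  let ?V = "V1 \<inter> V2 \<inter> W"
  have "open ?V" using V1 V2 open_W by auto
  moreover have "smooth_fun A ?V f" "smooth_fun A ?V g"
    using V1 V2 \<open>open ?V\<close> by (simp_all add: smooth_fun_iff)
  ultimately have "smooth_fun A ?V (pb f g)"
    using bivector_field unfolding bivector_field_def by blast
  then show ?thesis using \<open>open ?V\<close> V1(2) V2(2) x unfolding smooth_near_def by blast
qed

lemma pb_const: "pb f (\<lambda>_. c) x = 0"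
  using ham_apply[OF smooth_germ_const, of f c] tangent_const[OF ham_in_tangent_space] by metis

lemma pb_add: "smooth_germ x g \<Longrightarrow> smooth_germ x h \<Longrightarrow> pb f (\<lambda>y. g y + h y) x = pb f g x + pb f h x"
  using tangent_add[OF ham_in_tangent_space, of g h f] by (simp add: ham_apply smooth_germ_add)

lemma pb_diff: "smooth_germ x g \<Longrightarrow> smooth_germ x h \<Longrightarrow> pb f (\<lambda>y. g y - h y) x = pb f g x - pb f h x"
  using tangent_diff[OF ham_in_tangent_space, of g h f] by (simp add: ham_apply smooth_germ_diff)

lemma pb_mult: "smooth_germ x g \<Longrightarrow> smooth_germ x h \<Longrightarrow>
    pb f (\<lambda>y. g y * h y) x = pb f g x * h x + g x * pb f h x"
  using tangent_mult[OF ham_in_tangent_space, of g h f] by (simp add: ham_apply smooth_germ_mult)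

lemma pb_sum: "finite I \<Longrightarrow> (\<And>i. i \<in> I \<Longrightarrow> smooth_germ x (g i)) \<Longrightarrow>
    pb f (\<lambda>y. \<Sum>i\<in>I. g i y) x = (\<Sum>i\<in>I. pb f (g i) x)"
  using tangent_sum[OF ham_in_tangent_space, of I g f] by (simp add: ham_apply smooth_germ_sum)

lemma pb_minus: "smooth_germ x g \<Longrightarrow> pb f (\<lambda>y. - g y) x = - pb f g x"
  using tangent_minus[OF ham_in_tangent_space, of g f] by (simp add: ham_apply smooth_germ_minus)

lemma pb_cong:
  assumes "smooth_germ x g" "\<forall>\<^sub>F y in nhds x. g y = h y"
  shows "pb f g x = pb f h x"
  using tangent_cong[OF ham_in_tangent_space assms, of f] ham_apply[OF assms(1), of f]
    ham_apply[OF smooth_germ_transform[OF assms], of f] by simp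

end

lemma eventually_in_W: "x \<in> W \<Longrightarrow> \<forall>\<^sub>F y in nhds x. y \<in> W"
  using open_W by (rule eventually_nhds_in_open)

lemma vector_field_ham:
  assumes "open V" "V \<subseteq> W" "\<And>x. x \<in> V \<Longrightarrow> smooth_germ x f"
  shows "vector_field A V (ham f)"
  unfolding vector_field_iff[OF assms(1)]
proof (intro conjI ballI allI impI)
  fix x g assume x: "x \<in> V" and g: "smooth_germ x g"
  have "\<forall>\<^sub>F y in nhds x. pb f g y = ham f y g"
    using eventually_conj[OF smooth_germ_eventually[OF g] eventually_nhds_in_open[OF assms(1) x]]
    by (rule eventually_mono) (use ham_apply assms(2) in auto)
  then show "smooth_germ x (\<lambda>y. ham f y g)"
    by (rule smooth_germ_transform[OF smooth_germ_pb[OF subsetD[OF assms(2) x] assms(3)[OF x] g]])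
qed (use assms(2) in auto)

end

locale poisson_mfd = bivector_mfd +
  assumes poisson_bivector: "poisson_bivector A W \<Lambda>"
begin

lemma jacobi:
  assumes x: "x \<in> W" and "smooth_germ x f" "smooth_germ x g" "smooth_germ x h"
  shows "pb f (pb g h) x + pb g (pb h f) x + pb h (pb f g) x = 0"
proof -
  obtain V1 where V1: "open V1" "x \<in> V1" "smooth_fun A V1 f" using assms by (auto simp: smooth_near_def)
  obtain V2 where V2: "open V2" "x \<in> V2" "smooth_fun A V2 g" using assms by (auto simp: smooth_near_def)
  obtain V3 where V3: "open V3" "x \<in> V3" "smooth_fun A V3 h" using assms by (auto simp: smooth_near_def)
  let ?V = "V1 \<inter> V2 \<inter> V3 \<inter> W"
  have op: "open ?V" using V1 V2 V3 open_W by auto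
  have "smooth_fun A ?V f" "smooth_fun A ?V g" "smooth_fun A ?V h"
    using V1 V2 V3 by (simp_all add: smooth_fun_iff[OF op] smooth_fun_iff)
  moreover have "x \<in> ?V" using V1 V2 V3 x by simp
  ultimately show ?thesis
    using poisson_bivector op unfolding poisson_bivector_def by blast
qed

end

lemma sum_skew:
  fixes c t :: "nat \<Rightarrow> nat \<Rightarrow> real"
  assumes "\<And>i j. i < k \<Longrightarrow> j < k \<Longrightarrow> c i j = - c j i"
  shows "2 * (\<Sum>i<k. \<Sum>j<k. c i j * t i j) = (\<Sum>i<k. \<Sum>j<k. c i j * (t i j - t j i))"
proof -
  have "(\<Sum>i<k. \<Sum>j<k. c i j * t j i) = (\<Sum>j<k. \<Sum>i<k. c i j * t j i)" by (rule sum.swap)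
  also have "\<dots> = (\<Sum>j<k. \<Sum>i<k. - (c j i * t j i))"
  proof (intro sum.cong refl)
    fix i j assume "j \<in> {..<k}" "i \<in> {..<k}"
    then have "c i j = - c j i" by (intro assms) auto
    then show "c i j * t j i = - (c j i * t j i)" by simp
  qed
  finally show ?thesis by (simp add: right_diff_distrib sum_subtractf sum_negf)
qed

section \<open>Reduction by a nondegenerate family of functions\<close>

text \<open>The functions \<open>u i\<close> play the role of base coordinates pulled back along the projection of a
  coupling neighborhood; \<open>db\<close> is the Dirac bracket and turns out to be the bracket of the transverse
  Poisson structure.\<close>

locale dirac_mfd = poisson_mfd +
  fixes k :: nat and u :: "nat \<Rightarrow> 'a \<Rightarrow> real"
  assumes smooth_u: "\<And>x i. x \<in> W \<Longrightarrow> i < k \<Longrightarrow> smooth_germ x (u i)"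
    and nondegenerate: "\<And>x. x \<in> W \<Longrightarrow> ndet k (\<lambda>i j. pb (u i) (u j) x) \<noteq> 0"
begin

definition "M x i j = pb (u i) (u j) x"
text \<open>The inverse matrix of \<open>M x\<close>, written with the adjugate so that its entries
  are visibly smooth in \<open>x\<close>.\<close>

definition "C x i j = nadj k (M x) i j / ndet k (M x)"
text \<open>The solution of the linear system
  \<open>pb f (u l) x = (\<Sum>j<k. co f j x * M x j l)\<close>: subtracting these multiples of the
  \<open>u j\<close>, with the coefficients frozen at \<open>x\<close>, leaves a function that
  commutes with all \<open>u l\<close> at \<open>x\<close>.\<close>

definition "co f j x = (\<Sum>i<k. pb f (u i) x * C x i j)"
text \<open>A combination of Hamiltonian vectors at \<open>x\<close> with coefficients that are
  numbers, hence again a derivation; \<open>dham_u\<close> shows it to be tangent to the common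
  level sets of the \<open>u l\<close>.\<close>

definition "dham f x g = ham f x g - (\<Sum>j<k. co f j x * ham (u j) x g)"
definition "db f g x = pb f g x - (\<Sum>j<k. co f j x * pb (u j) g x)"

context
  fixes x
  assumes x: "x \<in> W"
begin

lemma ndet_M: "ndet k (M x) \<noteq> 0"
  using nondegenerate[OF x] unfolding M_def[abs_def] .

lemma smooth_germ_M: "i < k \<Longrightarrow> j < k \<Longrightarrow> smooth_germ x (\<lambda>y. M y i j)"
  unfolding M_def using smooth_germ_pb[OF x] smooth_u[OF x] by auto

lemma smooth_germ_ndet_M: "smooth_germ x (\<lambda>y. ndet k (M y))"
  by (rule smooth_germ_ndet) (rule smooth_germ_M)

lemma smooth_germ_C: "i < k \<Longrightarrow> j < k \<Longrightarrow> smooth_germ x (\<lambda>y. C y i j)"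
  unfolding C_def
  by (intro smooth_germ_divide smooth_germ_nadj smooth_germ_ndet_M ndet_M smooth_germ_M)

lemma smooth_germ_co: "smooth_germ x f \<Longrightarrow> j < k \<Longrightarrow> smooth_germ x (co f j)"
  unfolding co_def[abs_def]
  by (intro smooth_germ_sum smooth_germ_mult smooth_germ_C smooth_germ_pb x smooth_u[OF x]) auto

lemma C_M: "i < k \<Longrightarrow> j < k \<Longrightarrow> (\<Sum>l<k. C x i l * M x l j) = (if i = j then 1 else 0)"
  and M_C: "i < k \<Longrightarrow> j < k \<Longrightarrow> (\<Sum>l<k. M x i l * C x l j) = (if i = j then 1 else 0)"
  using nadj_mult[of i k j "M x"] ndet_M
  by (simp_all add: C_def sum_divide_distrib[symmetric])

lemma M_skew: "M x i j = - M x j i"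
  unfolding M_def by (rule pb_skew[OF x])

text \<open>The product of \<open>C\<close>, \<open>M\<close> and the transpose of \<open>C\<close>
  is computed twice: once with \<open>C M = 1\<close>, which gives the transpose of
  \<open>C\<close>, and once with skew symmetry of \<open>M\<close>, which gives minus
  \<open>C\<close>.\<close>

lemma C_skew: "i < k \<Longrightarrow> j < k \<Longrightarrow> C x i j = - C x j i"
proof -
  assume ij: "i < k" "j < k"
  have "(\<Sum>a<k. \<Sum>b<k. C x i a * M x a b * C x j b) = (\<Sum>b<k. (\<Sum>a<k. C x i a * M x a b) * C x j b)"
    by (subst sum.swap) (simp add: sum_distrib_right)
  also have "\<dots> = C x j i"
    using ij by (simp add: C_M if_distrib[of "\<lambda>a. a * _"] cong: if_cong)
  finally have 1: "(\<Sum>a<k. \<Sum>b<k. C x i a * M x a b * C x j b) = C x j i" .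
  have "(\<Sum>a<k. \<Sum>b<k. C x i a * M x a b * C x j b) = (\<Sum>a<k. - (C x i a * (\<Sum>b<k. C x j b * M x b a)))"
    unfolding sum_distrib_left sum_negf[symmetric]
    by (intro sum.cong refl) (subst M_skew, simp)
  also have "\<dots> = - C x i j"
    using ij by (simp add: C_M if_distrib[of "\<lambda>a. _ * a"] sum_negf cong: if_cong)
  finally show ?thesis using 1 by simp
qed

lemma dham_in_tangent_space: "dham f x \<in> tangent_space A x"
  unfolding dham_def[abs_def]
  by (intro tangent_space_diff tangent_space_sum tangent_space_scale ham_in_tangent_space x)

lemma dham_apply: "smooth_germ x g \<Longrightarrow> dham f x g = db f g x"
  by (simp add: dham_def db_def ham_apply[OF x])

lemma db_u: "l < k \<Longrightarrow> db f (u l) x = 0"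
proof -
  assume l: "l < k"
  have "(\<Sum>j<k. co f j x * M x j l) = (\<Sum>i<k. pb f (u i) x * (\<Sum>j<k. C x i j * M x j l))"
    unfolding co_def sum_distrib_left sum_distrib_right by (subst sum.swap) (simp add: mult.assoc)
  also have "\<dots> = pb f (u l) x"
    using l by (simp add: C_M if_distrib[of "\<lambda>a. _ * a"] cong: if_cong)
  finally show ?thesis by (simp add: db_def M_def)
qed

lemma dham_u: "l < k \<Longrightarrow> dham f x (u l) = 0"
  by (simp add: dham_apply smooth_u x db_u)

lemma db_altdef: "db f g x = pb f g x - (\<Sum>i<k. \<Sum>j<k. pb f (u i) x * C x i j * pb (u j) g x)"
  unfolding db_def co_def sum_distrib_right by (subst sum.swap) simp

text \<open>By skew symmetry of \<open>C\<close> the correction can be made in the second argument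
  as well as in the first.\<close>

lemma db_altdef2: "db f g x = pb f g x - (\<Sum>j<k. co g j x * pb f (u j) x)"
proof -
  have "(\<Sum>i<k. \<Sum>j<k. pb f (u i) x * C x i j * pb (u j) g x)
      = (\<Sum>i<k. \<Sum>j<k. pb g (u j) x * C x j i * pb f (u i) x)"
  proof (intro sum.cong refl)
    fix i j assume "i \<in> {..<k}" "j \<in> {..<k}"
    then have "C x i j = - C x j i" by (intro C_skew) auto
    moreover have "pb (u j) g x = - pb g (u j) x" by (rule pb_skew[OF x])
    ultimately show "pb f (u i) x * C x i j * pb (u j) g x = pb g (u j) x * C x j i * pb f (u i) x"
      by simp
  qed
  then show ?thesis unfolding db_altdef co_def sum_distrib_right by simp
qed

lemma db_skew: "db f g x = - db g f x"
  unfolding db_altdef2[of f g] db_def[of g f] using pb_skew[OF x, of f g] pb_skew[OF x, of f]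
  by (simp add: sum_negf)

lemma smooth_germ_db: "smooth_germ x f \<Longrightarrow> smooth_germ x g \<Longrightarrow> smooth_germ x (db f g)"
  unfolding db_def[abs_def]
  by (intro smooth_germ_diff smooth_germ_sum smooth_germ_mult smooth_germ_co smooth_germ_pb x smooth_u[OF x])
    auto

end

context
  fixes x
  assumes x: "x \<in> W"
begin

text \<open>Jacobi identity: correct a function \<open>f\<close> by a combination of the \<open>u j - u j x\<close>, to the effect that
  its Hamiltonian vector field at \<open>x\<close> becomes \<open>dham f x\<close>.\<close>

definition "star f y = f y - (\<Sum>j<k. co f j y * (u j y - u j x))"

lemma smooth_germ_star: "smooth_germ x f \<Longrightarrow> smooth_germ x (star f)"
  unfolding star_def[abs_def]
  by (intro smooth_germ_diff smooth_germ_sum smooth_germ_mult smooth_germ_co x smooth_u[OF x]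
      smooth_germ_const) auto

lemma pb_star:
  assumes y: "y \<in> W" and f: "smooth_germ y f"
  shows "pb g (star f) y
    = pb g f y - (\<Sum>j<k. pb g (co f j) y * (u j y - u j x) + co f j y * pb g (u j) y)"
proof -
  have s: "smooth_germ y (\<lambda>y. co f j y * (u j y - u j x))" if "j < k" for j
    by (intro smooth_germ_mult smooth_germ_diff smooth_germ_const smooth_u y smooth_germ_co f that)
  have "pb g (star f) y = pb g f y - pb g (\<lambda>y. \<Sum>j<k. co f j y * (u j y - u j x)) y"
    unfolding star_def[abs_def] using s by (intro pb_diff[OF y f]) (auto intro: smooth_germ_sum)
  also have "pb g (\<lambda>y. \<Sum>j<k. co f j y * (u j y - u j x)) y
      = (\<Sum>j<k. pb g (\<lambda>y. co f j y * (u j y - u j x)) y)"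
    using s by (intro pb_sum[OF y]) auto
  also have "\<dots> = (\<Sum>j<k. pb g (co f j) y * (u j y - u j x) + co f j y * pb g (u j) y)"
    using f y by (intro sum.cong refl)
      (simp add: pb_mult pb_diff pb_const smooth_germ_co smooth_u smooth_germ_diff)
  finally show ?thesis .
qed

lemma pb_star_x:
  assumes "smooth_germ x f" "smooth_germ x g"
  shows "pb (star f) g x = db f g x"
proof -
  have "pb (star f) g x = - pb g (star f) x" by (rule pb_skew[OF x])
  also have "\<dots> = (\<Sum>j<k. co f j x * pb g (u j) x) - pb g f x"
    by (simp add: pb_star[OF x assms(1)])
  also have "\<dots> = (\<Sum>j<k. co f j x * - pb (u j) g x) - - pb f g x"
    by (simp only: pb_skew[OF x, of g f] pb_skew[OF x, of g "u _"])
  finally show ?thesis by (simp add: db_def sum_negf)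
qed

text \<open>The factors \<open>u j y - u j x\<close> vanish at \<open>x\<close> and are annihilated
  by \<open>v\<close>, so the terms of \<open>pb_star\<close> that contain them contribute
  nothing.\<close>

lemma vertical_pb_star:
  assumes v: "v \<in> tangent_space A x" "\<And>l. l < k \<Longrightarrow> v (u l) = 0"
    and g: "smooth_germ x g" and h: "smooth_germ x h"
  shows "v (pb g (star h)) = v (pb g h) - (\<Sum>j<k. v (\<lambda>y. co h j y * pb g (u j) y))"
proof -
  note T = tangent_add[OF v(1)] tangent_diff[OF v(1)] tangent_mult[OF v(1)] tangent_const[OF v(1)]
  have sm: "smooth_germ x (pb g (co h j))" "smooth_germ x (co h j)" "smooth_germ x (pb g (u j))"
    "smooth_germ x (u j)" "smooth_germ x (\<lambda>y. u j y - u j x)" if "j < k" for j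
    using that x g h smooth_u[OF x that]
    by (auto intro!: smooth_germ_pb smooth_germ_co smooth_germ_diff)
  let ?r = "\<lambda>j y. pb g (co h j) y * (u j y - u j x) + co h j y * pb g (u j) y"
  have r: "smooth_germ x (?r j)" if "j < k" for j
    using sm[OF that] by (intro smooth_germ_add smooth_germ_mult) auto
  have "\<forall>\<^sub>F y in nhds x. pb g (star h) y = pb g h y - (\<Sum>j<k. ?r j y)"
    using eventually_conj[OF smooth_germ_eventually[OF h] eventually_in_W[OF x]]
    by (rule eventually_mono) (rule pb_star, auto)
  then have "v (pb g (star h)) = v (\<lambda>y. pb g h y - (\<Sum>j<k. ?r j y))"
    by (intro tangent_cong[OF v(1)] smooth_germ_pb x g smooth_germ_star h)
  also have "\<dots> = v (pb g h) - (\<Sum>j<k. v (?r j))"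
    using r by (subst tangent_diff[OF v(1)])
      (auto intro!: smooth_germ_pb x g h smooth_germ_sum tangent_sum[OF v(1)])
  also have "(\<Sum>j<k. v (?r j)) = (\<Sum>j<k. v (\<lambda>y. co h j y * pb g (u j) y))"
  proof (intro sum.cong refl)
    fix j assume "j \<in> {..<k}"
    then have j: "j < k" by simp
    have "v (?r j) = v (\<lambda>y. pb g (co h j) y * (u j y - u j x)) + v (\<lambda>y. co h j y * pb g (u j) y)"
      using sm[OF j] by (intro tangent_add[OF v(1)] smooth_germ_mult)
    also have "v (\<lambda>y. pb g (co h j) y * (u j y - u j x)) = 0"
      using sm[OF j] v(2)[OF j] by (simp add: T)
    finally show "v (?r j) = v (\<lambda>y. co h j y * pb g (u j) y)" by simp
  qed
  finally show ?thesis .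
qed

text \<open>In directions that annihilate the \<open>u l\<close>, both brackets have the same first
  derivative at \<open>x\<close>. The point is that \<open>pb (star g) (u j)\<close> vanishes at
  \<open>x\<close> together with its \<open>v\<close>-derivative, because \<open>db (u j) g\<close>
  is zero on all of \<open>W\<close> and not only at \<open>x\<close>.\<close>

lemma vertical_pb_star_star:
  assumes v: "v \<in> tangent_space A x" "\<And>l. l < k \<Longrightarrow> v (u l) = 0"
    and g: "smooth_germ x g" and h: "smooth_germ x h"
  shows "v (pb (star g) (star h)) = v (db g h)"
proof -
  have sm: "smooth_germ x (co h j)" "smooth_germ x (co g j)" "smooth_germ x (u j)"
    "smooth_germ x (pb g (u j))" "smooth_germ x (pb (star g) (u j))" if "j < k" for j
    using that x g h smooth_u[OF x that]
    by (auto intro!: smooth_germ_pb smooth_germ_co smooth_germ_star)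
  have neg: "v (pb f f') = - v (pb f' f)" if "smooth_germ x f" "smooth_germ x f'" for f f'
  proof -
    have "v (pb f f') = v (\<lambda>y. - pb f' f y)"
      using smooth_germ_pb[OF x that] eventually_mono[OF eventually_in_W[OF x] pb_skew]
      by (intro tangent_cong[OF v(1)])
    then show ?thesis using smooth_germ_pb[OF x that(2,1)] by (simp add: tangent_minus[OF v(1)])
  qed
  have "v (\<lambda>y. co h j y * pb (star g) (u j) y) = 0" if j: "j < k" for j
  proof -
    have y0: "pb (u j) g y = (\<Sum>l<k. co g l y * pb (u j) (u l) y)" if y: "y \<in> W" for y
    proof -
      have "db (u j) g y = 0" using db_u[OF y j, of g] db_skew[OF y, of "u j" g] by simp
      then show ?thesis using db_altdef2[OF y, of "u j" g] by simp
    qed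
    have "v (pb (u j) (star g)) = v (pb (u j) g) - (\<Sum>l<k. v (\<lambda>y. co g l y * pb (u j) (u l) y))"
      by (rule vertical_pb_star[OF v sm(3)[OF j] g])
    also have "(\<Sum>l<k. v (\<lambda>y. co g l y * pb (u j) (u l) y)) = v (\<lambda>y. \<Sum>l<k. co g l y * pb (u j) (u l) y)"
      using sm j by (intro tangent_sum[OF v(1), symmetric] smooth_germ_mult smooth_germ_pb x) auto
    also have "\<dots> = v (pb (u j) g)"
      using y0 eventually_in_W[OF x] sm j
      by (intro tangent_cong[OF v(1), symmetric] smooth_germ_pb x g sm(3)) (auto elim: eventually_mono)
    finally have "v (pb (star g) (u j)) = 0"
      using neg[of "star g" "u j"] sm(3)[OF j] smooth_germ_star[OF g] by simp
    moreover have "pb (star g) (u j) x = 0"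
      using pb_star_x[OF g sm(3)[OF j]] db_u[OF x j] by simp
    ultimately show ?thesis using sm[OF j] by (simp add: tangent_mult[OF v(1)])
  qed
  then have "v (pb (star g) (star h)) = v (pb (star g) h)"
    using vertical_pb_star[OF v smooth_germ_star[OF g] h] by simp
  also have "\<dots> = - v (pb h (star g))"
    by (rule neg) (auto intro: smooth_germ_star g h)
  also have "\<dots> = - (v (pb h g) - (\<Sum>j<k. v (\<lambda>y. co g j y * pb h (u j) y)))"
    by (simp only: vertical_pb_star[OF v h g])
  also have "\<dots> = - v (\<lambda>y. pb h g y - (\<Sum>j<k. co g j y * pb h (u j) y))"
    using sm x g h by (subst tangent_diff[OF v(1)])
      (auto intro!: smooth_germ_pb smooth_germ_sum smooth_germ_mult tangent_sum[OF v(1), symmetric])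
  also have "v (\<lambda>y. pb h g y - (\<Sum>j<k. co g j y * pb h (u j) y)) = v (\<lambda>y. - db g h y)"
  proof (rule tangent_cong[OF v(1), symmetric])
    show "smooth_germ x (\<lambda>y. - db g h y)" by (intro smooth_germ_minus smooth_germ_db x g h)
    show "\<forall>\<^sub>F y in nhds x. - db g h y = pb h g y - (\<Sum>j<k. co g j y * pb h (u j) y)"
      using eventually_in_W[OF x] by (rule eventually_mono) (metis db_skew db_altdef2 minus_equation_iff)
  qed
  also have "\<dots> = - v (db g h)"
    by (intro tangent_minus[OF v(1)] smooth_germ_db x g h)
  finally show ?thesis by simp
qed

text \<open>\<open>dham f x\<close> annihilates the \<open>u l\<close>, so the inner Dirac bracket
  may be replaced by a bracket of starred functions before it is applied. The Jacobi identity of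
  \<open>db\<close> thus becomes that of \<open>pb\<close> for \<open>star f\<close>,
  \<open>star g\<close> and \<open>star h\<close>.\<close>

lemma db_db:
  assumes "smooth_germ x f" "smooth_germ x g" "smooth_germ x h"
  shows "db f (db g h) x = pb (star f) (pb (star g) (star h)) x"
proof -
  have sm: "smooth_germ x (pb (star g) (star h))"
    using assms x by (intro smooth_germ_pb smooth_germ_star)
  have "db f (db g h) x = dham f x (db g h)"
    by (rule dham_apply[OF x, symmetric]) (intro smooth_germ_db x assms)
  also have "\<dots> = dham f x (pb (star g) (star h))"
    by (rule vertical_pb_star_star[symmetric])
      (use assms dham_in_tangent_space[OF x] dham_u[OF x] in auto)
  also have "\<dots> = pb (star f) (pb (star g) (star h)) x"
    using dham_apply[OF x sm, of f] pb_star_x[OF assms(1) sm] by simp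
  finally show ?thesis .
qed

lemma db_jacobi:
  assumes "smooth_germ x f" "smooth_germ x g" "smooth_germ x h"
  shows "db f (db g h) x + db g (db h f) x + db h (db f g) x = 0"
  using jacobi[OF x assms[THEN smooth_germ_star]] assms by (simp add: db_db)

text \<open>Jacobi's formula: the logarithmic derivative of a determinant is the trace of the
  inverse matrix times the derivative of the matrix.\<close>

lemma tangent_ln_ndet_M:
  assumes v: "v \<in> tangent_space A x"
  shows "v (\<lambda>y. ln \<bar>ndet k (M y)\<bar>) = (\<Sum>i<k. \<Sum>j<k. C x j i * v (\<lambda>y. M y i j))"
proof -
  have "v (\<lambda>y. ndet k (M y)) = (\<Sum>i<k. \<Sum>j<k. v (\<lambda>y. M y i j) * nadj k (M x) j i)"
    by (subst tangent_ndet[OF v]) (auto intro!: smooth_germ_M x simp: ndet_replace_row)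
  then show ?thesis
    using tangent_ln_abs[OF v smooth_germ_ndet_M[OF x] ndet_M[OF x]]
    by (simp add: C_def sum_divide_distrib mult.commute)
qed

text \<open>Differentiate \<open>C M = 1\<close> and multiply by \<open>C\<close> from the
  right.\<close>

lemma tangent_C:
  assumes v: "v \<in> tangent_space A x" and ij: "i < k" "j < k"
  shows "v (\<lambda>y. C y i j) = - (\<Sum>a<k. \<Sum>b<k. C x i a * v (\<lambda>y. M y a b) * C x b j)"
proof -
  have *: "(\<Sum>a<k. v (\<lambda>y. C y i a) * M x a b) = - (\<Sum>a<k. C x i a * v (\<lambda>y. M y a b))" if b: "b < k" for b
  proof -
    have "0 = v (\<lambda>y. \<Sum>a<k. C y i a * M y a b)"
      using eventually_in_W[OF x] C_M[OF _ ij(1) b]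
      by (subst tangent_cong[OF v _ , of _ "\<lambda>_. if i = b then 1 else 0"])
        (auto simp: tangent_const[OF v] elim!: eventually_mono
          intro!: smooth_germ_sum smooth_germ_mult smooth_germ_C smooth_germ_M x ij b)
    also have "\<dots> = (\<Sum>a<k. v (\<lambda>y. C y i a) * M x a b + C x i a * v (\<lambda>y. M y a b))"
      using b ij by (subst tangent_sum[OF v])
        (auto intro!: smooth_germ_mult smooth_germ_C smooth_germ_M x sum.cong tangent_mult[OF v])
    finally show ?thesis by (simp add: sum.distrib)
  qed
  have "v (\<lambda>y. C y i j) = (\<Sum>a<k. v (\<lambda>y. C y i a) * (if a = j then 1 else 0))"
    using ij by (simp add: if_distrib[of "\<lambda>a. _ * a"] cong: if_cong)
  also have "\<dots> = (\<Sum>a<k. v (\<lambda>y. C y i a) * (\<Sum>b<k. M x a b * C x b j))"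
    using ij by (intro sum.cong refl) (simp add: M_C[OF x])
  also have "\<dots> = (\<Sum>b<k. (\<Sum>a<k. v (\<lambda>y. C y i a) * M x a b) * C x b j)"
    unfolding sum_distrib_left sum_distrib_right by (subst sum.swap) (simp add: mult.assoc)
  also have "\<dots> = (\<Sum>b<k. - (\<Sum>a<k. C x i a * v (\<lambda>y. M y a b)) * C x b j)"
    by (intro sum.cong refl) (simp add: *)
  also have "\<dots> = - (\<Sum>a<k. \<Sum>b<k. C x i a * v (\<lambda>y. M y a b) * C x b j)"
    by (subst sum.swap) (simp add: sum_negf sum_distrib_right)
  finally show ?thesis .
qed

text \<open>As \<open>C\<close> is skew, the double bracket may be antisymmetrized in
  \<open>i\<close> and \<open>j\<close>, which accounts for the factor 2. The Jacobi identity turns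
  the difference into minus the bracket of \<open>f\<close> with \<open>M i j\<close>, and Jacobi's
  formula for the determinant sums these up.\<close>

lemma C_pb_pb:
  assumes f: "smooth_germ x f"
  shows "2 * (\<Sum>i<k. \<Sum>j<k. C x i j * pb (u j) (pb f (u i)) x) = pb f (\<lambda>y. ln \<bar>ndet k (M y)\<bar>) x"
proof -
  have "2 * (\<Sum>i<k. \<Sum>j<k. C x i j * pb (u j) (pb f (u i)) x)
      = (\<Sum>i<k. \<Sum>j<k. C x i j * (pb (u j) (pb f (u i)) x - pb (u i) (pb f (u j)) x))"
    by (rule sum_skew) (rule C_skew[OF x])
  also have "\<dots> = (\<Sum>i<k. \<Sum>j<k. C x j i * pb f (\<lambda>y. M y i j) x)"
  proof (intro sum.cong refl)
    fix i j assume "i \<in> {..<k}" "j \<in> {..<k}"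
    then have ij: "i < k" "j < k" by auto
    have "\<forall>\<^sub>F y in nhds x. pb (u j) f y = - pb f (u j) y"
      using eventually_in_W[OF x] by (rule eventually_mono) (rule pb_skew)
    then have "pb (u i) (pb (u j) f) x = pb (u i) (\<lambda>y. - pb f (u j) y) x"
      using ij f by (intro pb_cong[OF x] smooth_germ_pb x smooth_u)
    also have "\<dots> = - pb (u i) (pb f (u j)) x"
      using ij f by (intro pb_minus smooth_germ_pb x smooth_u)
    finally have "pb (u j) (pb f (u i)) x - pb (u i) (pb f (u j)) x = - pb f (\<lambda>y. M y i j) x"
      using jacobi[OF x f smooth_u[OF x ij(1)] smooth_u[OF x ij(2)]] by (simp add: M_def[abs_def])
    then show "C x i j * (pb (u j) (pb f (u i)) x - pb (u i) (pb f (u j)) x) = C x j i * pb f (\<lambda>y. M y i j) x"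
      using C_skew[OF x ij] by simp
  qed
  also have "\<dots> = ham f x (\<lambda>y. ln \<bar>ndet k (M y)\<bar>)"
    unfolding tangent_ln_ndet_M[OF ham_in_tangent_space[OF x]]
    by (intro sum.cong refl) (simp add: ham_apply x smooth_germ_M)
  also have "\<dots> = pb f (\<lambda>y. ln \<bar>ndet k (M y)\<bar>) x"
    by (intro ham_apply x smooth_germ_ln_abs smooth_germ_ndet_M ndet_M)
  finally show ?thesis .
qed

lemma C_pb_M:
  assumes a: "a < k"
  shows "2 * (\<Sum>b<k. \<Sum>j<k. C x b j * pb (u j) (\<lambda>y. M y a b) x) = pb (u a) (\<lambda>y. ln \<bar>ndet k (M y)\<bar>) x"
  using C_pb_pb[OF smooth_u[OF x a]] by (simp add: M_def[abs_def])

text \<open>For a volume form with respect to which all Hamiltonian vector fields of \<open>\<Lambda>\<close> are divergence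
  free, \<open>\<Sum>j<k. pb (u j) (co f j)\<close> is minus the divergence of \<open>dham f\<close>.\<close>

lemma sum_pb_co:
  assumes f: "smooth_germ x f"
  shows "2 * (\<Sum>j<k. pb (u j) (co f j) x) = db f (\<lambda>y. ln \<bar>ndet k (M y)\<bar>) x"
proof -
  let ?L = "\<lambda>y. ln \<bar>ndet k (M y)\<bar>"
  have co: "pb (u j) (co f j) x
      = (\<Sum>i<k. C x i j * pb (u j) (pb f (u i)) x) + (\<Sum>i<k. pb f (u i) x * pb (u j) (\<lambda>y. C y i j) x)"
    if j: "j < k" for j
  proof -
    have "pb (u j) (co f j) x = (\<Sum>i<k. pb (u j) (\<lambda>y. pb f (u i) y * C y i j) x)"
      unfolding co_def[abs_def]
      using j f by (intro pb_sum[OF x]) (auto intro!: smooth_germ_mult smooth_germ_pb smooth_germ_C x smooth_u)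
    also have "\<dots> = (\<Sum>i<k. pb (u j) (pb f (u i)) x * C x i j + pb f (u i) x * pb (u j) (\<lambda>y. C y i j) x)"
      using j f by (intro sum.cong refl pb_mult[OF x]) (auto intro!: smooth_germ_pb smooth_germ_C x smooth_u)
    finally show ?thesis by (simp add: sum.distrib mult.commute)
  qed
  have pbC: "pb (u j) (\<lambda>y. C y i j) x = - (\<Sum>a<k. \<Sum>b<k. C x i a * pb (u j) (\<lambda>y. M y a b) x * C x b j)"
    if "i < k" "j < k" for i j
    using tangent_C[OF ham_in_tangent_space[OF x] that, of "u j"] that
    by (simp add: ham_apply x smooth_germ_C smooth_germ_M)
  have "2 * (\<Sum>j<k. pb (u j) (\<lambda>y. C y i j) x) = - (\<Sum>a<k. C x i a * pb (u a) ?L x)" if i: "i < k" for i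
  proof -
    have "(\<Sum>j<k. pb (u j) (\<lambda>y. C y i j) x)
        = - (\<Sum>j<k. \<Sum>a<k. \<Sum>b<k. C x i a * (C x b j * pb (u j) (\<lambda>y. M y a b) x))"
      by (simp add: pbC i sum_negf mult_ac)
    also have "(\<Sum>j<k. \<Sum>a<k. \<Sum>b<k. C x i a * (C x b j * pb (u j) (\<lambda>y. M y a b) x))
        = (\<Sum>a<k. \<Sum>j<k. \<Sum>b<k. C x i a * (C x b j * pb (u j) (\<lambda>y. M y a b) x))"
      by (rule sum.swap)
    also have "\<dots> = (\<Sum>a<k. C x i a * (\<Sum>b<k. \<Sum>j<k. C x b j * pb (u j) (\<lambda>y. M y a b) x))"
      unfolding sum_distrib_left by (intro sum.cong refl sum.swap)
    finally have "2 * (\<Sum>j<k. pb (u j) (\<lambda>y. C y i j) x)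
        = - (\<Sum>a<k. C x i a * (2 * (\<Sum>b<k. \<Sum>j<k. C x b j * pb (u j) (\<lambda>y. M y a b) x)))"
      by (simp add: sum_distrib_left mult_ac)
    then show ?thesis by (simp add: C_pb_M)
  qed
  \<comment> \<open>This is minus the correction term in \<open>db_altdef\<close> with
    \<open>?L\<close> as second argument; together with \<open>C_pb_pb\<close>, which gives the
    uncorrected bracket, it completes the Dirac bracket.\<close>
  then have F2: "(\<Sum>i<k. pb f (u i) x * (2 * (\<Sum>j<k. pb (u j) (\<lambda>y. C y i j) x)))
      = - (\<Sum>i<k. \<Sum>a<k. pb f (u i) x * C x i a * pb (u a) ?L x)"
    by (simp add: sum_negf sum_distrib_left mult.assoc)
  have "2 * (\<Sum>j<k. pb (u j) (co f j) x)
      = 2 * (\<Sum>j<k. \<Sum>i<k. C x i j * pb (u j) (pb f (u i)) x)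
        + 2 * (\<Sum>j<k. \<Sum>i<k. pb f (u i) x * pb (u j) (\<lambda>y. C y i j) x)"
    by (simp add: co sum.distrib)
  also have "(\<Sum>j<k. \<Sum>i<k. C x i j * pb (u j) (pb f (u i)) x)
      = (\<Sum>i<k. \<Sum>j<k. C x i j * pb (u j) (pb f (u i)) x)" by (rule sum.swap)
  also have "2 * \<dots> = pb f ?L x" by (rule C_pb_pb[OF f])
  also have "2 * (\<Sum>j<k. \<Sum>i<k. pb f (u i) x * pb (u j) (\<lambda>y. C y i j) x)
      = (\<Sum>i<k. pb f (u i) x * (2 * (\<Sum>j<k. pb (u j) (\<lambda>y. C y i j) x)))"
    by (subst sum.swap) (simp add: sum_distrib_left mult_ac)
  finally show ?thesis unfolding F2 db_altdef[OF x] by simp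
qed

end

end

section \<open>Volume forms and divergence\<close>

lemma sum_PiE_insert:
  fixes g :: "('i \<Rightarrow> 'j) \<Rightarrow> real"
  assumes "m \<notin> S"
  shows "(\<Sum>s\<in>PiE (insert m S) T. g s) = (\<Sum>s\<in>PiE S T. \<Sum>j\<in>T m. g (s(m := j)))"
proof -
  have "(\<Sum>s\<in>PiE (insert m S) T. g s) = (\<Sum>(j, s)\<in>T m \<times> PiE S T. g (s(m := j)))"
    unfolding PiE_insert_eq by (subst sum.reindex[OF inj_combinator[OF assms]]) (simp add: case_prod_beta)
  also have "\<dots> = (\<Sum>j\<in>T m. \<Sum>s\<in>PiE S T. g (s(m := j)))" by (simp add: sum.cartesian_product)
  finally show ?thesis by (subst sum.swap)
qed

context smooth_mfd
begin

context
  fixes W \<Omega> x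
  assumes vol: "volume_form A n W \<Omega>" and x: "x \<in> W"
begin

abbreviation (input) vol_at :: "(nat \<Rightarrow> 'a tvec) \<Rightarrow> real" where
  "vol_at v \<equiv> \<Omega> x (map v [0..<n])"

lemma map_list_update: "i < n \<Longrightarrow> (map v [0..<n])[i := w] = map (v(i := w)) [0..<n]"
  by (rule nth_equalityI) (auto simp: nth_list_update)

context
  fixes v :: "nat \<Rightarrow> 'a tvec"
  assumes v: "\<And>i. i < n \<Longrightarrow> v i \<in> tangent_space A x"
begin

lemma vol_at_facts:
  shows "\<And>i u w. i < n \<Longrightarrow> u \<in> tangent_space A x \<Longrightarrow> w \<in> tangent_space A x \<Longrightarrow>
      vol_at (v(i := (\<lambda>f. u f + w f))) = vol_at (v(i := u)) + vol_at (v(i := w))"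
    and "\<And>i u r. i < n \<Longrightarrow> u \<in> tangent_space A x \<Longrightarrow>
      vol_at (v(i := (\<lambda>f. r * u f))) = r * vol_at (v(i := u))"
    and "\<And>i j. i < n \<Longrightarrow> j < n \<Longrightarrow> i \<noteq> j \<Longrightarrow> v i = v j \<Longrightarrow> vol_at v = 0"
proof -
  let ?vs = "map v [0..<n]"
  have "length ?vs = n \<and> set ?vs \<subseteq> tangent_space A x" using v by auto
  note * = vol[unfolded volume_form_def, THEN conjunct1, THEN bspec, OF x, THEN spec, THEN mp, OF this]
  show "vol_at (v(i := (\<lambda>f. u f + w f))) = vol_at (v(i := u)) + vol_at (v(i := w))"
    if "i < n" "u \<in> tangent_space A x" "w \<in> tangent_space A x" for i u w
    using *[THEN conjunct1] that by (simp add: map_list_update)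
  show "vol_at (v(i := (\<lambda>f. r * u f))) = r * vol_at (v(i := u))"
    if "i < n" "u \<in> tangent_space A x" for i u r
    using *[THEN conjunct2, THEN conjunct1] that by (simp add: map_list_update)
  show "vol_at v = 0" if "i < n" "j < n" "i \<noteq> j" "v i = v j" for i j
    using *[THEN conjunct2, THEN conjunct2] that by auto
qed

lemma vol_at_sum:
  assumes "i < n" "finite J" "\<And>j. j \<in> J \<Longrightarrow> e j \<in> tangent_space A x"
  shows "vol_at (v(i := (\<lambda>f. \<Sum>j\<in>J. c j * e j f))) = (\<Sum>j\<in>J. c j * vol_at (v(i := e j)))"
  using assms(2,3)
proof (induction J rule: finite_induct)
  case empty
  show ?case
    using vol_at_facts(2)[OF assms(1) zero_in_tangent_space, of 0]
    by (simp only: mult_zero_left sum.empty)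
next
  case (insert j J)
  have e: "e j \<in> tangent_space A x" using insert.prems by simp
  have e': "(\<lambda>f. \<Sum>j\<in>J. c j * e j f) \<in> tangent_space A x"
    using insert.prems by (intro tangent_space_sum tangent_space_scale) auto
  have "(\<lambda>f. \<Sum>j\<in>insert j J. c j * e j f) = (\<lambda>f. c j * e j f + (\<Sum>j\<in>J. c j * e j f))"
    using insert.hyps by simp
  then have "vol_at (v(i := (\<lambda>f. \<Sum>j\<in>insert j J. c j * e j f)))
      = vol_at (v(i := (\<lambda>f. c j * e j f))) + vol_at (v(i := (\<lambda>f. \<Sum>j\<in>J. c j * e j f)))"
    using vol_at_facts(1)[OF assms(1) tangent_space_scale[OF e, of "c j"] e'] by (simp only:)
  also have "vol_at (v(i := (\<lambda>f. c j * e j f))) = c j * vol_at (v(i := e j))"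
    by (rule vol_at_facts(2)[OF assms(1) e])
  also have "vol_at (v(i := (\<lambda>f. \<Sum>j\<in>J. c j * e j f))) = (\<Sum>j\<in>J. c j * vol_at (v(i := e j)))"
    by (rule insert.IH) (use insert.prems in auto)
  finally show ?case by (simp only: sum.insert[OF insert.hyps])
qed

end

text \<open>Polarization: put the sum of \<open>v i\<close> and \<open>v j\<close> into both slots
  and expand. The definition of a volume form supplies only the vanishing on repeated
  vectors.\<close>

lemma vol_at_swap:
  assumes v: "\<And>i. i < n \<Longrightarrow> v i \<in> tangent_space A x" and ij: "i < n" "j < n" "i \<noteq> j"
  shows "vol_at (v \<circ> Transposition.transpose i j) = - vol_at v"
proof -
  define F where "F a b = vol_at (v(i := a, j := b))" for a b
  let ?T = "tangent_space A x"
  have F1: "F (\<lambda>f. a f + a' f) b = F a b + F a' b" if "a \<in> ?T" "a' \<in> ?T" "b \<in> ?T" for a a' b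
    using vol_at_facts(1)[of "v(j := b)" i a a'] that v ij by (simp add: F_def fun_upd_twist)
  have F2: "F a (\<lambda>f. b f + b' f) = F a b + F a b'" if "a \<in> ?T" "b \<in> ?T" "b' \<in> ?T" for a b b'
    using vol_at_facts(1)[of "v(i := a)" j b b'] that v ij by (simp add: F_def)
  have F0: "F a a = 0" if "a \<in> ?T" for a
    using vol_at_facts(3)[of "v(i := a, j := a)" i j] that v ij by (simp add: F_def)
  have "F (\<lambda>f. v i f + v j f) (\<lambda>f. v i f + v j f) = F (v i) (v j) + F (v j) (v i)"
    using v ij by (simp add: F1 F2 F0 tangent_space_add)
  then have "F (v j) (v i) = - F (v i) (v j)"
    using F0[of "\<lambda>f. v i f + v j f"] v ij tangent_space_add by simp
  moreover have "v(i := v i, j := v j) = v" by auto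
  moreover have "v(i := v j, j := v i) = v \<circ> Transposition.transpose i j"
    using ij by (auto simp: fun_eq_iff Transposition.transpose_def)
  ultimately show ?thesis by (simp add: F_def)
qed

lemma vol_at_permutes:
  assumes "p permutes {..<n}" "\<And>i. i < n \<Longrightarrow> v i \<in> tangent_space A x"
  shows "vol_at (v \<circ> p) = of_int (sign p) * vol_at v"
  using assms(1) finite_lessThan assms(2)
proof (induction arbitrary: v rule: permutes_induct)
  case id
  then show ?case by simp
next
  case (swap a b p)
  have "vol_at (v \<circ> (Transposition.transpose a b \<circ> p)) = vol_at ((v \<circ> Transposition.transpose a b) \<circ> p)"
    by (simp add: comp_assoc)
  also have "\<dots> = of_int (sign p) * vol_at (v \<circ> Transposition.transpose a b)"
    using swap by (intro swap.IH) (auto simp: Transposition.transpose_def)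
  also have "\<dots> = - of_int (sign p) * vol_at v"
    using vol_at_swap[of v a b] swap by simp
  also have "- of_int (sign p) = of_int (sign (Transposition.transpose a b \<circ> p))"
    using swap by (subst sign_compose)
      (auto simp: sign_swap_id permutation_swap_id intro: permutes_imp_permutation[of "{..<n}"])
  finally show ?case .
qed

text \<open>Multilinearity is used for one argument at a time. After \<open>m\<close> arguments the
  function \<open>s\<close> on \<open>{..<m}\<close> records which vector of \<open>e\<close> was
  chosen in each of them.\<close>

lemma vol_at_expand_rows:
  assumes e: "\<And>j. j < n \<Longrightarrow> e j \<in> tangent_space A x" and "m \<le> n"
    and v: "\<And>i. i < n \<Longrightarrow> v i = (\<lambda>f. \<Sum>j<n. B i j * e j f)"
  shows "vol_at v = (\<Sum>s\<in>PiE {..<m} (\<lambda>_. {..<n}). (\<Prod>i<m. B i (s i)) *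
    vol_at (\<lambda>i. if i < m then e (s i) else v i))"
  using \<open>m \<le> n\<close>
proof (induction m)
  case 0
  then show ?case by simp
next
  case (Suc m)
  have vT: "v i \<in> tangent_space A x" if "i < n" for i
    unfolding v[OF that] using e by (intro tangent_space_sum tangent_space_scale) auto
  have "vol_at v = (\<Sum>s\<in>PiE {..<m} (\<lambda>_. {..<n}). (\<Prod>i<m. B i (s i)) *
      vol_at (\<lambda>i. if i < m then e (s i) else v i))"
    using Suc by simp
  also have "\<dots> = (\<Sum>s\<in>PiE {..<m} (\<lambda>_. {..<n}). \<Sum>j<n. (\<Prod>i<Suc m. B i ((s(m := j)) i)) *
      vol_at (\<lambda>i. if i < Suc m then e ((s(m := j)) i) else v i))"
  proof (rule sum.cong[OF refl])
    fix s assume s: "s \<in> PiE {..<m} (\<lambda>_. {..<n})"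
    let ?w = "\<lambda>i. if i < m then e (s i) else v i"
    have "?w = ?w(m := (\<lambda>f. \<Sum>j<n. B m j * e j f))" using v[of m] Suc.prems by auto
    then have "vol_at ?w = vol_at (?w(m := (\<lambda>f. \<Sum>j<n. B m j * e j f)))" by simp
    also have "\<dots> = (\<Sum>j<n. B m j * vol_at (?w(m := e j)))"
      using s Suc.prems e vT by (intro vol_at_sum) (auto simp: PiE_def Pi_def)
    finally have "vol_at ?w = (\<Sum>j<n. B m j * vol_at (?w(m := e j)))" .
    moreover have "?w(m := e j) = (\<lambda>i. if i < Suc m then e ((s(m := j)) i) else v i)" for j
      by (auto simp: fun_eq_iff less_Suc_eq)
    moreover have "(\<Prod>i<m. B i (s i)) = (\<Prod>i<m. B i ((s(m := j)) i))" for j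
      by (rule prod.cong) auto
    ultimately show "(\<Prod>i<m. B i (s i)) * vol_at ?w = (\<Sum>j<n. (\<Prod>i<Suc m. B i ((s(m := j)) i)) *
        vol_at (\<lambda>i. if i < Suc m then e ((s(m := j)) i) else v i))"
      by (simp add: sum_distrib_left mult.assoc)
  qed
  also have "\<dots> = (\<Sum>s\<in>PiE {..<Suc m} (\<lambda>_. {..<n}). (\<Prod>i<Suc m. B i (s i)) *
      vol_at (\<lambda>i. if i < Suc m then e (s i) else v i))"
    unfolding lessThan_Suc by (rule sum_PiE_insert[symmetric]) simp
  finally show ?case .
qed

text \<open>In the full expansion the choices \<open>s\<close> with a repetition vanish. The
  injective ones are the permutations of \<open>{..<n}\<close>, extended by the identity, and their
  signs produce the Leibniz formula.\<close>

lemma vol_at_expand: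
  assumes e: "\<And>j. j < n \<Longrightarrow> e j \<in> tangent_space A x"
    and v: "\<And>i. i < n \<Longrightarrow> v i = (\<lambda>f. \<Sum>j<n. B i j * e j f)"
  shows "vol_at v = ndet n B * vol_at e"
proof -
  let ?P = "PiE {..<n} (\<lambda>_. {..<n})"
  let ?g = "\<lambda>s. (\<Prod>i<n. B i (s i)) * vol_at (\<lambda>i. e (s i))"
  have "vol_at v = (\<Sum>s\<in>?P. (\<Prod>i<n. B i (s i)) * vol_at (\<lambda>i. if i < n then e (s i) else v i))"
    by (rule vol_at_expand_rows[OF e le_refl v])
  also have "\<dots> = (\<Sum>s\<in>?P. ?g s)"
    by (intro sum.cong refl arg_cong[of _ _ "\<lambda>l. _ * \<Omega> x l"]) auto
  also have "\<dots> = (\<Sum>s\<in>{s \<in> ?P. inj_on s {..<n}}. ?g s)"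
  proof (rule sum.mono_neutral_right)
    show "\<forall>s\<in>?P - {s \<in> ?P. inj_on s {..<n}}. ?g s = 0"
    proof
      fix s assume s: "s \<in> ?P - {s \<in> ?P. inj_on s {..<n}}"
      then obtain i j where "i < n" "j < n" "i \<noteq> j" "s i = s j" by (auto simp: inj_on_def)
      moreover have "e (s i) \<in> tangent_space A x" if "i < n" for i
        using s that by (intro e) auto
      ultimately show "?g s = 0"
        using vol_at_facts(3)[of "\<lambda>i. e (s i)" i j] by auto
    qed
  qed (auto intro: finite_PiE)
  also have "\<dots> = (\<Sum>p | p permutes {..<n}. of_int (sign p) * (\<Prod>i<n. B i (p i)) * vol_at e)"
  proof (rule sum.reindex_bij_witness[where
        i="\<lambda>p. restrict p {..<n}" and j="\<lambda>s i. if i < n then s i else i"])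
    fix s assume s: "s \<in> {s \<in> ?P. inj_on s {..<n}}"
    let ?p = "\<lambda>i. if i < n then s i else i"
    have "s ` {..<n} \<subseteq> {..<n}" using s by auto
    then have "bij_betw s {..<n} {..<n}"
      using s endo_inj_surj[of "{..<n}" s] by (simp add: bij_betw_def)
    then have "bij_betw ?p {..<n} {..<n}" by (rule bij_betw_cong[THEN iffD1, rotated]) auto
    then have p: "?p permutes {..<n}" by (rule bij_imp_permutes) auto
    show "restrict ?p {..<n} = s" using s by (auto simp: fun_eq_iff PiE_def extensional_def)
    show "?p \<in> {p. p permutes {..<n}}" using p by simp
    have "vol_at (\<lambda>i. e (s i)) = vol_at (e \<circ> ?p)"
      by (intro arg_cong[of _ _ "\<Omega> x"]) auto
    then show "of_int (sign ?p) * (\<Prod>i<n. B i (?p i)) * vol_at e = ?g s"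
      using vol_at_permutes[OF p e] by simp
  next
    fix p assume "p \<in> {p. p permutes {..<n}}"
    then have p: "p permutes {..<n}" by simp
    show "(\<lambda>i. if i < n then restrict p {..<n} i else i) = p"
      using permutes_not_in[OF p] by (auto simp: fun_eq_iff)
    show "restrict p {..<n} \<in> {s \<in> ?P. inj_on s {..<n}}"
      using permutes_in_image[OF p] inj_onD[OF permutes_inj_on[OF p, of "{..<n}"]] by (auto simp: inj_on_def)
  qed
  finally show ?thesis by (simp add: ndet_permutes sum_distrib_right)
qed

text \<open>If the form vanished on the frame, it would by \<open>vol_at_expand\<close> vanish on
  every list of \<open>n\<close> tangent vectors.\<close>

lemma vol_frame_nonzero:
  assumes c: "coordinates V X D" "x \<in> V"
  shows "vol_at (\<lambda>i. D i x) \<noteq> 0"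
proof
  assume 0: "vol_at (\<lambda>i. D i x) = 0"
  obtain vs where vs: "length vs = n" "set vs \<subseteq> tangent_space A x" "\<Omega> x vs \<noteq> 0"
    using vol[unfolded volume_form_def, THEN conjunct2, THEN conjunct2, THEN bspec, OF x] by (elim exE conjE)
  have eq: "vs = map (\<lambda>i. vs ! i) [0..<n]" using vs(1) by (intro nth_equalityI) auto
  have "vol_at (\<lambda>i. vs ! i) = ndet n (\<lambda>i j. (vs ! i) (X j)) * vol_at (\<lambda>i. D i x)"
    using vs(1,2) by (intro vol_at_expand coordinatesD(4)[OF c] tangent_expand[OF c]) auto
  then show False using eq vs(3) 0 by simp
qed

end

lemma smooth_germ_vol:
  assumes vol: "volume_form A n W \<Omega>" and V: "open V" "V \<subseteq> W" "x \<in> V"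
    and Ys: "length Ys = n" "\<And>Y. Y \<in> set Ys \<Longrightarrow> vector_field A V Y"
  shows "smooth_germ x (\<lambda>y. \<Omega> y (map (\<lambda>Y. Y y) Ys))"
proof -
  have "smooth_fun A V (\<lambda>y. \<Omega> y (map (\<lambda>Y. Y y) Ys))"
    using vol[unfolded volume_form_def, THEN conjunct2, THEN conjunct1, THEN spec, THEN spec, THEN mp, of V Ys]
      V Ys by blast
  then show ?thesis using V by (simp add: smooth_fun_iff)
qed

lemma vector_field_subset: "vector_field A V Y \<Longrightarrow> U \<subseteq> V \<Longrightarrow> vector_field A U Y"
  by (auto simp: vector_field_def)

lemma vector_fieldD:
  assumes "vector_field A V Y" "open V" "x \<in> V"
  shows "Y x \<in> tangent_space A x" "\<And>f. smooth_germ x f \<Longrightarrow> smooth_germ x (\<lambda>y. Y y f)"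
  using assms by (auto simp: vector_field_iff)

text \<open>Second derivatives do not spoil the product rule: the mixed terms, such as
  \<open>Y f * Z g\<close>, are the same in both orders of differentiation and cancel.\<close>

lemma lie_bracket_in_tangent_space:
  assumes Y: "vector_field A V Y" and Z: "vector_field A V Z" and V: "open V" "x \<in> V"
  shows "lie_bracket A Y Z x \<in> tangent_space A x"
proof -
  note YT = vector_fieldD(1)[OF Y V] and ZT = vector_fieldD(1)[OF Z V]
  note Ys = vector_fieldD(2)[OF Y V] and Zs = vector_fieldD(2)[OF Z V]
  have ev: "\<forall>\<^sub>F y in nhds x. y \<in> V \<and> smooth_germ y f" if "smooth_germ x f" for f
    by (intro eventually_conj eventually_nhds_in_open V smooth_germ_eventually that)
  show ?thesis
  proof (rule tangent_spaceI)
    fix f g assume f: "smooth_germ x f" and eq: "\<forall>\<^sub>F y in nhds x. f y = g y"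
    have g: "smooth_germ x g" by (rule smooth_germ_transform[OF f eq])
    have eq': "\<forall>\<^sub>F y in nhds x. T y f = T y g" if T: "vector_field A V T" for T
    proof -
      have "\<forall>\<^sub>F y in nhds x. \<forall>\<^sub>F z in nhds y. f z = g z" using eq by (simp add: eventually_eventually)
      with ev[OF f] show ?thesis
        by eventually_elim (use tangent_cong vector_fieldD(1)[OF T V(1)] in blast)
    qed
    show "lie_bracket A Y Z x f = lie_bracket A Y Z x g"
      using f g tangent_cong[OF YT Zs[OF f] eq'[OF Z]] tangent_cong[OF ZT Ys[OF f] eq'[OF Y]]
      by (simp add: lie_bracket_def)
  next
    fix f g assume f: "smooth_germ x f" and g: "smooth_germ x g"
    have eq: "\<forall>\<^sub>F y in nhds x. T y f + T y g = T y (\<lambda>y. f y + g y)" if T: "vector_field A V T" for T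
      using ev[OF f] ev[OF g]
      by eventually_elim (use tangent_add vector_fieldD(1)[OF T V(1)] in metis)
    have "Y x (\<lambda>y. Z y (\<lambda>y. f y + g y)) = Y x (\<lambda>y. Z y f) + Y x (\<lambda>y. Z y g)"
      using tangent_cong[OF YT _ eq[OF Z]] f g Zs by (simp add: tangent_add[OF YT] smooth_germ_add)
    moreover have "Z x (\<lambda>y. Y y (\<lambda>y. f y + g y)) = Z x (\<lambda>y. Y y f) + Z x (\<lambda>y. Y y g)"
      using tangent_cong[OF ZT _ eq[OF Y]] f g Ys by (simp add: tangent_add[OF ZT] smooth_germ_add)
    ultimately show "lie_bracket A Y Z x (\<lambda>y. f y + g y) = lie_bracket A Y Z x f + lie_bracket A Y Z x g"
      using f g by (simp add: lie_bracket_def smooth_germ_add)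
  next
    fix r f assume f: "smooth_germ x f"
    have eq: "\<forall>\<^sub>F y in nhds x. r * T y f = T y (\<lambda>y. r * f y)" if T: "vector_field A V T" for T
      using ev[OF f]
      by eventually_elim (use tangent_scale vector_fieldD(1)[OF T V(1)] in metis)
    have "Y x (\<lambda>y. Z y (\<lambda>y. r * f y)) = r * Y x (\<lambda>y. Z y f)"
      using tangent_cong[OF YT _ eq[OF Z]] f Zs by (simp add: tangent_scale[OF YT] smooth_germ_mult)
    moreover have "Z x (\<lambda>y. Y y (\<lambda>y. r * f y)) = r * Z x (\<lambda>y. Y y f)"
      using tangent_cong[OF ZT _ eq[OF Y]] f Ys by (simp add: tangent_scale[OF ZT] smooth_germ_mult)
    ultimately show "lie_bracket A Y Z x (\<lambda>y. r * f y) = r * lie_bracket A Y Z x f"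
      using f by (simp add: lie_bracket_def smooth_germ_mult right_diff_distrib)
  next
    fix f g assume f: "smooth_germ x f" and g: "smooth_germ x g"
    have eq: "\<forall>\<^sub>F y in nhds x. T y f * g y + f y * T y g = T y (\<lambda>y. f y * g y)" if T: "vector_field A V T" for T
      using ev[OF f] ev[OF g]
      by eventually_elim (use tangent_mult vector_fieldD(1)[OF T V(1)] in metis)
    have "Y x (\<lambda>y. Z y (\<lambda>y. f y * g y))
        = Y x (\<lambda>y. Z y f) * g x + Z x f * Y x g + Y x f * Z x g + f x * Y x (\<lambda>y. Z y g)"
      using tangent_cong[OF YT _ eq[OF Z]] f g Zs
      by (simp add: tangent_add[OF YT] tangent_mult[OF YT] smooth_germ_add smooth_germ_mult)
    moreover have "Z x (\<lambda>y. Y y (\<lambda>y. f y * g y))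
        = Z x (\<lambda>y. Y y f) * g x + Y x f * Z x g + Z x f * Y x g + f x * Z x (\<lambda>y. Y y g)"
      using tangent_cong[OF ZT _ eq[OF Y]] f g Ys
      by (simp add: tangent_add[OF ZT] tangent_mult[OF ZT] smooth_germ_add smooth_germ_mult)
    ultimately show "lie_bracket A Y Z x (\<lambda>y. f y * g y)
        = lie_bracket A Y Z x f * g x + f x * lie_bracket A Y Z x g"
      using f g by (simp add: lie_bracket_def smooth_germ_mult algebra_simps)
  qed (simp add: lie_bracket_def)
qed

text \<open>Expanding the test fields in the frame with coefficient matrix \<open>B\<close> turns
  the form into \<open>det B * w\<close>. The derivatives of \<open>B\<close> cancel against those
  in the Lie brackets, and what remains is the classical divergence for the density
  \<open>w\<close>.\<close>

lemma lie_derivative_coordinates: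
  assumes vol: "volume_form A n W \<Omega>" "x \<in> W" and c: "coordinates V0 X D" "x \<in> V0"
    and V: "open V" "V \<subseteq> W" "V \<subseteq> V0" "x \<in> V"
    and Y: "vector_field A V Y"
    and Ys: "length Ys = n" "\<And>Z. Z \<in> set Ys \<Longrightarrow> vector_field A V Z"
  defines "w \<equiv> \<lambda>y. \<Omega> y (map (\<lambda>i. D i y) [0..<n])"
  shows "lie_derivative_form A Y \<Omega> Ys x
    = ((\<Sum>i<n. D i x (\<lambda>y. Y y (X i))) + Y x (\<lambda>y. ln \<bar>w y\<bar>)) * \<Omega> x (map (\<lambda>Z. Z x) Ys)"
proof -
  have YT: "Y x \<in> tangent_space A x" by (rule vector_fieldD(1)[OF Y V(1,4)])
  have Zf: "vector_field A V (Ys ! i)" if "i < n" for i using Ys that by auto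
  have cy: "coordinates V0 X D" "y \<in> V0" if "y \<in> V" for y using c V(3) that by auto
  define B where "B y i j = (Ys ! i) y (X j)" for y i j
  have sB: "smooth_germ x (\<lambda>y. B y i j)" if "i < n" "j < n" for i j
    unfolding B_def using vector_fieldD(2)[OF Zf V(1,4)] that coordinatesD(2)[OF c] by auto
  have sYX: "smooth_germ x (\<lambda>y. Y y (X j))" if "j < n" for j
    using vector_fieldD(2)[OF Y V(1,4)] that coordinatesD(2)[OF c] by auto
  have sw: "smooth_germ x w"
  proof -
    have "smooth_germ x (\<lambda>y. \<Omega> y (map (\<lambda>Y. Y y) (map D [0..<n])))"
      using vector_field_subset[OF coordinatesD(3)[OF c(1)] V(3)]
      by (intro smooth_germ_vol[OF vol(1) V(1,2,4)]) auto
    then show ?thesis by (simp add: w_def o_def)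
  qed
  have w0: "w x \<noteq> 0" using vol_frame_nonzero[OF vol c] by (simp add: w_def)
  have map_Ys: "map (\<lambda>Z. Z y) Ys = map (\<lambda>i. (Ys ! i) y) [0..<n]" for y
    using Ys(1) by (intro nth_equalityI) auto
  have Om: "\<Omega> y (map (\<lambda>Z. Z y) Ys) = ndet n (B y) * w y" if y: "y \<in> V" for y
    unfolding map_Ys w_def B_def using y V(2)
    by (intro vol_at_expand[OF vol(1)] coordinatesD(4)[OF cy[OF y]]
        tangent_expand[OF cy[OF y]] vector_fieldD(1)[OF Zf V(1) y]) auto
  define K where "K l j = D l x (\<lambda>y. Y y (X j))" for l j
  define vB where "vB i j = Y x (\<lambda>y. B y i j)" for i j
  have "Y x (\<lambda>y. \<Omega> y (map (\<lambda>Z. Z y) Ys)) = Y x (\<lambda>y. ndet n (B y) * w y)"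
    by (rule tangent_cong[OF YT, symmetric])
      (use eventually_nhds_in_open[OF V(1,4)] Om in
        \<open>auto intro!: smooth_germ_mult smooth_germ_ndet sB sw elim: eventually_mono\<close>)
  also have "\<dots> = Y x (\<lambda>y. ndet n (B y)) * w x + ndet n (B x) * Y x w"
    by (intro tangent_mult[OF YT] smooth_germ_ndet sB sw)
  finally have T1: "Y x (\<lambda>y. \<Omega> y (map (\<lambda>Z. Z y) Ys))
      = (\<Sum>i<n. ndet n ((B x)(i := vB i))) * w x + ndet n (B x) * Y x w"
    using tangent_ndet[OF YT sB] by (simp add: vB_def[abs_def])
  \<comment> \<open>The bracket has components \<open>vB i j\<close> minus an entry of the matrix
    product of \<open>B x\<close> and \<open>K\<close>. The first part cancels the derivative of the
    determinant in \<open>T1\<close>, the second adds up to the trace of \<open>K\<close>.\<close>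
  have T2: "\<Omega> x ((map (\<lambda>Z. Z x) Ys)[i := lie_bracket A Y (Ys ! i) x])
      = (ndet n ((B x)(i := vB i)) - ndet n ((B x)(i := (\<lambda>j. \<Sum>l<n. B x i l * K l j)))) * w x"
    if i: "i < n" for i
  proof -
    let ?b = "lie_bracket A Y (Ys ! i) x"
    have bT: "?b \<in> tangent_space A x"
      by (rule lie_bracket_in_tangent_space[OF Y Zf[OF i] V(1,4)])
    have bX: "?b (X j) = vB i j - (\<Sum>l<n. B x i l * K l j)" if j: "j < n" for j
      using tangent_coordinates[OF vector_fieldD(1)[OF Zf[OF i] V(1,4)] c sYX[OF j]] coordinatesD(2)[OF c j]
      by (simp add: lie_bracket_def vB_def B_def K_def)
    have "(map (\<lambda>Z. Z x) Ys)[i := ?b] = map ((\<lambda>i. (Ys ! i) x)(i := ?b)) [0..<n]"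
      unfolding map_Ys by (rule map_list_update[OF vol i])
    also have "\<Omega> x \<dots> = ndet n ((B x)(i := (\<lambda>j. ?b (X j)))) * w x"
      unfolding w_def
    proof (rule vol_at_expand[OF vol coordinatesD(4)[OF c]])
      fix a assume a: "a < n"
      show "((\<lambda>i. (Ys ! i) x)(i := ?b)) a = (\<lambda>f. \<Sum>j<n. ((B x)(i := (\<lambda>j. ?b (X j)))) a j * D j x f)"
        using tangent_expand[OF c bT] tangent_expand[OF c vector_fieldD(1)[OF Zf[OF a] V(1,4)]]
        by (simp add: B_def)
    qed
    also have "ndet n ((B x)(i := (\<lambda>j. ?b (X j))))
        = ndet n ((B x)(i := vB i)) - ndet n ((B x)(i := (\<lambda>j. \<Sum>l<n. B x i l * K l j)))"
      using i by (simp add: ndet_replace_row bX left_diff_distrib sum_subtractf)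
    finally show ?thesis .
  qed
  have "lie_derivative_form A Y \<Omega> Ys x = (\<Sum>i<n. ndet n ((B x)(i := vB i))) * w x + ndet n (B x) * Y x w
      - (\<Sum>i<n. (ndet n ((B x)(i := vB i)) - ndet n ((B x)(i := (\<lambda>j. \<Sum>l<n. B x i l * K l j)))) * w x)"
    unfolding lie_derivative_form_def T1 Ys(1) by (simp add: T2)
  also have "\<dots> = ndet n (B x) * Y x w
      + (\<Sum>i<n. ndet n ((B x)(i := (\<lambda>j. \<Sum>l<n. B x i l * K l j)))) * w x"
    by (simp add: left_diff_distrib sum_subtractf sum_distrib_right)
  also have "\<dots> = (Y x w / w x + (\<Sum>l<n. K l l)) * (ndet n (B x) * w x)"
    unfolding sum_ndet_replace_row_mult using w0 by (simp add: field_simps)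
  finally show ?thesis
    using tangent_ln_abs[OF YT sw w0] Om[OF V(4)] by (simp add: K_def add.commute)
qed

lemma divergence_coordinates:
  assumes vol: "volume_form A n W \<Omega>" "x \<in> W" "open W" and c: "coordinates V0 X D" "x \<in> V0"
    and V: "open V" "x \<in> V" and Y: "vector_field A V Y"
  shows "divergence A n \<Omega> Y x
    = (\<Sum>i<n. D i x (\<lambda>y. Y y (X i))) + Y x (\<lambda>y. ln \<bar>\<Omega> y (map (\<lambda>i. D i y) [0..<n])\<bar>)"
  (is "_ = ?r")
  unfolding divergence_def
proof (rule the_equality)
  note oV0 = coordinatesD(1)[OF c(1)]
  show "\<forall>U Ys. open U \<and> x \<in> U \<and> length Ys = n \<and> (\<forall>Z\<in>set Ys. vector_field A U Z) \<longrightarrow>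
      lie_derivative_form A Y \<Omega> Ys x = ?r * \<Omega> x (map (\<lambda>Z. Z x) Ys)"
  proof (intro allI impI, elim conjE)
    fix U Ys assume U: "open U" "x \<in> U" and Ys: "length Ys = n" "\<forall>Z\<in>set Ys. vector_field A U Z"
    let ?U = "U \<inter> V \<inter> W \<inter> V0"
    have "open ?U" using U V vol(3) oV0 by auto
    then show "lie_derivative_form A Y \<Omega> Ys x = ?r * \<Omega> x (map (\<lambda>Z. Z x) Ys)"
    proof (rule lie_derivative_coordinates[OF vol(1,2) c])
      show "vector_field A ?U Y" by (rule vector_field_subset[OF Y]) auto
      show "vector_field A ?U Z" if "Z \<in> set Ys" for Z
        by (rule vector_field_subset[OF bspec[OF Ys(2) that]]) auto
    qed (use U V vol(2) c(2) Ys in auto)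
  qed
  fix r assume r: "\<forall>U Ys. open U \<and> x \<in> U \<and> length Ys = n \<and> (\<forall>Z\<in>set Ys. vector_field A U Z) \<longrightarrow>
      lie_derivative_form A Y \<Omega> Ys x = r * \<Omega> x (map (\<lambda>Z. Z x) Ys)"
  \<comment> \<open>The coordinate frame is an admissible family of test fields on which the form
    does not vanish, so it determines \<open>r\<close>.\<close>
  let ?Ys = "map D [0..<n]" and ?U = "V0 \<inter> V \<inter> W"
  have Ys: "vector_field A V0 Z" if "Z \<in> set ?Ys" for Z using that coordinatesD(3)[OF c(1)] by auto
  have "lie_derivative_form A Y \<Omega> ?Ys x = r * \<Omega> x (map (\<lambda>Z. Z x) ?Ys)"
    by (rule r[rule_format, of V0 ?Ys]) (intro conjI oV0 c(2) ballI Ys; simp)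
  moreover have "lie_derivative_form A Y \<Omega> ?Ys x = ?r * \<Omega> x (map (\<lambda>Z. Z x) ?Ys)"
  proof (rule lie_derivative_coordinates[OF vol(1,2) c])
    show "vector_field A ?U Y" by (rule vector_field_subset[OF Y]) auto
    show "vector_field A ?U Z" if "Z \<in> set ?Ys" for Z
      by (rule vector_field_subset[OF Ys[OF that]]) auto
  qed (use oV0 V vol(2,3) c(2) in auto)
  moreover have "\<Omega> x (map (\<lambda>Z. Z x) ?Ys) \<noteq> 0"
    using vol_frame_nonzero[OF vol(1,2) c] by (simp add: o_def)
  ultimately show "r = ?r" by simp
qed

section \<open>Bump functions and smooth maps\<close>

text \<open>The set where \<open>h\<close> may be nonzero lies in the preimage of a closed ball of
  the model subspace. This preimage is compact, hence closed in the Hausdorff space, and so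
  extension by zero is smooth.\<close>

lemma bump_exists:
  assumes "open V" "x \<in> V"
  obtains h where "\<And>y. smooth_germ y h" "\<And>y. 0 \<le> h y" "\<And>y. h y \<le> 1" "h x = 1"
    "\<And>y. y \<notin> V \<Longrightarrow> h y = 0"
proof -
  obtain U \<phi> where U: "(U, \<phi>) \<in> max_atlas" "x \<in> U" by (rule max_atlas_covers)
  obtain E where E: "subspace E" "openin (top_of_set E) (\<phi> ` U)"
    using is_chart_chart[OF U(1)] by (auto simp: is_chart_def)
  obtain Q where Q: "open Q" "\<phi> ` (U \<inter> V) = \<phi> ` U \<inter> Q"
    using chart_image_openin[OF U(1) assms(1)] by metis
  obtain Q' where Q': "open Q'" "\<phi> ` U = E \<inter> Q'" using E(2) by (auto simp: openin_open)
  have "\<phi> x \<in> Q \<inter> Q'" "open (Q \<inter> Q')" using Q Q' U(2) assms(2) by blast+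
  then obtain r where r: "r > 0" "cball (\<phi> x) r \<subseteq> Q \<inter> Q'" using open_contains_cball by blast
  let ?B = "E \<inter> cball (\<phi> x) r"
  have BUV: "?B \<subseteq> \<phi> ` (U \<inter> V)" using r(2) Q(2) Q'(2) by blast
  have "compact ?B" using closed_Int_compact[OF closed_subspace[OF E(1)] compact_cball] .
  moreover have "continuous_on ?B (inv_into U \<phi>)"
    using chart_homeomorphism[OF U(1)] BUV
    by (auto simp: homeomorphism_def intro: continuous_on_subset)
  ultimately have K: "closed (inv_into U \<phi> ` ?B)"
    by (intro compact_imp_closed compact_continuous_image)
  let ?K = "inv_into U \<phi> ` ?B"
  have KUV: "?K \<subseteq> U \<inter> V" using BUV chart_inv[OF U(1)] by force
  \<comment> \<open>The squared distance is used because it is smooth at the centre, hence the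
    threshold \<open>r\<^sup>2\<close>.\<close>
  obtain \<theta> :: "real \<Rightarrow> real" where \<theta>: "\<And>k. C_k_on k UNIV \<theta>" "\<And>t. 0 \<le> \<theta> t" "\<And>t. \<theta> t \<le> 1"
    "\<And>t. t \<le> 0 \<Longrightarrow> \<theta> t = 0" "\<And>t. r\<^sup>2 \<le> t \<Longrightarrow> \<theta> t = 1"
    using smooth_step_exists[of 0 "r\<^sup>2"] r(1) by auto
  define h where "h y = (if y \<in> U \<inter> V then 1 - \<theta> ((\<phi> y - \<phi> x) \<bullet> (\<phi> y - \<phi> x)) else 0)" for y
  have h0: "h y = 0" if "y \<notin> ?K" for y
  proof (cases "y \<in> U \<inter> V")
    case True
    have "\<phi> y \<notin> cball (\<phi> x) r"
    proof
      assume "\<phi> y \<in> cball (\<phi> x) r"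
      moreover have "\<phi> y \<in> E" using True Q'(2) by blast
      ultimately have "inv_into U \<phi> (\<phi> y) \<in> ?K" by blast
      then show False using that True chart_inv[OF U(1)] by simp
    qed
    then have "r < norm (\<phi> y - \<phi> x)" by (simp add: dist_norm norm_minus_commute)
    then have "r\<^sup>2 \<le> (\<phi> y - \<phi> x) \<bullet> (\<phi> y - \<phi> x)"
      using r(1) by (simp add: power2_norm_eq_inner[symmetric] power_mono)
    then show ?thesis by (simp add: h_def \<theta>(5))
  qed (auto simp: h_def)
  have "smooth_germ y h" for y
  proof (cases "y \<in> U \<inter> V")
    case True
    have "smooth_germ y (\<lambda>y. \<Sum>b\<in>Basis. (\<phi> y \<bullet> b - \<phi> x \<bullet> b) * (\<phi> y \<bullet> b - \<phi> x \<bullet> b))"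
      using True by (intro smooth_germ_sum smooth_germ_mult smooth_germ_diff smooth_germ_const
          smooth_germ_chart[OF U(1)]) auto
    also have "(\<lambda>y. \<Sum>b\<in>Basis. (\<phi> y \<bullet> b - \<phi> x \<bullet> b) * (\<phi> y \<bullet> b - \<phi> x \<bullet> b))
        = (\<lambda>y. (\<phi> y - \<phi> x) \<bullet> (\<phi> y - \<phi> x))"
      by (rule ext) (subst euclidean_inner, simp add: inner_diff_left)
    finally have "smooth_germ y (\<lambda>y. \<theta> ((\<phi> y - \<phi> x) \<bullet> (\<phi> y - \<phi> x)))"
      by (rule smooth_germ_compose_real[OF _ open_UNIV UNIV_I \<theta>(1)])
    then have "smooth_germ y (\<lambda>y. 1 - \<theta> ((\<phi> y - \<phi> x) \<bullet> (\<phi> y - \<phi> x)))"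
      by (intro smooth_germ_diff smooth_germ_const)
    then show ?thesis
    proof (rule smooth_germ_transform)
      show "\<forall>\<^sub>F z in nhds y. 1 - \<theta> ((\<phi> z - \<phi> x) \<bullet> (\<phi> z - \<phi> x)) = h z"
        using eventually_nhds_in_open[OF open_Int[OF chart_open[OF U(1)] assms(1)] True]
        by (rule eventually_mono) (simp add: h_def)
    qed
  next
    case False
    then have "y \<in> - ?K" using KUV by auto
    then have "\<forall>\<^sub>F z in nhds y. z \<in> - ?K" using K by (intro eventually_nhds_in_open open_Compl)
    then have "\<forall>\<^sub>F z in nhds y. 0 = h z" by (rule eventually_mono) (simp add: h0)
    then show ?thesis by (rule smooth_germ_transform[OF smooth_germ_const])
  qed
  moreover have "0 \<le> h y" "h y \<le> 1" for y using \<theta>(2,3) by (auto simp: h_def)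
  moreover have "h x = 1" using U(2) assms(2) \<theta>(4) by (simp add: h_def)
  moreover have "h y = 0" if "y \<notin> V" for y using that by (simp add: h_def)
  ultimately show ?thesis by (rule that)
qed

text \<open>Maps are tested by pulling back function germs, which fits tangent vectors as
  derivations; \<open>smooth_self_map_if_germs\<close> recovers the definition by charts.\<close>

definition smooth_map_germ :: "'a \<Rightarrow> ('a \<Rightarrow> 'a) \<Rightarrow> bool" where
  "smooth_map_germ x p \<longleftrightarrow> isCont p x \<and> (\<forall>g. smooth_germ (p x) g \<longrightarrow> smooth_germ x (\<lambda>y. g (p y)))"

lemma smooth_map_germ_pullback:
  "smooth_map_germ x p \<Longrightarrow> smooth_germ (p x) g \<Longrightarrow> smooth_germ x (\<lambda>y. g (p y))"
  by (simp add: smooth_map_germ_def)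

lemma smooth_map_germ_transform:
  assumes p: "smooth_map_germ x p" and eq: "\<forall>\<^sub>F y in nhds x. p y = q y"
  shows "smooth_map_germ x q"
proof -
  have "p x = q x" using eq by (rule eventually_nhds_x_imp_x)
  moreover have "isCont q x" using p isCont_cong[OF eq] by (simp add: smooth_map_germ_def)
  moreover have "smooth_germ x (\<lambda>y. g (q y))" if "smooth_germ x (\<lambda>y. g (p y))" for g
    by (rule smooth_germ_transform[OF that]) (use eq in \<open>auto elim: eventually_mono\<close>)
  ultimately show ?thesis using p by (simp add: smooth_map_germ_def)
qed

lemma smooth_map_germ_const: "smooth_map_germ x (\<lambda>_. s)"
  by (simp add: smooth_map_germ_def)

lemma smooth_map_germ_chart_inv:
  assumes U: "(U, \<phi>) \<in> max_atlas" and w: "\<And>b. b \<in> Basis \<Longrightarrow> smooth_germ x (\<lambda>y. w y \<bullet> b)"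
    and wU: "\<forall>\<^sub>F y in nhds x. w y \<in> \<phi> ` U"
  shows "smooth_map_germ x (\<lambda>y. inv_into U \<phi> (w y))"
proof -
  have wx: "w x \<in> \<phi> ` U" using wU by (rule eventually_nhds_x_imp_x)
  then have ix: "inv_into U \<phi> (w x) \<in> U" "\<phi> (inv_into U \<phi> (w x)) = w x"
    by (auto simp: chart_inv[OF U])
  have "smooth_germ x (\<lambda>y. g (inv_into U \<phi> (w y)))" if "smooth_germ (inv_into U \<phi> (w x)) g" for g
    by (rule smooth_germ_compose[OF w wU]) (use that smooth_near_iff_chart[OF U ix(1)] ix(2) in auto)
  moreover have "isCont (\<lambda>y. inv_into U \<phi> (w y)) x"
    unfolding continuous_at_open
  proof (intro allI impI, elim conjE)
    fix V assume V: "open V" "inv_into U \<phi> (w x) \<in> V"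
    obtain Q where Q: "open Q" "\<phi> ` (U \<inter> V) = \<phi> ` U \<inter> Q"
      using chart_image_openin[OF U V(1)] by metis
    have "isCont (\<lambda>y. \<Sum>b\<in>Basis. (w y \<bullet> b) *\<^sub>R b) x"
      by (intro continuous_sum continuous_scaleR continuous_const smooth_germ_isCont w)
    then have cw: "isCont w x" by (simp add: euclidean_representation)
    have "\<phi> (inv_into U \<phi> (w x)) \<in> \<phi> ` (U \<inter> V)" using ix(1) V(2) by blast
    then have "w x \<in> Q" using ix(2) Q(2) by simp
    then have "\<forall>\<^sub>F y in nhds x. w y \<in> Q"
      using cw Q(1) by (auto simp: isCont_def tendsto_at_iff_tendsto_nhds intro: topological_tendstoD)
    with wU have "\<forall>\<^sub>F y in nhds x. inv_into U \<phi> (w y) \<in> V"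
    proof eventually_elim
      case (elim y)
      then have "w y \<in> \<phi> ` (U \<inter> V)" using Q(2) by auto
      then show ?case using chart_inv[OF U] by auto
    qed
    then show "\<exists>T. open T \<and> x \<in> T \<and> (\<forall>y\<in>T. inv_into U \<phi> (w y) \<in> V)"
      by (simp add: eventually_nhds)
  qed
  ultimately show ?thesis by (simp add: smooth_map_germ_def)
qed

section \<open>Retractions onto embedded submanifolds\<close>

definition retraction_germ :: "'a set \<Rightarrow> 'a set \<Rightarrow> ('a \<Rightarrow> 'a) \<Rightarrow> bool" where
  "retraction_germ S N p \<longleftrightarrow> open N \<and> (\<forall>x\<in>N. smooth_map_germ x p \<and> p x \<in> S) \<and> (\<forall>x\<in>N \<inter> S. p x = x)"

text \<open>An open set \<open>V\<close> on which points \<open>q\<close> of \<open>S\<close> can be moved smoothly, with \<open>t\<close> from \<open>0\<close> to \<open>1\<close>,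
  to the image of \<open>y\<close> under a retraction; in an adapted chart \<open>G\<close> is a convex combination.\<close>

definition retraction_patch :: "'a set \<Rightarrow> 'a set \<Rightarrow> (real \<Rightarrow> 'a \<Rightarrow> 'a \<Rightarrow> 'a) \<Rightarrow> bool" where
  "retraction_patch S V G \<longleftrightarrow> open V \<and>
     (\<forall>t q y. 0 \<le> t \<and> t \<le> 1 \<and> q \<in> V \<inter> S \<and> y \<in> V \<longrightarrow> G t q y \<in> S \<and> G 0 q y = q) \<and>
     (\<forall>t s. s \<in> V \<inter> S \<longrightarrow> G t s s = s) \<and>
     (\<forall>q q' y. G 1 q y = G 1 q' y) \<and>
     (\<forall>x l q. x \<in> V \<and> smooth_germ x l \<and> (\<forall>y. 0 \<le> l y \<and> l y \<le> 1) \<and> smooth_map_germ x q \<and>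
        (\<forall>\<^sub>F y in nhds x. q y \<in> V \<inter> S) \<longrightarrow> smooth_map_germ x (\<lambda>y. G (l y) (q y) y))"

lemma retraction_patch_exists:
  assumes "embedded_submanifold n k A S" "s \<in> S"
  obtains V G where "retraction_patch S V G" "s \<in> V"
proof -
  obtain c where c: "c \<in> max_atlas" "case c of (U, \<phi>) \<Rightarrow> s \<in> U \<and>
      (\<exists>E L. subspace E \<and> dim E = n \<and> openin (top_of_set E) (\<phi> ` U) \<and>
        subspace L \<and> L \<subseteq> E \<and> dim L = k \<and> \<phi> ` (U \<inter> S) = \<phi> ` U \<inter> L)"
    using bspec[OF assms(1)[unfolded embedded_submanifold_def] assms(2)] by (rule bexE)
  obtain U \<phi> where c': "c = (U, \<phi>)" by (rule prod.exhaust)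
  from c obtain E L where U: "(U, \<phi>) \<in> max_atlas" "s \<in> U"
    and E: "subspace E" "dim E = n" "openin (top_of_set E) (\<phi> ` U)"
    and L: "subspace L" "L \<subseteq> E" "dim L = k" and S: "\<phi> ` (U \<inter> S) = \<phi> ` U \<inter> L"
    unfolding c' prod.case by (elim conjE exE)
  show ?thesis
  proof (rule adapted_orthonormal_basis[OF E(1,2) L])
    fix b :: "nat \<Rightarrow> 'e" assume b: "k \<le> n" "\<And>i. i < k \<Longrightarrow> b i \<in> L"
      "\<And>z. z \<in> E \<Longrightarrow> (\<Sum>i<n. (z \<bullet> b i) *\<^sub>R b i) = z"
      "\<And>z. z \<in> E \<Longrightarrow> z \<in> L \<longleftrightarrow> (\<forall>i. k \<le> i \<and> i < n \<longrightarrow> z \<bullet> b i = 0)"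
    define \<pi> where "\<pi> z = (\<Sum>i<k. (z \<bullet> b i) *\<^sub>R b i)" for z
    have \<pi>L: "\<pi> z \<in> L" for z
      unfolding \<pi>_def by (intro subspace_sum L(1) subspace_scale b(2)) auto
    have \<pi>_id: "\<pi> z = z" if "z \<in> L" for z
    proof -
      have z: "z \<in> E" using that L(2) by blast
      have "(\<Sum>i<n. (z \<bullet> b i) *\<^sub>R b i) = \<pi> z"
        unfolding \<pi>_def using b(1) b(4)[OF z] that
        by (intro sum.mono_neutral_right) auto
      then show ?thesis using b(3)[OF z] by simp
    qed
    have \<phi>L: "\<phi> y \<in> L" if "y \<in> U" "y \<in> S" for y using that S by blast
    obtain Q where Q: "open Q" "\<phi> ` U = E \<inter> Q" using E(3) by (auto simp: openin_open)
    have "\<phi> s \<in> Q" using Q(2) U(2) by blast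
    then obtain r where r: "r > 0" "ball (\<phi> s) r \<subseteq> Q" using Q(1) openE by blast
    define B where "B = ball (\<phi> s) r"
    \<comment> \<open>For points of \<open>V\<close> both the chart image and its projection to
      \<open>L\<close> lie in \<open>B\<close>. As balls are convex, the segment from
      \<open>\<phi> q\<close> to \<open>\<pi> (\<phi> y)\<close> does not leave the image of the
      chart.\<close>
    define V where "V = U \<inter> \<phi> -` (B \<inter> \<pi> -` B)"
    have "open (B \<inter> \<pi> -` B)"
      unfolding B_def \<pi>_def by (intro open_Int open_ball open_vimage continuous_intros)
    then have V: "open V" unfolding V_def by (rule chart_preimage_open[OF U(1)])
    have sV: "s \<in> V" using U(2) r(1) \<pi>_id[OF \<phi>L[OF U(2) assms(2)]] by (simp add: V_def B_def)
    define z where "z t q y = (1 - t) *\<^sub>R \<phi> q + t *\<^sub>R \<pi> (\<phi> y)" for t q y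
    define G where "G t q y = inv_into U \<phi> (z t q y)" for t q y
    have z_in: "z t q y \<in> \<phi> ` (U \<inter> S)" if "0 \<le> t" "t \<le> 1" "q \<in> V" "q \<in> S" "y \<in> V" for t q y
    proof -
      have "z t q y \<in> L"
        unfolding z_def using that(3,4) by (intro subspace_add subspace_scale L(1) \<pi>L \<phi>L) (auto simp: V_def)
      moreover have "z t q y \<in> B"
        unfolding z_def B_def using that by (intro convexD_alt convex_ball) (auto simp: V_def B_def)
      ultimately show ?thesis using S Q(2) r(2) L(2) unfolding B_def by blast
    qed
    have "retraction_patch S V G"
      unfolding retraction_patch_def
    proof (intro conjI allI impI; (elim conjE)?)
      show "G t q y \<in> S" if "0 \<le> t" "t \<le> 1" "q \<in> V \<inter> S" "y \<in> V" for t q y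
        using z_in[of t q y] that by (auto simp: G_def chart_inv[OF U(1)])
      show "G 0 q y = q" if "q \<in> V \<inter> S" for q y
        using that by (simp add: G_def z_def V_def chart_inv[OF U(1)])
      show "G t q q = q" if q: "q \<in> V \<inter> S" for t q
      proof -
        have "z t q q = \<phi> q"
          using q by (simp add: z_def V_def \<pi>_id[OF \<phi>L] algebra_simps)
        then show ?thesis using q by (simp add: G_def V_def chart_inv[OF U(1)])
      qed
      show "G 1 q y = G 1 q' y" for q q' y by (simp add: G_def z_def)
      fix x l q assume x: "x \<in> V" and l: "smooth_germ x l" "\<forall>y. 0 \<le> l y \<and> l y \<le> 1"
        and q: "smooth_map_germ x q" "\<forall>\<^sub>F y in nhds x. q y \<in> V \<inter> S"
      show "smooth_map_germ x (\<lambda>y. G (l y) (q y) y)"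
        unfolding G_def
      proof (rule smooth_map_germ_chart_inv[OF U(1)])
        have "q x \<in> U" using eventually_nhds_x_imp_x[OF q(2)] by (simp add: V_def)
        then have q\<phi>: "smooth_germ x (\<lambda>y. \<phi> (q y) \<bullet> b)" for b
          by (rule smooth_map_germ_pullback[OF q(1) smooth_germ_chart[OF U(1)]])
        show "smooth_germ x (\<lambda>y. z (l y) (q y) y \<bullet> b)" for b
          unfolding z_def \<pi>_def inner_add_left inner_scaleR_left inner_sum_left
          using x by (intro smooth_germ_add smooth_germ_mult smooth_germ_diff smooth_germ_const l(1) q\<phi>
              smooth_germ_sum smooth_germ_chart[OF U(1)]) (auto simp: V_def)
        show "\<forall>\<^sub>F y in nhds x. z (l y) (q y) y \<in> \<phi> ` U"
          using q(2) eventually_nhds_in_open[OF V x]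
        proof eventually_elim
          case (elim y)
          then have "z (l y) (q y) y \<in> \<phi> ` (U \<inter> S)" using l(2) by (intro z_in) auto
          then show ?case by blast
        qed
      qed
    qed (rule V)
    then show thesis using sV by (rule that)
  qed
qed

text \<open>Off \<open>C\<close> nothing changes, on \<open>V\<close> the retraction of the patch
  takes over, and in between \<open>G\<close> interpolates with parameter \<open>l y\<close> as long
  as both \<open>y\<close> and \<open>p y\<close> lie in \<open>Q\<close>. Other points of
  \<open>C\<close> are given up, but no point of \<open>S\<close> in \<open>N\<close> is lost,
  because \<open>p\<close> fixes it.\<close>

lemma retraction_merge:
  assumes p: "retraction_germ S N p" and G: "retraction_patch S Q G" and s: "s \<in> Q \<inter> S"
    and C: "closed C" "C \<subseteq> Q" and V: "open V"
    and l: "\<And>y. smooth_germ y l" "\<And>y. 0 \<le> l y" "\<And>y. l y \<le> 1" "\<And>y. y \<notin> C \<Longrightarrow> l y = 0"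
      "\<And>y. y \<in> V \<Longrightarrow> l y = 1"
  obtains N' p' where "retraction_germ S N' p'" "N \<inter> S \<subseteq> N'" "V \<inter> S \<subseteq> N'"
    "N' - C = N - C" "\<And>y. y \<notin> C \<Longrightarrow> p' y = p y"
proof -
  have VC: "V \<subseteq> C"
  proof
    fix y assume "y \<in> V"
    then show "y \<in> C" using l(4)[of y] l(5)[of y] by fastforce
  qed
  have N: "open N" "\<And>x. x \<in> N \<Longrightarrow> smooth_map_germ x p" "\<And>x. x \<in> N \<Longrightarrow> p x \<in> S"
    "\<And>x. x \<in> N \<Longrightarrow> x \<in> S \<Longrightarrow> p x = x"
    using p by (auto simp: retraction_germ_def)
  note G' = G[unfolded retraction_patch_def]
  note G1 = G'[THEN conjunct1] and G2 = G'[THEN conjunct2, THEN conjunct1, rule_format]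
    and G3 = G'[THEN conjunct2, THEN conjunct2, THEN conjunct1, rule_format]
    and G4 = G'[THEN conjunct2, THEN conjunct2, THEN conjunct2, THEN conjunct1, rule_format]
    and G5 = G'[THEN conjunct2, THEN conjunct2, THEN conjunct2, THEN conjunct2, rule_format]
  have Q1: "open Q" by (rule G1)
  have Q2: "G t q y \<in> S" if "0 \<le> t" "t \<le> 1" "q \<in> Q" "q \<in> S" "y \<in> Q" for t q y
    using G2[of t q y] that by simp
  have Q3: "G 0 q y = q" if "q \<in> Q" "q \<in> S" "y \<in> Q" for q y
    using G2[of 0 q y] that by simp
  have Q4: "G t s s = s" if "s \<in> Q" "s \<in> S" for t s using G3 that by simp
  have Q6: "smooth_map_germ x (\<lambda>y. G (l y) (q y) y)"
    if "x \<in> Q" "smooth_germ x l" "\<And>y. 0 \<le> l y \<and> l y \<le> 1" "smooth_map_germ x q"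
      "\<forall>\<^sub>F y in nhds x. q y \<in> Q \<inter> S" for x l q
    by (rule G5) (intro conjI allI that)
  note Q = Q1 Q2 Q3 Q4 G4 Q6
  define Z where "Z = N \<inter> Q \<inter> p -` Q"
  define N' where "N' = (N - C) \<union> V \<union> Z"
  \<comment> \<open>The point \<open>s\<close> is a placeholder: \<open>G 1\<close> does not depend
    on its argument \<open>q\<close>, and on \<open>V\<close> the point \<open>p y\<close> need not
    lie in the patch.\<close>
  define p' where "p' y = (if y \<notin> C then p y else if y \<in> V then G 1 s y else G (l y) (p y) y)" for y
  have "continuous_on N p"
    using N(1,2) by (simp add: continuous_on_eq_continuous_at smooth_map_germ_def)
  then have "open (N \<inter> p -` Q)" using N(1) Q(1) by (rule continuous_open_preimage)
  then have Z: "open Z"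
    using Q(1) unfolding Z_def by (metis Int_assoc Int_commute open_Int)
  have Zp: "p' y = G (l y) (p y) y" if y: "y \<in> Z" for y
    using y N(3)[of y] l(4)[of y] l(5)[of y] Q(3)[of "p y" y] Q(5)[of s y "p y"]
    by (auto simp: p'_def Z_def)
  have NC: "open (N - C)" using N(1) C(1) by (rule open_Diff)
  have "retraction_germ S N' p'"
    unfolding retraction_germ_def
  proof (intro conjI ballI)
    show "open N'" unfolding N'_def using NC V Z by auto
    fix x assume x: "x \<in> N'"
    then consider "x \<in> N - C" | "x \<in> V" | "x \<in> Z" by (auto simp: N'_def)
    then have "smooth_map_germ x p' \<and> p' x \<in> S \<and> (x \<in> S \<longrightarrow> p' x = x)"
    proof cases
      case 1
      have "\<forall>\<^sub>F y in nhds x. p y = p' y"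
        using eventually_nhds_in_open[OF NC 1] by (rule eventually_mono) (simp add: p'_def)
      then have "smooth_map_germ x p'"
        by (rule smooth_map_germ_transform[rotated]) (use N(2) 1 in blast)
      moreover have "p' x = p x" using 1 by (simp add: p'_def)
      ultimately show ?thesis using 1 N(3,4)[of x] by auto
    next
      case 2
      then have xQ: "x \<in> Q" using VC C(2) by blast
      have "smooth_map_germ x (\<lambda>y. G 1 s y)"
        using Q(6)[OF xQ smooth_germ_const _ smooth_map_germ_const, of 1 s] s by simp
      moreover have "\<forall>\<^sub>F y in nhds x. G 1 s y = p' y"
        using eventually_nhds_in_open[OF V 2] by (rule eventually_mono) (use VC in \<open>auto simp: p'_def\<close>)
      ultimately have "smooth_map_germ x p'" by (rule smooth_map_germ_transform)
      moreover have "p' x = G 1 s x" using 2 VC by (auto simp: p'_def)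
      ultimately show ?thesis using Q(2)[of 1 s x] Q(4)[of x 1] Q(5)[of s x x] s xQ by auto
    next
      case 3
      then have xZ: "x \<in> N" "x \<in> Q" "p x \<in> Q" by (auto simp: Z_def)
      have "\<forall>\<^sub>F y in nhds x. p y \<in> Q \<inter> S"
        using eventually_nhds_in_open[OF Z 3] by (rule eventually_mono) (use N(3) in \<open>auto simp: Z_def\<close>)
      then have "smooth_map_germ x (\<lambda>y. G (l y) (p y) y)"
        using Q(6)[OF xZ(2) l(1)] l(2,3) N(2)[OF xZ(1)] by blast
      moreover have "\<forall>\<^sub>F y in nhds x. G (l y) (p y) y = p' y"
        using eventually_nhds_in_open[OF Z 3] by (rule eventually_mono) (simp add: Zp)
      ultimately have "smooth_map_germ x p'" by (rule smooth_map_germ_transform)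
      then show ?thesis
        using Q(2)[OF l(2,3) xZ(3) N(3)[OF xZ(1)] xZ(2)] Q(4)[OF xZ(2)] N(4)[OF xZ(1)]
        by (auto simp: Zp[OF 3])
    qed
    then show "smooth_map_germ x p'" "p' x \<in> S" by auto
  next
    fix x assume "x \<in> N' \<inter> S"
    then consider "x \<in> N - C" "x \<in> S" | "x \<in> V" "x \<in> S" | "x \<in> Z" "x \<in> S" by (auto simp: N'_def)
    then show "p' x = x"
    proof cases
      case 1
      then show ?thesis using N(4) by (simp add: p'_def)
    next
      case 2
      then have "x \<in> C" "x \<in> Q" using VC C(2) by auto
      then show ?thesis using 2 Q(4)[of x 1] Q(5)[of s x x] by (simp add: p'_def)
    next
      case 3
      then show ?thesis using N(4)[of x] Q(4)[of x] by (simp add: Zp Z_def)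
    qed
  qed
  moreover have "N \<inter> S \<subseteq> N'"
  proof
    fix y assume "y \<in> N \<inter> S"
    then show "y \<in> N'" using N(4)[of y] C(2) by (auto simp: N'_def Z_def)
  qed
  moreover have "V \<inter> S \<subseteq> N'" by (auto simp: N'_def)
  moreover have "N' - C = N - C" using VC by (auto simp: N'_def Z_def)
  moreover have "p' y = p y" if "y \<notin> C" for y using that by (simp add: p'_def)
  ultimately show ?thesis by (rule that)
qed

text \<open>The retractions of a sequence of patches are merged one after the other; local finiteness
  makes the sequence of partial results locally stationary.\<close>

lemma retraction_glue:
  fixes C V Q :: "nat \<Rightarrow> 'a set" and G :: "nat \<Rightarrow> real \<Rightarrow> 'a \<Rightarrow> 'a \<Rightarrow> 'a"
    and l :: "nat \<Rightarrow> 'a \<Rightarrow> real" and s :: "nat \<Rightarrow> 'a"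
  assumes G: "\<And>i. retraction_patch S (Q i) (G i)" and s: "\<And>i. s i \<in> Q i \<inter> S"
    and C: "\<And>i. closed (C i)" "\<And>i. C i \<subseteq> Q i" and V: "\<And>i. open (V i)"
    and l: "\<And>i y. smooth_germ y (l i)" "\<And>i y. 0 \<le> l i y" "\<And>i y. l i y \<le> 1"
      "\<And>i y. y \<notin> C i \<Longrightarrow> l i y = 0" "\<And>i y. y \<in> V i \<Longrightarrow> l i y = 1"
    and S: "S \<subseteq> (\<Union>i. V i)"
    and fin: "\<And>x. x \<in> S \<Longrightarrow> \<exists>B m. open B \<and> x \<in> B \<and> (\<forall>i\<ge>m. B \<inter> C i = {})"
  obtains N p where "retraction_germ S N p" "S \<subseteq> N"
proof -
  let ?P = "\<lambda>(N, p). retraction_germ S N p"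
  let ?R = "\<lambda>i (N, p) (N', p'). N \<inter> S \<subseteq> N' \<and> V i \<inter> S \<subseteq> N' \<and> N' - C i = N - C i \<and>
    (\<forall>y. y \<notin> C i \<longrightarrow> p' y = p y)"
  have "\<exists>F. \<forall>i. ?P (F i) \<and> ?R i (F i) (F (Suc i))"
  proof (rule dependent_nat_choice)
    show "\<exists>X. ?P X" by (rule exI[of _ "({}, id)"]) (simp add: retraction_germ_def)
    fix X i assume X: "?P X"
    obtain N p where Np: "X = (N, p)" by (rule prod.exhaust)
    from X have p: "retraction_germ S N p" by (simp add: Np)
    show "\<exists>Y. ?P Y \<and> ?R i X Y"
    proof (rule retraction_merge[OF p G[of i] s C V l(1,2,3) l(4) l(5)])
      fix N' p' assume *: "retraction_germ S N' p'" "N \<inter> S \<subseteq> N'" "V i \<inter> S \<subseteq> N'" "N' - C i = N - C i"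
          "\<And>y. y \<notin> C i \<Longrightarrow> p' y = p y"
      have "?P (N', p') \<and> ?R i X (N', p')"
        unfolding Np prod.case by (intro conjI allI impI *)
      then show ?thesis by (rule exI)
    qed
  qed
  then obtain F where "\<forall>i. ?P (F i) \<and> ?R i (F i) (F (Suc i))" by (rule exE)
  note F = this[THEN spec, THEN conjunct1] this[THEN spec, THEN conjunct2]
  define N where "N i = fst (F i)" for i
  define p where "p i = snd (F i)" for i
  have r: "retraction_germ S (N i) (p i)" for i using F(1)[of i] by (simp add: N_def p_def case_prod_beta)
  have NS: "N i \<inter> S \<subseteq> N (Suc i)" "V i \<inter> S \<subseteq> N (Suc i)" "N (Suc i) - C i = N i - C i"
    "\<And>y. y \<notin> C i \<Longrightarrow> p (Suc i) y = p i y" for i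
    using F(2)[of i] by (simp_all add: N_def p_def case_prod_beta)
  have stat: "(y \<in> N j \<longleftrightarrow> y \<in> N m) \<and> p j y = p m y" if "m \<le> j" and y: "\<And>i. m \<le> i \<Longrightarrow> y \<notin> C i" for m j y
    using that(1)
  proof (induction j rule: dec_induct)
    case (step i)
    have "y \<in> N (Suc i) - C i \<longleftrightarrow> y \<in> N i - C i" using NS(3)[of i] by simp
    then show ?case using NS(4)[of y i] y[OF step(1)] step by auto
  qed simp
  \<comment> \<open>\<open>m y\<close> is a stage after which nothing changes at \<open>y\<close>.
    Around every point of \<open>B\<close> a whole neighborhood has such a stage in common, so the
    limit coincides there with one of the partial retractions.\<close>
  define B where "B = \<Union>{B. open B \<and> (\<exists>m. \<forall>i\<ge>m. B \<inter> C i = {})}"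
  define m where "m y = (SOME m. \<forall>i\<ge>m. y \<notin> C i)" for y
  define N' where "N' = {y \<in> B. y \<in> N (m y)}"
  define p' where "p' y = p (m y) y" for y
  have local: "\<exists>U j. open U \<and> x \<in> U \<and> (\<forall>y\<in>U. (y \<in> N' \<longleftrightarrow> y \<in> N j) \<and> p' y = p j y)" if x: "x \<in> B" for x
  proof -
    obtain U j where U: "open U" "\<And>i. i \<ge> j \<Longrightarrow> U \<inter> C i = {}" "x \<in> U"
      using x by (auto simp: B_def)
    have "(y \<in> N' \<longleftrightarrow> y \<in> N j) \<and> p' y = p j y" if y: "y \<in> U" for y
    proof -
      have yC: "y \<notin> C i" if "i \<ge> j" for i using U(2)[OF that] y by auto
      then have "\<exists>m. \<forall>i\<ge>m. y \<notin> C i" by auto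
      then have my: "\<forall>i\<ge>m y. y \<notin> C i" unfolding m_def by (rule someI_ex)
      have "y \<in> B" using U y by (auto simp: B_def)
      moreover have "(y \<in> N (max j (m y)) \<longleftrightarrow> y \<in> N j) \<and> p (max j (m y)) y = p j y"
        using yC by (intro stat) auto
      moreover have "(y \<in> N (max j (m y)) \<longleftrightarrow> y \<in> N (m y)) \<and> p (max j (m y)) y = p (m y) y"
        using my by (intro stat) auto
      ultimately show ?thesis by (simp add: N'_def p'_def)
    qed
    then show ?thesis using U(1,3) by blast
  qed
  have loc: "\<exists>U j. open U \<and> x \<in> U \<and> U \<subseteq> N' \<and> x \<in> N j \<and> (\<forall>y\<in>U. p' y = p j y)" if x: "x \<in> N'" for x
  proof -
    obtain U j where U: "open U" "x \<in> U" "\<And>y. y \<in> U \<Longrightarrow> (y \<in> N' \<longleftrightarrow> y \<in> N j) \<and> p' y = p j y"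
      using local[of x] x by (auto simp: N'_def)
    have "open (N j)" using r[of j] by (simp add: retraction_germ_def)
    then show ?thesis using U x by (intro exI[of _ "U \<inter> N j"] exI[of _ j]) auto
  qed
  have "retraction_germ S N' p'"
    unfolding retraction_germ_def
  proof (intro conjI ballI)
    show "open N'" unfolding open_subopen[of N'] using loc by meson
    fix x assume "x \<in> N'"
    from loc[OF this] obtain U j where U: "open U" "x \<in> U" "x \<in> N j" "\<And>y. y \<in> U \<Longrightarrow> p' y = p j y" by blast
    have "\<forall>\<^sub>F y in nhds x. p j y = p' y"
      using eventually_nhds_in_open[OF U(1,2)] by (rule eventually_mono) (simp add: U(4))
    then show "smooth_map_germ x p'" "p' x \<in> S"
      using r[of j] U smooth_map_germ_transform by (auto simp: retraction_germ_def)
  next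
    fix x assume x: "x \<in> N' \<inter> S"
    then obtain U j where "x \<in> U" "x \<in> N j" "\<And>y. y \<in> U \<Longrightarrow> p' y = p j y" using loc by blast
    then show "p' x = x" using r[of j] x by (auto simp: retraction_germ_def)
  qed
  moreover have "S \<subseteq> N'"
  proof
    fix x assume x: "x \<in> S"
    then have xB: "x \<in> B" using fin[OF x] by (auto simp: B_def)
    obtain i where "x \<in> V i" using S x by auto
    then have "x \<in> N (Suc i)" using NS(2)[of i] x by auto
    have xN: "x \<in> N j" if "Suc i \<le> j" for j
      using that by (induction j rule: dec_induct) (use \<open>x \<in> N (Suc i)\<close> NS(1) x in auto)
    obtain U j where U: "open U" "\<And>i. i \<ge> j \<Longrightarrow> U \<inter> C i = {}" "x \<in> U"
      using xB by (auto simp: B_def)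
    then have "\<exists>m. \<forall>i\<ge>m. x \<notin> C i" by blast
    then have "\<forall>i\<ge>m x. x \<notin> C i" unfolding m_def by (rule someI_ex)
    then have "x \<in> N (max (Suc i) (m x)) \<longleftrightarrow> x \<in> N (m x)"
      using stat[of "m x" "max (Suc i) (m x)" x] by auto
    then show "x \<in> N'" using xB xN[of "max (Suc i) (m x)"] by (simp add: N'_def)
  qed
  ultimately show ?thesis by (rule that)
qed

text \<open>By the Lindelof property countably many patches suffice. Their bump functions need not
  be locally finite, so each is damped where an earlier one is large; this yields the sequence that
  \<open>retraction_glue\<close> asks for.\<close>

theorem retraction_exists:
  assumes S: "embedded_submanifold n k A S"
  obtains N p where "retraction_germ S N p" "S \<subseteq> N"
proof (cases "S = {}")
  case True
  then show ?thesis using that[of "{}" id] by (simp add: retraction_germ_def)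
next
  case False
  have "\<forall>x\<in>S. \<exists>Q G h. retraction_patch S Q G \<and> x \<in> Q \<and> (\<forall>y. smooth_germ y h) \<and>
      (\<forall>y. 0 \<le> h y \<and> h y \<le> 1) \<and> h x = 1 \<and> (\<forall>y. y \<notin> Q \<longrightarrow> h y = 0)"
  proof
    fix x assume x: "x \<in> S"
    obtain Q G where Q: "retraction_patch S Q G" "x \<in> Q" by (rule retraction_patch_exists[OF S x])
    then have oQ: "open Q" by (simp add: retraction_patch_def)
    show "\<exists>Q G h. retraction_patch S Q G \<and> x \<in> Q \<and> (\<forall>y. smooth_germ y h) \<and>
      (\<forall>y. 0 \<le> h y \<and> h y \<le> 1) \<and> h x = 1 \<and> (\<forall>y. y \<notin> Q \<longrightarrow> h y = 0)"
    proof (rule bump_exists[OF oQ Q(2)])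
      fix h assume "\<And>y. smooth_germ y h" "\<And>y. 0 \<le> h y" "\<And>y. h y \<le> 1" "h x = 1" "\<And>y. y \<notin> Q \<Longrightarrow> h y = 0"
      with Q show ?thesis by (intro exI[of _ Q] exI[of _ G] exI[of _ h] conjI allI impI)
    qed
  qed
  from bchoice[OF this] obtain Q where "\<forall>x\<in>S. \<exists>G h. retraction_patch S (Q x) G \<and> x \<in> (Q x) \<and> (\<forall>y. smooth_germ y h) \<and>
      (\<forall>y. 0 \<le> h y \<and> h y \<le> 1) \<and> h x = 1 \<and> (\<forall>y. y \<notin> (Q x) \<longrightarrow> h y = 0)" by (rule exE)
  from bchoice[OF this] obtain G where "\<forall>x\<in>S. \<exists>h. retraction_patch S (Q x) (G x) \<and> x \<in> (Q x) \<and> (\<forall>y. smooth_germ y h) \<and>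
      (\<forall>y. 0 \<le> h y \<and> h y \<le> 1) \<and> h x = 1 \<and> (\<forall>y. y \<notin> (Q x) \<longrightarrow> h y = 0)" by (rule exE)
  from bchoice[OF this] obtain h where "\<forall>x\<in>S. retraction_patch S (Q x) (G x) \<and> x \<in> (Q x) \<and> (\<forall>y. smooth_germ y (h x)) \<and>
      (\<forall>y. 0 \<le> (h x) y \<and> (h x) y \<le> 1) \<and> (h x) x = 1 \<and> (\<forall>y. y \<notin> (Q x) \<longrightarrow> (h x) y = 0)" by (rule exE)
  then have Q: "\<And>x. x \<in> S \<Longrightarrow> retraction_patch S (Q x) (G x)" "\<And>x. x \<in> S \<Longrightarrow> x \<in> Q x"
    and h: "\<And>x y. x \<in> S \<Longrightarrow> smooth_germ y (h x)" "\<And>x y. x \<in> S \<Longrightarrow> 0 \<le> h x y \<and> h x y \<le> 1"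
      "\<And>x. x \<in> S \<Longrightarrow> h x x = (1::real)" "\<And>x y. x \<in> S \<Longrightarrow> y \<notin> Q x \<Longrightarrow> h x y = 0"
    by simp_all
  have cont: "continuous_on UNIV (h x)" if "x \<in> S" for x
    using smooth_germ_isCont[OF h(1)[OF that]] by (simp add: continuous_at_imp_continuous_on)
  define O' where "O' x = {y. 5/6 < h x y}" for x
  have O': "open (O' x)" "x \<in> O' x" if "x \<in> S" for x
    using h(3)[OF that] open_Collect_less[OF continuous_on_const cont[OF that], of "5/6"]
    by (simp_all add: O'_def)
  obtain T where T: "T \<subseteq> O' ` S" "countable T" "\<Union>T = \<Union>(O' ` S)"
    using Lindelof[of "O' ` S"] O'(1) by auto
  have "T \<noteq> {}" using T(3) O'(2) False by auto
  from T obtain S0 where S0: "countable S0" "S0 \<subseteq> S" "T = O' ` S0"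
    using countable_subset_image[of T O' S] by auto
  have "S0 \<noteq> {}" using S0 \<open>T \<noteq> {}\<close> by auto
  define s where "s = from_nat_into S0"
  have sS: "s i \<in> S" for i using from_nat_into[OF \<open>S0 \<noteq> {}\<close>] S0(2) by (auto simp: s_def)
  have cover: "\<exists>i. 5/6 < h (s i) x" if "x \<in> S" for x
  proof -
    have "x \<in> \<Union>T" using T(3) O'(2)[OF that] that by auto
    then obtain z where "z \<in> S0" "x \<in> O' z" using S0(3) by auto
    then show ?thesis using from_nat_into_surj[OF S0(1)] by (force simp: O'_def s_def)
  qed
  obtain \<theta> :: "real \<Rightarrow> real" where \<theta>: "\<And>k. C_k_on k UNIV \<theta>" "\<And>t. 0 \<le> \<theta> t" "\<And>t. \<theta> t \<le> 1"
    "\<And>t. t \<le> 1/2 \<Longrightarrow> \<theta> t = 0" "\<And>t. 2/3 \<le> t \<Longrightarrow> \<theta> t = 1"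
    using smooth_step_exists[of "1/2" "2/3"] by auto
  obtain \<psi> :: "real \<Rightarrow> real" where \<psi>: "\<And>k. C_k_on k UNIV \<psi>" "\<And>t. 0 \<le> \<psi> t" "\<And>t. \<psi> t \<le> 1"
    "\<And>t. t \<le> 3/4 \<Longrightarrow> \<psi> t = 0" "\<And>t. 5/6 \<le> t \<Longrightarrow> \<psi> t = 1"
    using smooth_step_exists[of "3/4" "5/6"] by auto
  \<comment> \<open>\<open>\<theta>\<close> rises between 1/2 and 2/3 and \<open>\<psi>\<close>
    between 3/4 and 5/6; the outer values enter \<open>C\<close>, the inner ones \<open>V\<close>.
    Since 2/3 < 3/4, the least index with \<open>h (s i) x\<close> above 2/3 has \<open>x\<close> in
    \<open>V i\<close>. Where \<open>h (s j)\<close> exceeds 5/6, all \<open>C i\<close> with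
    \<open>i > j\<close> are left, which gives local finiteness.\<close>
  define l where "l i y = \<theta> (h (s i) y) * (\<Prod>j<i. 1 - \<psi> (h (s j) y))" for i y
  define C where "C i = {y. 1/2 \<le> h (s i) y} \<inter> (\<Inter>j<i. {y. h (s j) y \<le> 5/6})" for i
  define V where "V i = {y. 2/3 < h (s i) y} \<inter> (\<Inter>j<i. {y. h (s j) y < 3/4})" for i
  show ?thesis
  proof (rule retraction_glue[where Q="\<lambda>i. Q (s i)" and G="\<lambda>i. G (s i)" and s=s and C=C and V=V and l=l])
    show "retraction_patch S (Q (s i)) (G (s i))" for i by (rule Q(1)[OF sS])
    show "s i \<in> Q (s i) \<inter> S" for i using Q(2) sS by auto
    show "closed (C i)" for i
      unfolding C_def by (intro closed_Int closed_INT ballI closed_Collect_le continuous_on_const cont sS)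
    show "open (V i)" for i
      unfolding V_def by (intro open_Int open_INT ballI open_Collect_less continuous_on_const cont sS) auto
    show "C i \<subseteq> Q (s i)" for i
    proof
      fix y assume "y \<in> C i"
      then show "y \<in> Q (s i)" using h(4)[OF sS, of y i] by (auto simp: C_def)
    qed
    show "smooth_germ y (l i)" for i y
      unfolding l_def[abs_def]
      by (intro smooth_germ_mult smooth_germ_prod smooth_germ_diff smooth_germ_const
          smooth_germ_compose_real[OF _ open_UNIV UNIV_I \<theta>(1)]
          smooth_germ_compose_real[OF _ open_UNIV UNIV_I \<psi>(1)] h(1) sS)
    show "0 \<le> l i y" for i y
      unfolding l_def using \<theta>(2) \<psi>(3) by (intro mult_nonneg_nonneg prod_nonneg) auto
    show "l i y \<le> 1" for i y
      unfolding l_def using \<theta>(2,3) \<psi>(2,3) by (intro mult_le_one prod_le_1 prod_nonneg) auto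
    show "l i y = 0" if y: "y \<notin> C i" for i y
    proof -
      consider "h (s i) y \<le> 1/2" | j where "j < i" "5/6 \<le> h (s j) y" using y by (force simp: C_def)
      then show ?thesis
      proof cases
        case 1
        then show ?thesis by (simp add: l_def \<theta>(4))
      next
        case 2
        then have "(\<Prod>j<i. 1 - \<psi> (h (s j) y)) = 0" by (intro prod_zero bexI[of _ j]) (auto simp: \<psi>(5))
        then show ?thesis by (simp add: l_def)
      qed
    qed
    show "l i y = 1" if "y \<in> V i" for i y
      using that by (auto simp: l_def V_def \<theta>(5) \<psi>(4) less_imp_le)
    show "S \<subseteq> (\<Union>i. V i)"
    proof
      fix x assume x: "x \<in> S"
      obtain i where "5/6 < h (s i) x" using cover[OF x] by blast
      then have ex: "\<exists>i. 2/3 < h (s i) x" by (intro exI[of _ i]) simp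
      define i where "i = (LEAST i. 2/3 < h (s i) x)"
      have "2/3 < h (s i) x" unfolding i_def using ex by (rule LeastI_ex)
      moreover have "\<not> 2/3 < h (s j) x" if "j < i" for j
        using that not_less_Least unfolding i_def by blast
      ultimately have "x \<in> V i" by (force simp: V_def)
      then show "x \<in> (\<Union>i. V i)" by blast
    qed
    show "\<exists>B m. open B \<and> x \<in> B \<and> (\<forall>i\<ge>m. B \<inter> C i = {})" if x: "x \<in> S" for x
    proof -
      obtain j where j: "5/6 < h (s j) x" using cover[OF x] by auto
      have dis: "O' (s j) \<inter> C i = {}" if i: "Suc j \<le> i" for i
      proof -
        have "y \<notin> C i" if "y \<in> O' (s j)" for y
          using that i by (auto simp: O'_def C_def not_le Suc_le_eq intro!: bexI[of _ j])
        then show ?thesis by blast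
      qed
      have "x \<in> O' (s j)" using j by (simp add: O'_def)
      with dis O'(1)[OF sS[of j]] show ?thesis by blast
    qed
  qed (rule that)
qed

end

section \<open>Pushforward of tangent vectors and tangent spaces of submanifolds\<close>

lemma isCont_eventually_nhds:
  assumes "isCont f x" "open S" "f x \<in> S"
  shows "\<forall>\<^sub>F y in nhds x. f y \<in> S"
  using topological_tendstoD[OF assms(1)[unfolded isCont_def] assms(2,3)] assms(3)
  by (simp add: eventually_nhds_conv_at)

context smooth_mfd
begin

lemma pushforward_apply: "smooth_germ (p x) g \<Longrightarrow> pushforward A p x v g = v (\<lambda>y. g (p y))"
  by (simp add: pushforward_def)

lemma pushforward_in_tangent_space:
  assumes p: "smooth_map_germ x p" and v: "v \<in> tangent_space A x"
  shows "pushforward A p x v \<in> tangent_space A (p x)"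
proof (rule tangent_spaceI)
  note pull = smooth_map_germ_pullback[OF p]
  have ev: "\<forall>\<^sub>F y in nhds x. P (p y)" if "\<forall>\<^sub>F z in nhds (p x). P z" for P
  proof -
    have "filterlim p (nhds (p x)) (nhds x)"
      using p by (simp add: smooth_map_germ_def isCont_def tendsto_at_iff_tendsto_nhds)
    then show ?thesis using that by (simp add: filterlim_iff)
  qed
  show "pushforward A p x v f = pushforward A p x v g"
    if f: "smooth_germ (p x) f" and eq: "\<forall>\<^sub>F y in nhds (p x). f y = g y" for f g
    using tangent_cong[OF v pull[OF f] ev[OF eq]] f smooth_germ_transform[OF f eq]
    by (simp add: pushforward_apply)
  show "pushforward A p x v (\<lambda>y. f y + g y) = pushforward A p x v f + pushforward A p x v g"
    if "smooth_germ (p x) f" "smooth_germ (p x) g" for f g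
    using that by (simp add: pushforward_apply smooth_germ_add tangent_add[OF v] pull)
  show "pushforward A p x v (\<lambda>y. r * f y) = r * pushforward A p x v f"
    if "smooth_germ (p x) f" for f r
    using that by (simp add: pushforward_apply smooth_germ_mult tangent_scale[OF v] pull)
  show "pushforward A p x v (\<lambda>y. f y * g y) = pushforward A p x v f * g (p x) + f (p x) * pushforward A p x v g"
    if "smooth_germ (p x) f" "smooth_germ (p x) g" for f g
    using that by (simp add: pushforward_apply smooth_germ_mult tangent_mult[OF v] pull)
qed (simp add: pushforward_def)

lemma smooth_self_map_if_germs:
  assumes N: "open N" and p: "\<And>x. x \<in> N \<Longrightarrow> smooth_map_germ x p"
  shows "smooth_self_map A N p"
  unfolding smooth_self_map_def
proof (intro conjI)
  show cont: "continuous_on N p"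
    using p N by (simp add: continuous_on_eq_continuous_at smooth_map_germ_def)
  show "\<forall>(U, \<phi>)\<in>A. \<forall>(V, \<psi>)\<in>A. smooth_on (\<phi> ` (U \<inter> N \<inter> p -` V)) (\<psi> \<circ> p \<circ> inv_into U \<phi>)"
  proof safe
    fix U \<phi> V \<psi> assume "(U, \<phi>) \<in> A" "(V, \<psi>) \<in> A"
    then have U: "(U, \<phi>) \<in> max_atlas" and V: "(V, \<psi>) \<in> max_atlas" using atlas_subset by auto
    show "smooth_on (\<phi> ` (U \<inter> N \<inter> p -` V)) (\<psi> \<circ> p \<circ> inv_into U \<phi>)"
      unfolding smooth_on_iff_smooth_at
    proof safe
      fix x assume x: "x \<in> U" "x \<in> N" "p x \<in> V"
      have "smooth_at (\<phi> ` U) (\<phi> x) (\<lambda>z. (\<psi> \<circ> p \<circ> inv_into U \<phi>) z \<bullet> b)" for b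
        using iffD1[OF smooth_near_iff_chart[OF U x(1)]
            smooth_map_germ_pullback[OF p[OF x(2)] smooth_germ_chart[OF V x(3), of b]]]
        by (simp only: o_def)
      then have "smooth_at (\<phi> ` U) (\<phi> x) (\<psi> \<circ> p \<circ> inv_into U \<phi>)"
        by (rule smooth_at_components)
      then show "smooth_at (\<phi> ` (U \<inter> N \<inter> p -` V)) (\<phi> x) (\<psi> \<circ> p \<circ> inv_into U \<phi>)"
        by (rule smooth_at_subset) auto
    qed
  qed
qed

lemma submanifold_tangentD:
  assumes "w \<in> submanifold_tangent A S x"
  shows "w \<in> tangent_space A x"
    and "\<And>f. smooth_germ x f \<Longrightarrow> \<forall>\<^sub>F y in nhds x. y \<in> S \<longrightarrow> f y = 0 \<Longrightarrow> w f = 0"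
  using assms by (simp_all add: submanifold_tangent_def)

lemma adapted_coordinatesD:
  assumes "adapted_coordinates k S V X D"
  shows "coordinates V X D" "k \<le> n"
    "\<And>y i. y \<in> V \<Longrightarrow> y \<in> S \<Longrightarrow> k \<le> i \<Longrightarrow> i < n \<Longrightarrow> X i y = 0"
    "\<And>y i. y \<in> V \<Longrightarrow> y \<in> S \<Longrightarrow> i < k \<Longrightarrow> D i y \<in> submanifold_tangent A S y"
  using assms by (auto simp: adapted_coordinates_def)

lemma submanifold_tangent_normal_coordinates:
  assumes c: "adapted_coordinates k S V X D" "x \<in> V" and w: "w \<in> submanifold_tangent A S x"
    and i: "k \<le> i" "i < n"
  shows "w (X i) = 0"
proof (rule submanifold_tangentD(2)[OF w])
  note c' = adapted_coordinatesD(1)[OF c(1)]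
  show "smooth_germ x (X i)" by (rule coordinatesD(2)[OF c' c(2) i(2)])
  show "\<forall>\<^sub>F y in nhds x. y \<in> S \<longrightarrow> X i y = 0"
    using eventually_nhds_in_open[OF coordinatesD(1)[OF c'] c(2)]
    by (rule eventually_mono) (use adapted_coordinatesD(3)[OF c(1)] i in auto)
qed

end

section \<open>Neighborhoods of symplectic leaves\<close>

locale leaf_nbhd = poisson_mfd n A UNIV \<Lambda>
  for n :: nat and A :: "('a::{t2_space, second_countable_topology}, 'e::euclidean_space) chart set"
    and \<Lambda> :: "'a bivfield" +
  fixes S N0 :: "'a set" and p :: "'a \<Rightarrow> 'a" and k :: nat
  assumes embedded: "embedded_submanifold n k A S"
    and characteristic: "\<And>x. x \<in> S \<Longrightarrow> submanifold_tangent A S x = sharp A \<Lambda> x ` cotangent_space A x"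
    and retraction: "retraction_germ S N0 p" and S_subset: "S \<subseteq> N0"
begin

abbreviation "adapted \<equiv> adapted_coordinates k S"

lemma open_N0: "open N0"
  and smooth_p: "x \<in> N0 \<Longrightarrow> smooth_map_germ x p"
  and p_in_S: "x \<in> N0 \<Longrightarrow> p x \<in> S"
  and p_id: "x \<in> S \<Longrightarrow> p x = x"
  using retraction S_subset by (auto simp: retraction_germ_def)

lemma open_preimage_p:
  assumes "open V"
  shows "open (N0 \<inter> p -` V)"
proof (rule continuous_open_preimage[OF _ open_N0 assms])
  show "continuous_on N0 p"
    using smooth_p open_N0 by (simp add: continuous_on_eq_continuous_at smooth_map_germ_def)
qed

text \<open>\<open>base X\<close> and \<open>bmat X\<close> take the roles of \<open>u\<close> and
  \<open>M\<close> in \<open>dirac_mfd\<close>, and \<open>patch V X\<close> is the open set on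
  which that locale is available.\<close>

definition "base X i y = X i (p y)" for X :: "nat \<Rightarrow> 'a \<Rightarrow> real"
definition "bmat X y i j = pb (base X i) (base X j) y"
definition "patch V X = {y \<in> N0. p y \<in> V \<and> ndet k (bmat X y) \<noteq> 0}"

context
  fixes V X D
  assumes c: "adapted V X D"
begin

lemmas c_coord = adapted_coordinatesD(1)[OF c]
lemmas k_le_n = adapted_coordinatesD(2)[OF c]

lemma smooth_base: "y \<in> N0 \<Longrightarrow> p y \<in> V \<Longrightarrow> i < n \<Longrightarrow> smooth_germ y (base X i)"
  unfolding base_def[abs_def]
  by (rule smooth_map_germ_pullback[OF smooth_p coordinatesD(2)[OF c_coord]])

lemma eventually_patch_domain: "y \<in> N0 \<Longrightarrow> p y \<in> V \<Longrightarrow> \<forall>\<^sub>F z in nhds y. z \<in> N0 \<and> p z \<in> V"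
  using eventually_nhds_in_open[OF open_preimage_p[OF coordinatesD(1)[OF c_coord]], of y] by simp

text \<open>\<open>p\<close> takes its values in \<open>S\<close>, where the coordinates with index
  at least \<open>k\<close> are zero.\<close>

lemma base_normal:
  assumes y: "y \<in> N0" "p y \<in> V" and v: "v \<in> tangent_space A y" and i: "k \<le> i" "i < n"
  shows "v (base X i) = 0"
proof (rule tangent_eventually_zero[OF v])
  show "\<forall>\<^sub>F z in nhds y. base X i z = 0"
    using eventually_patch_domain[OF y]
    by (rule eventually_mono) (use adapted_coordinatesD(3)[OF c] i p_in_S in \<open>auto simp: base_def\<close>)
qed

lemma tangent_pullback:
  assumes y: "y \<in> N0" "p y \<in> V" and v: "v \<in> tangent_space A y" and g: "smooth_germ (p y) g"
  shows "v (\<lambda>z. g (p z)) = (\<Sum>i<k. v (base X i) * D i (p y) g)"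
proof -
  let ?w = "pushforward A p y v"
  have X: "smooth_germ (p y) (X i)" if "i < n" for i by (rule coordinatesD(2)[OF c_coord y(2) that])
  have "?w g = (\<Sum>i<n. ?w (X i) * D i (p y) g)"
    by (rule tangent_coordinates[OF pushforward_in_tangent_space[OF smooth_p[OF y(1)] v] c_coord y(2) g])
  also have "\<dots> = (\<Sum>i<n. v (base X i) * D i (p y) g)"
    by (intro sum.cong refl) (simp add: pushforward_apply X base_def[abs_def])
  also have "\<dots> = (\<Sum>i<k. v (base X i) * D i (p y) g)"
    using k_le_n base_normal[OF y v] by (intro sum.mono_neutral_right) auto
  finally show ?thesis by (simp add: pushforward_apply g)
qed

lemma vertical_iff:
  assumes y: "y \<in> N0" "p y \<in> V"
  shows "v \<in> vertical A p y \<longleftrightarrow> v \<in> tangent_space A y \<and> (\<forall>i<k. v (base X i) = 0)"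
proof
  assume v: "v \<in> vertical A p y"
  then have "v (base X i) = 0" if "i < k" for i
    using pushforward_apply[of p y "X i" v] coordinatesD(2)[OF c_coord y(2), of i] k_le_n that
    by (simp add: vertical_def base_def[abs_def])
  then show "v \<in> tangent_space A y \<and> (\<forall>i<k. v (base X i) = 0)"
    using v by (simp add: vertical_def)
next
  assume v: "v \<in> tangent_space A y \<and> (\<forall>i<k. v (base X i) = 0)"
  have "pushforward A p y v g = 0" for g
  proof (cases "smooth_germ (p y) g")
    case True
    then show ?thesis using tangent_pullback[OF y conjunct1[OF v] True] v by (simp add: pushforward_apply)
  qed (simp add: pushforward_def)
  then show "v \<in> vertical A p y" using v by (auto simp: vertical_def)
qed

text \<open>On \<open>S\<close> the functions \<open>base X i\<close> and \<open>X i\<close> agree,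
  so vectors tangent to \<open>S\<close> do not distinguish them; the remaining coordinates have
  derivative zero along \<open>S\<close>.\<close>

lemma tangent_leaf_eqI:
  assumes s: "s \<in> S" "s \<in> V" and v: "v \<in> submanifold_tangent A S s" "w \<in> submanifold_tangent A S s"
    and eq: "\<And>i. i < k \<Longrightarrow> v (base X i) = w (base X i)"
  shows "v = w"
proof (rule tangent_eqI[OF c_coord s(2) submanifold_tangentD(1)[OF v(1)] submanifold_tangentD(1)[OF v(2)]])
  have sN: "s \<in> N0" "p s \<in> V" using s S_subset p_id by auto
  fix i assume i: "i < n"
  show "v (X i) = w (X i)"
  proof (cases "i < k")
    case True
    have X: "smooth_germ s (X i)" by (rule coordinatesD(2)[OF c_coord s(2) i])
    have ub: "u (base X i) = u (X i)" if u: "u \<in> submanifold_tangent A S s" for u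
    proof -
      have "u (\<lambda>y. base X i y - X i y) = 0"
        by (rule submanifold_tangentD(2)[OF u smooth_germ_diff[OF smooth_base[OF sN i] X]])
          (simp add: base_def p_id)
      then show ?thesis
        using tangent_diff[OF submanifold_tangentD(1)[OF u] smooth_base[OF sN i] X] by simp
    qed
    show ?thesis using eq[OF True] ub[OF v(1)] ub[OF v(2)] by simp
  next
    case False
    then show ?thesis
      using submanifold_tangent_normal_coordinates[OF c s(2) v(1)]
        submanifold_tangent_normal_coordinates[OF c s(2) v(2)] i by simp
  qed
qed

lemma ham_in_leaf:
  assumes "s \<in> S"
  shows "ham f s \<in> submanifold_tangent A S s"
  unfolding characteristic[OF assms] hamiltonian_field_def by simp

lemma zero_in_leaf: "(\<lambda>f. 0) \<in> submanifold_tangent A S s"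
  by (simp add: submanifold_tangent_def)

lemma base_coordinate_field:
  assumes s: "s \<in> S" "s \<in> V" and ij: "i < k" "j < k"
  shows "D i s (base X j) = (if i = j then 1 else 0)"
proof -
  have sN: "s \<in> N0" "p s \<in> V" "i < n" "j < n" using s S_subset p_id ij k_le_n by auto
  have X: "smooth_germ s (X j)" by (rule coordinatesD(2)[OF c_coord s(2) sN(4)])
  have Di: "D i s \<in> submanifold_tangent A S s" by (rule adapted_coordinatesD(4)[OF c s(2,1) ij(1)])
  have "D i s (\<lambda>y. base X j y - X j y) = 0"
    by (rule submanifold_tangentD(2)[OF Di smooth_germ_diff[OF smooth_base[OF sN(1,2,4)] X]])
      (simp add: base_def p_id)
  then show ?thesis
    using tangent_diff[OF submanifold_tangentD(1)[OF Di] smooth_base[OF sN(1,2,4)] X]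
      coordinatesD(5)[OF c_coord s(2) sN(3,4)] by simp
qed

text \<open>On the leaf the matrix of brackets is the symplectic one: a vector in its kernel would give a
  vanishing Hamiltonian vector field of a function with nonzero differential along the leaf.\<close>

lemma bmat_nondegenerate:
  assumes s: "s \<in> S" "s \<in> V"
  shows "ndet k (bmat X s) \<noteq> 0"
proof
  assume "ndet k (bmat X s) = 0"
  then show False
  proof (rule ndet_eq_0D)
    fix a i assume i: "i < k" "a i \<noteq> (0::real)" and a: "\<And>j. j < k \<Longrightarrow> (\<Sum>i<k. a i * bmat X s i j) = 0"
    have sN: "s \<in> N0" "p s \<in> V" using s S_subset p_id by auto
    have sb: "smooth_germ s (base X j)" if "j < k" for j using smooth_base[OF sN] that k_le_n by simp
    define f where "f y = (\<Sum>i<k. a i * base X i y)" for y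
    have f: "smooth_germ s f"
      unfolding f_def[abs_def] by (intro smooth_germ_sum smooth_germ_mult smooth_germ_const sb) simp
    have vf: "v f = (\<Sum>i<k. a i * v (base X i))" if v: "v \<in> tangent_space A s" for v
      unfolding f_def[abs_def]
      by (subst tangent_sum[OF v]) (auto intro!: smooth_germ_mult sb sum.cong tangent_scale[OF v])
    have "ham f s = (\<lambda>g. 0)"
    proof (rule tangent_leaf_eqI[OF s ham_in_leaf[OF s(1)] zero_in_leaf])
      fix j assume j: "j < k"
      have "ham f s (base X j) = pb f (base X j) s" by (rule ham_apply) (auto intro: sb j)
      also have "\<dots> = - ham (base X j) s f" using pb_skew[of s f "base X j"] by (simp add: ham_apply f)
      also have "\<dots> = - (\<Sum>i<k. a i * ham (base X j) s (base X i))"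
        by (subst vf) auto
      also have "\<dots> = - (\<Sum>i<k. a i * - bmat X s i j)"
        using pb_skew[of s "base X j"] by (simp add: ham_apply sb bmat_def)
      also have "\<dots> = 0" using a[OF j] by (simp add: sum_negf)
      finally show "ham f s (base X j) = 0" .
    qed
    \<comment> \<open>Being tangent to the leaf, \<open>D i s\<close> is the image of a covector
      \<open>\<beta>\<close>. By skew symmetry its derivative of \<open>f\<close> is minus the value
      of \<open>\<beta>\<close> on \<open>ham f s\<close>, which is zero, whereas the coordinates
      give \<open>a i\<close>.\<close>
    have "D i s \<in> sharp A \<Lambda> s ` cotangent_space A s"
      using adapted_coordinatesD(4)[OF c s(2,1) i(1)] characteristic[OF s(1)] by simp
    then obtain \<beta> where \<beta>: "\<beta> \<in> cotangent_space A s" "D i s = sharp A \<Lambda> s \<beta>" by auto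
    have "D i s f = \<Lambda> s \<beta> (differential A f s)" using \<beta>(2) f by (simp add: sharp_def)
    also have "\<dots> = - \<beta> (sharp A \<Lambda> s (differential A f s))"
      using bivector_skew[of s \<beta> "differential A f s"] cotangent_sharp[of s "differential A f s" \<beta>] \<beta>(1) by simp
    also have "\<dots> = 0"
      using \<open>ham f s = (\<lambda>g. 0)\<close> cotangent_zero[OF \<beta>(1)] by (simp add: hamiltonian_field_def)
    finally have "D i s f = 0" .
    moreover have "D i s f = (\<Sum>j<k. a j * D i s (base X j))"
      by (rule vf) (use i(1) k_le_n coordinatesD(4)[OF c_coord s(2)] in simp)
    ultimately show False
      using i by (simp add: base_coordinate_field[OF s] if_distrib[of "\<lambda>r. _ * r"] cong: if_cong)
  qed
qed

lemma open_patch: "open (patch V X)"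
proof -
  have "\<exists>T. open T \<and> y \<in> T \<and> T \<subseteq> patch V X" if y: "y \<in> patch V X" for y
  proof -
    have yN: "y \<in> N0" "p y \<in> V" "ndet k (bmat X y) \<noteq> 0" using y by (auto simp: patch_def)
    have "smooth_germ y (\<lambda>z. ndet k (bmat X z))"
      unfolding bmat_def
      by (intro smooth_germ_ndet smooth_germ_pb smooth_base yN) (use k_le_n in auto)
    then have "isCont (\<lambda>z. ndet k (bmat X z)) y" by (rule smooth_germ_isCont)
    then have "\<forall>\<^sub>F z in nhds y. ndet k (bmat X z) \<in> - {0}"
      using yN(3) by (intro isCont_eventually_nhds) auto
    with eventually_patch_domain[OF yN(1,2)] have "\<forall>\<^sub>F z in nhds y. z \<in> patch V X"
      by eventually_elim (simp add: patch_def)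
    then show ?thesis by (auto simp: eventually_nhds)
  qed
  then show ?thesis by (subst open_subopen) blast
qed

lemma dirac_patch: "dirac_mfd n A (patch V X) \<Lambda> k (base X)"
proof unfold_locales
  show "open (patch V X)" by (rule open_patch)
  show "bivector_field A (patch V X) \<Lambda>" using bivector_field by (auto simp: bivector_field_def)
  show "poisson_bivector A (patch V X) \<Lambda>"
    using poisson_bivector by (auto simp: poisson_bivector_def bivector_field_def)
  show "smooth_germ y (base X i)" if "y \<in> patch V X" "i < k" for y i
    using that k_le_n by (intro smooth_base) (auto simp: patch_def)
  show "ndet k (\<lambda>i j. pb (base X i) (base X j) y) \<noteq> 0" if "y \<in> patch V X" for y
    using that by (simp add: patch_def bmat_def[abs_def])
qed

end

text \<open>The splitting itself defines the projection, without reference to coordinates, so that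
  overlapping patches give one and the same object; \<open>vproj\<close> computes it on a
  patch.\<close>

definition vertical_part :: "'a \<Rightarrow> 'a tvec \<Rightarrow> 'a tvec" where
  "vertical_part y v = (THE w. w \<in> vertical A p y \<and> (\<lambda>f. v f - w f) \<in> horizontal A \<Lambda> p y)"

definition vertical_covector :: "'a \<Rightarrow> 'a covec \<Rightarrow> 'a covec" where
  "vertical_covector y \<alpha> v = (if v \<in> tangent_space A y then \<alpha> (vertical_part y v) else 0)"

text \<open>Image of \<open>\<Lambda>\<close> under the vertical projection, applied to both of its
  legs.\<close>

definition transverse :: "'a bivfield" where
  "transverse y \<alpha> \<beta> = \<Lambda> y (vertical_covector y \<alpha>) (vertical_covector y \<beta>)"

context
  fixes V X D y
  assumes c: "adapted V X D" and y: "y \<in> patch V X"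
begin

interpretation d: dirac_mfd n A "patch V X" \<Lambda> k "base X"
  by (rule dirac_patch[OF c])

text \<open>Coefficients of the horizontal part of \<open>v\<close> with respect to the vectors
  \<open>ham (base X j) y\<close>.\<close>

definition "hcoeff v j = (\<Sum>i<k. v (base X i) * d.C y i j)"
definition "vproj v f = v f - (\<Sum>j<k. hcoeff v j * ham (base X j) y f)"

lemma yN: "y \<in> N0" "p y \<in> V"
  using y by (auto simp: patch_def)

lemma ham_base_apply: "j < k \<Longrightarrow> l < k \<Longrightarrow> ham (base X j) y (base X l) = d.M y j l"
  unfolding d.M_def by (rule ham_apply) (auto intro: d.smooth_u y)

lemma combination_base:
  assumes "l < k"
  shows "(\<Sum>j<k. hcoeff v j * ham (base X j) y (base X l)) = v (base X l)"
proof -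
  have "(\<Sum>j<k. hcoeff v j * ham (base X j) y (base X l)) = (\<Sum>j<k. \<Sum>i<k. v (base X i) * (d.C y i j * d.M y j l))"
    using assms by (simp add: hcoeff_def ham_base_apply sum_distrib_right mult.assoc)
  also have "\<dots> = (\<Sum>i<k. v (base X i) * (\<Sum>j<k. d.C y i j * d.M y j l))"
    by (subst sum.swap) (simp add: sum_distrib_left)
  also have "\<dots> = v (base X l)"
    using assms by (simp add: d.C_M[OF y] if_distrib[of "\<lambda>a. _ * a"] cong: if_cong)
  finally show ?thesis .
qed

lemma combination_in_tangent_space: "(\<lambda>f. \<Sum>j<k. a j * ham (base X j) y f) \<in> tangent_space A y"
  by (intro tangent_space_sum tangent_space_scale ham_in_tangent_space UNIV_I)

lemma vproj_in_tangent_space: "v \<in> tangent_space A y \<Longrightarrow> vproj v \<in> tangent_space A y"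
  unfolding vproj_def[abs_def] by (intro tangent_space_diff combination_in_tangent_space)

lemma vproj_vertical: "v \<in> tangent_space A y \<Longrightarrow> vproj v \<in> vertical A p y"
  by (simp add: vertical_iff[OF c yN] vproj_in_tangent_space) (simp add: vproj_def combination_base)

lemma tangent_base_combination:
  assumes v: "v \<in> tangent_space A y"
  shows "v (\<lambda>z. \<Sum>i<k. a i * base X i z) = (\<Sum>i<k. a i * v (base X i))"
  by (subst tangent_sum[OF v])
    (auto intro!: smooth_germ_mult d.smooth_u y sum.cong tangent_scale[OF v])

lemma ham_base_combination:
  "ham (\<lambda>z. \<Sum>i<k. a i * base X i z) y = (\<lambda>f. \<Sum>i<k. a i * ham (base X i) y f)"
proof
  fix f
  show "ham (\<lambda>z. \<Sum>i<k. a i * base X i z) y f = (\<Sum>i<k. a i * ham (base X i) y f)"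
  proof (cases "smooth_germ y f")
    case True
    have "ham (\<lambda>z. \<Sum>i<k. a i * base X i z) y f = - pb f (\<lambda>z. \<Sum>i<k. a i * base X i z) y"
      using pb_skew[of y "\<lambda>z. \<Sum>i<k. a i * base X i z" f] by (simp add: ham_apply True)
    also have "pb f (\<lambda>z. \<Sum>i<k. a i * base X i z) y = ham f y (\<lambda>z. \<Sum>i<k. a i * base X i z)"
      by (rule ham_apply[symmetric]) (auto intro!: smooth_germ_sum smooth_germ_mult d.smooth_u y)
    also have "\<dots> = (\<Sum>i<k. a i * ham f y (base X i))"
      by (rule tangent_base_combination) simp
    also have "\<dots> = (\<Sum>i<k. a i * - ham (base X i) y f)"
    proof (intro sum.cong refl)
      fix i assume "i \<in> {..<k}"
      then show "a i * ham f y (base X i) = a i * - ham (base X i) y f"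
        using pb_skew[of y f "base X i"] d.smooth_u[OF y, of i] by (simp add: ham_apply True)
    qed
    finally show ?thesis by (simp add: sum_negf)
  next
    case False
    then show ?thesis by (simp add: hamiltonian_field_def sharp_def)
  qed
qed

text \<open>A covector that annihilates the vertical vectors is a combination of the differentials
  of the \<open>base X i\<close>: its value on \<open>v\<close> is its value on the horizontal part
  of \<open>v\<close>, whose coefficients are linear in the derivatives
  \<open>v (base X i)\<close>.\<close>

lemma horizontal_iff:
  "w \<in> horizontal A \<Lambda> p y \<longleftrightarrow> (\<exists>a. w = (\<lambda>f. \<Sum>j<k. a j * ham (base X j) y f))"
proof
  assume "w \<in> horizontal A \<Lambda> p y"
  then obtain \<alpha> where \<alpha>: "\<alpha> \<in> cotangent_space A y" "\<And>v. v \<in> vertical A p y \<Longrightarrow> \<alpha> v = 0"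
    and w: "w = sharp A \<Lambda> y \<alpha>"
    by (auto simp: horizontal_def annihilator_def)
  define a where "a i = (\<Sum>j<k. d.C y i j * \<alpha> (ham (base X j) y))" for i
  have "\<alpha> = differential A (\<lambda>z. \<Sum>i<k. a i * base X i z) y"
  proof
    fix v
    show "\<alpha> v = differential A (\<lambda>z. \<Sum>i<k. a i * base X i z) y v"
    proof (cases "v \<in> tangent_space A y")
      case True
      have "0 = \<alpha> (vproj v)" using \<alpha>(2)[OF vproj_vertical[OF True]] by simp
      also have "\<dots> = \<alpha> v - (\<Sum>j<k. hcoeff v j * \<alpha> (ham (base X j) y))"
        unfolding vproj_def[abs_def]
        by (simp add: cotangent_diff[OF \<alpha>(1)] cotangent_sum[OF \<alpha>(1)] True combination_in_tangent_space)
      also have "(\<Sum>j<k. hcoeff v j * \<alpha> (ham (base X j) y)) = (\<Sum>i<k. a i * v (base X i))"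
        unfolding hcoeff_def a_def sum_distrib_right by (subst sum.swap) (simp add: mult_ac)
      finally show ?thesis by (simp add: differential_apply True tangent_base_combination)
    qed (simp add: differential_def cotangent_outside[OF \<alpha>(1)])
  qed
  then show "\<exists>a. w = (\<lambda>f. \<Sum>j<k. a j * ham (base X j) y f)"
    using ham_base_combination[of a] w by (auto simp: hamiltonian_field_def)
next
  assume "\<exists>a. w = (\<lambda>f. \<Sum>j<k. a j * ham (base X j) y f)"
  then obtain a where w: "w = (\<lambda>f. \<Sum>j<k. a j * ham (base X j) y f)" by blast
  have "differential A (\<lambda>z. \<Sum>i<k. a i * base X i z) y \<in> annihilator A y (vertical A p y)"
    unfolding annihilator_def mem_Collect_eq
    by (intro conjI differential_in_cotangent_space ballI)
      (simp add: vertical_iff[OF c yN] differential_apply tangent_base_combination)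
  then have "sharp A \<Lambda> y (differential A (\<lambda>z. \<Sum>i<k. a i * base X i z) y) \<in> horizontal A \<Lambda> p y"
    unfolding horizontal_def by (rule imageI)
  then show "w \<in> horizontal A \<Lambda> p y"
    using ham_base_combination[of a] w by (simp only: hamiltonian_field_def)
qed

lemma horizontal_in_tangent_space: "w \<in> horizontal A \<Lambda> p y \<Longrightarrow> w \<in> tangent_space A y"
  by (auto simp: horizontal_iff combination_in_tangent_space)

lemma horizontal_vertical_zero:
  assumes w: "w \<in> horizontal A \<Lambda> p y" "w \<in> vertical A p y"
  shows "w = (\<lambda>f. 0)"
proof -
  obtain a where a: "w = (\<lambda>f. \<Sum>j<k. a j * ham (base X j) y f)" using w(1) by (auto simp: horizontal_iff)
  have a0: "(\<Sum>j<k. a j * d.M y j l) = 0" if "l < k" for l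
    using w(2) that by (auto simp: vertical_iff[OF c yN] a ham_base_apply)
  have "a i = 0" if i: "i < k" for i
  proof -
    have "(0::real) = (\<Sum>l<k. (\<Sum>j<k. a j * d.M y j l) * d.C y l i)" by (simp add: a0)
    also have "\<dots> = (\<Sum>j<k. a j * (\<Sum>l<k. d.M y j l * d.C y l i))"
      unfolding sum_distrib_left sum_distrib_right by (subst sum.swap) (simp add: mult.assoc)
    also have "\<dots> = a i"
      using i by (simp add: d.M_C[OF y] if_distrib[of "\<lambda>b. _ * b"] cong: if_cong)
    finally show ?thesis by simp
  qed
  then show ?thesis by (simp add: a)
qed

lemma zero_horizontal: "(\<lambda>f. 0) \<in> horizontal A \<Lambda> p y"
  unfolding horizontal_iff by (rule exI[of _ "\<lambda>_. 0"]) simp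

lemma zero_vertical: "(\<lambda>f. 0) \<in> vertical A p y"
  by (simp add: vertical_iff[OF c yN])

lemma vproj_complement: "(\<lambda>f. v f - vproj v f) \<in> horizontal A \<Lambda> p y"
  unfolding horizontal_iff vproj_def by (rule exI[of _ "hcoeff v"]) simp

lemma vertical_part_eq:
  assumes v: "v \<in> tangent_space A y"
  shows "vertical_part y v = vproj v"
  unfolding vertical_part_def
proof (rule the_equality)
  show "vproj v \<in> vertical A p y \<and> (\<lambda>f. v f - vproj v f) \<in> horizontal A \<Lambda> p y"
    using vproj_vertical[OF v] vproj_complement by blast
  fix w assume w: "w \<in> vertical A p y \<and> (\<lambda>f. v f - w f) \<in> horizontal A \<Lambda> p y"
  obtain a where a: "(\<lambda>f. v f - w f) = (\<lambda>f. \<Sum>j<k. a j * ham (base X j) y f)"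
    using w by (auto simp: horizontal_iff)
  have "w f - vproj v f = (\<Sum>j<k. (hcoeff v j - a j) * ham (base X j) y f)" for f
    using fun_cong[OF a, of f] by (simp add: vproj_def left_diff_distrib sum_subtractf)
  then have "(\<lambda>f. w f - vproj v f) \<in> horizontal A \<Lambda> p y"
    unfolding horizontal_iff by (intro exI[of _ "\<lambda>j. hcoeff v j - a j"]) simp
  moreover have "(\<lambda>f. w f - vproj v f) \<in> vertical A p y"
    using w vproj_vertical[OF v] by (auto simp: vertical_iff[OF c yN] tangent_space_diff)
  ultimately have "(\<lambda>f. w f - vproj v f) = (\<lambda>f. 0)" by (rule horizontal_vertical_zero)
  then show "w = vproj v" by (simp add: fun_eq_iff)
qed

lemma pushforward_surj:
  "pushforward A p y ` tangent_space A y = submanifold_tangent A S (p y)"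
proof
  note sp = smooth_p[OF yN(1)]
  show "pushforward A p y ` tangent_space A y \<subseteq> submanifold_tangent A S (p y)"
  proof
    fix w assume "w \<in> pushforward A p y ` tangent_space A y"
    then obtain v where v: "v \<in> tangent_space A y" "w = pushforward A p y v" by auto
    have "w f = 0" if f: "smooth_germ (p y) f" and 0: "\<forall>\<^sub>F z in nhds (p y). z \<in> S \<longrightarrow> f z = 0" for f
    proof -
      obtain U where U: "open U" "p y \<in> U" "\<And>z. z \<in> U \<Longrightarrow> z \<in> S \<Longrightarrow> f z = 0"
        using 0 by (auto simp: eventually_nhds)
      have "\<forall>\<^sub>F z in nhds y. f (p z) = 0"
        using eventually_nhds_in_open[OF open_preimage_p[OF U(1)], of y]
        by (rule eventually_mono) (use yN U p_in_S in auto)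
      then show ?thesis using tangent_eventually_zero[OF v(1)] by (simp add: v(2) pushforward_apply f)
    qed
    then show "w \<in> submanifold_tangent A S (p y)"
      using pushforward_in_tangent_space[OF sp v(1)] by (simp add: submanifold_tangent_def v(2))
  qed
  show "submanifold_tangent A S (p y) \<subseteq> pushforward A p y ` tangent_space A y"
  proof
    fix w assume w: "w \<in> submanifold_tangent A S (p y)"
    \<comment> \<open>The coefficients solve a linear system with matrix \<open>d.M y\<close>, so
      that \<open>v\<close> has the prescribed derivatives \<open>w (X l)\<close> on the base
      functions.\<close>
    define a where "a j = (\<Sum>i<k. w (X i) * d.C y i j)" for j
    define v where "v = (\<lambda>f. \<Sum>j<k. a j * ham (base X j) y f)"
    have v: "v \<in> tangent_space A y" unfolding v_def by (rule combination_in_tangent_space)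
    have vu: "v (base X l) = w (X l)" if l: "l < k" for l
    proof -
      have "v (base X l) = (\<Sum>j<k. \<Sum>i<k. w (X i) * (d.C y i j * d.M y j l))"
        using l by (simp add: v_def a_def ham_base_apply sum_distrib_right mult.assoc)
      also have "\<dots> = (\<Sum>i<k. w (X i) * (\<Sum>j<k. d.C y i j * d.M y j l))"
        by (subst sum.swap) (simp add: sum_distrib_left)
      also have "\<dots> = w (X l)"
        using l by (simp add: d.C_M[OF y] if_distrib[of "\<lambda>a. _ * a"] cong: if_cong)
      finally show ?thesis .
    qed
    have "pushforward A p y v = w"
    proof (rule tangent_eqI[OF c_coord[OF c] yN(2) pushforward_in_tangent_space[OF sp v]
          submanifold_tangentD(1)[OF w]])
      fix i assume i: "i < n"
      have "pushforward A p y v (X i) = v (base X i)"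
        using pushforward_apply[of p y "X i" v] coordinatesD(2)[OF c_coord[OF c] yN(2) i]
        by (simp add: base_def[abs_def])
      then show "pushforward A p y v (X i) = w (X i)"
        using vu[of i] base_normal[OF c yN v, of i] i
          submanifold_tangent_normal_coordinates[OF c yN(2) w, of i] by (cases "i < k") auto
    qed
    then show "w \<in> pushforward A p y ` tangent_space A y" using v by blast
  qed
qed

lemma coupling_at:
  "horizontal A \<Lambda> p y \<inter> vertical A p y = {\<lambda>f. 0} \<and>
    (\<forall>v\<in>tangent_space A y. \<exists>h\<in>horizontal A \<Lambda> p y. \<exists>w\<in>vertical A p y. v = (\<lambda>f. h f + w f))"
proof
  show "horizontal A \<Lambda> p y \<inter> vertical A p y = {\<lambda>f. 0}"
    using horizontal_vertical_zero zero_horizontal zero_vertical by blast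
  show "\<forall>v\<in>tangent_space A y. \<exists>h\<in>horizontal A \<Lambda> p y. \<exists>w\<in>vertical A p y. v = (\<lambda>f. h f + w f)"
  proof
    fix v assume v: "v \<in> tangent_space A y"
    show "\<exists>h\<in>horizontal A \<Lambda> p y. \<exists>w\<in>vertical A p y. v = (\<lambda>f. h f + w f)"
      by (rule bexI[OF _ vproj_complement[of v]], rule bexI[OF _ vproj_vertical[OF v]]) simp
  qed
qed

lemma vertical_covector_apply:
  "v \<in> tangent_space A y \<Longrightarrow> vertical_covector y \<alpha> v = \<alpha> (vproj v)"
  by (simp add: vertical_covector_def vertical_part_eq)

lemma vertical_covector_in_cotangent_space:
  assumes \<alpha>: "\<alpha> \<in> cotangent_space A y"
  shows "vertical_covector y \<alpha> \<in> cotangent_space A y"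
proof -
  have "vproj (\<lambda>f. u f + v f) = (\<lambda>f. vproj u f + vproj v f)" for u v
    by (simp add: fun_eq_iff vproj_def hcoeff_def sum.distrib distrib_right)
  moreover have "vproj (\<lambda>f. r * v f) = (\<lambda>f. r * vproj v f)" for r v
    by (simp add: fun_eq_iff vproj_def hcoeff_def sum_distrib_left sum_distrib_right right_diff_distrib mult.assoc)
  moreover have "vertical_covector y \<alpha> v = 0" if "v \<notin> tangent_space A y" for v
    using that by (simp add: vertical_covector_def)
  ultimately show ?thesis
    by (auto simp: cotangent_space_def vertical_covector_apply tangent_space_add tangent_space_scale
        cotangent_add[OF \<alpha>] cotangent_scale[OF \<alpha>] vproj_in_tangent_space)
qed

text \<open>This links the geometric definition with the Dirac bracket: composing a differential
  with the vertical projection amounts to correcting the function as in \<open>d.star\<close>. Skew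
  symmetry of \<open>C\<close> matches the coefficients \<open>d.co\<close> with
  \<open>hcoeff\<close>.\<close>

lemma vertical_covector_differential:
  assumes f: "smooth_germ y f"
  shows "vertical_covector y (differential A f y) = differential A (d.star y f) y"
proof
  fix v
  show "vertical_covector y (differential A f y) v = differential A (d.star y f) y v"
  proof (cases "v \<in> tangent_space A y")
    case True
    have sm: "smooth_germ y (\<lambda>z. base X j z - base X j y)" "smooth_germ y (base X j)"
      "smooth_germ y (d.co f j)" if "j < k" for j
      using d.smooth_u[OF y that] d.smooth_germ_co[OF y f that] by (auto intro: smooth_germ_diff)
    have "v (d.star y f) = v f - (\<Sum>j<k. v (\<lambda>z. d.co f j z * (base X j z - base X j y)))"
      unfolding d.star_def[OF y, abs_def]
      by (subst tangent_diff[OF True f]) (auto intro!: smooth_germ_sum smooth_germ_mult sm tangent_sum[OF True])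
    also have "(\<Sum>j<k. v (\<lambda>z. d.co f j z * (base X j z - base X j y))) = (\<Sum>j<k. d.co f j y * v (base X j))"
      by (intro sum.cong refl) (simp add: tangent_mult[OF True] tangent_diff[OF True] tangent_const[OF True] sm)
    also have "\<dots> = (\<Sum>j<k. \<Sum>i<k. pb f (base X i) y * d.C y i j * v (base X j))"
      by (simp add: d.co_def sum_distrib_right)
    also have "\<dots> = (\<Sum>i<k. \<Sum>j<k. pb f (base X i) y * d.C y i j * v (base X j))" by (rule sum.swap)
    also have "\<dots> = (\<Sum>i<k. \<Sum>j<k. v (base X j) * d.C y j i * ham (base X i) y f)"
    proof (intro sum.cong refl)
      fix i j assume "i \<in> {..<k}" "j \<in> {..<k}"
      then have "d.C y i j = - d.C y j i" by (intro d.C_skew[OF y]) auto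
      moreover have "pb f (base X i) y = - ham (base X i) y f"
        using pb_skew[of y f "base X i"] by (simp add: ham_apply f)
      ultimately show "pb f (base X i) y * d.C y i j * v (base X j) = v (base X j) * d.C y j i * ham (base X i) y f"
        by simp
    qed
    also have "\<dots> = (\<Sum>i<k. hcoeff v i * ham (base X i) y f)"
      by (simp add: hcoeff_def sum_distrib_right)
    finally have "v (d.star y f) = vproj v f" by (simp add: vproj_def)
    then show ?thesis
      using True by (simp add: vertical_covector_apply differential_apply vproj_in_tangent_space)
  qed (simp add: vertical_covector_def differential_def)
qed

text \<open>The bracket is that of the two starred functions at \<open>y\<close>. The star on the
  first turns its Hamiltonian vector into \<open>d.dham f y\<close>, and this vector annihilates the
  base functions, so the star on the second is invisible to it.\<close>

lemma transverse_bracket: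
  assumes f: "smooth_germ y f" and g: "smooth_germ y g"
  shows "poisson_bracket A transverse f g y = d.db f g y"
proof -
  have sm: "smooth_germ y (\<lambda>z. base X j z - base X j y)" "smooth_germ y (base X j)"
    "smooth_germ y (d.co g j)" if "j < k" for j
    using d.smooth_u[OF y that] d.smooth_germ_co[OF y g that] by (auto intro: smooth_germ_diff)
  note T = d.dham_in_tangent_space[OF y, of f]
  have "poisson_bracket A transverse f g y = pb (d.star y f) (d.star y g) y"
    by (simp add: poisson_bracket_def transverse_def vertical_covector_differential f g)
  also have "\<dots> = d.dham f y (d.star y g)"
    using d.pb_star_x[OF y f d.smooth_germ_star[OF y g]] d.dham_apply[OF y d.smooth_germ_star[OF y g]] by simp
  also have "\<dots> = d.dham f y g - (\<Sum>j<k. d.dham f y (\<lambda>z. d.co g j z * (base X j z - base X j y)))"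
    unfolding d.star_def[OF y, abs_def]
    by (subst tangent_diff[OF T g]) (auto intro!: smooth_germ_sum smooth_germ_mult sm tangent_sum[OF T])
  also have "(\<Sum>j<k. d.dham f y (\<lambda>z. d.co g j z * (base X j z - base X j y))) = 0"
    by (intro sum.neutral ballI)
      (simp add: tangent_mult[OF T] tangent_diff[OF T] tangent_const[OF T] sm d.dham_u[OF y])
  finally show ?thesis by (simp add: d.dham_apply[OF y g])
qed

lemma transverse_in_vertical: "transverse y \<in> bivectors A y (vertical A p y)"
proof (rule bivector_rep[OF UNIV_I, of y])
  fix ps assume ps: "set ps \<subseteq> tangent_space A y \<times> tangent_space A y"
    "\<And>\<alpha> \<beta>. \<alpha> \<in> cotangent_space A y \<Longrightarrow> \<beta> \<in> cotangent_space A y \<Longrightarrow>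
      \<Lambda> y \<alpha> \<beta> = (\<Sum>(u, v)\<leftarrow>ps. \<alpha> u * \<beta> v - \<alpha> v * \<beta> u)"
  let ?qs = "map (\<lambda>(u, v). (vproj u, vproj v)) ps"
  have "set ?qs \<subseteq> vertical A p y \<times> vertical A p y" using ps(1) vproj_vertical by auto
  moreover have "transverse y \<alpha> \<beta> = (\<Sum>(u, v)\<leftarrow>?qs. \<alpha> u * \<beta> v - \<alpha> v * \<beta> u)"
    if "\<alpha> \<in> cotangent_space A y" "\<beta> \<in> cotangent_space A y" for \<alpha> \<beta>
  proof -
    have "transverse y \<alpha> \<beta> = (\<Sum>(u, v)\<leftarrow>ps. vertical_covector y \<alpha> u * vertical_covector y \<beta> v
        - vertical_covector y \<alpha> v * vertical_covector y \<beta> u)"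
      unfolding transverse_def by (intro ps(2) vertical_covector_in_cotangent_space that)
    also have "\<dots> = (\<Sum>(u, v)\<leftarrow>?qs. \<alpha> u * \<beta> v - \<alpha> v * \<beta> u)"
      unfolding map_map o_def case_prod_beta fst_conv snd_conv
    proof (intro arg_cong[of _ _ sum_list] map_cong refl)
      fix q assume "q \<in> set ps"
      then have "fst q \<in> tangent_space A y" "snd q \<in> tangent_space A y" using ps(1) by auto
      then show "vertical_covector y \<alpha> (fst q) * vertical_covector y \<beta> (snd q)
          - vertical_covector y \<alpha> (snd q) * vertical_covector y \<beta> (fst q)
          = \<alpha> (vproj (fst q)) * \<beta> (vproj (snd q)) - \<alpha> (vproj (snd q)) * \<beta> (vproj (fst q))"
        by (simp add: vertical_covector_apply)
    qed
    finally show ?thesis .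
  qed
  ultimately show ?thesis
    unfolding bivectors_def mem_Collect_eq by (intro exI[of _ ?qs] conjI ballI)
qed

text \<open>Split each covector into the part \<open>?V\<close> factoring through the vertical
  projection and the rest \<open>?H\<close>. As \<open>?H\<close> annihilates vertical vectors, its
  image under \<open>sharp\<close> is horizontal by definition, hence is annihilated by every
  \<open>?V\<close>. The mixed terms vanish, and the difference is \<open>\<Lambda>\<close>
  evaluated on the two \<open>?H\<close> parts.\<close>

lemma horizontal_part_in_horizontal:
  "(\<lambda>z \<alpha> \<beta>. \<Lambda> z \<alpha> \<beta> - transverse z \<alpha> \<beta>) y \<in> bivectors A y (horizontal A \<Lambda> p y)"
proof (rule bivector_rep[OF UNIV_I, of y])
  fix ps assume ps: "set ps \<subseteq> tangent_space A y \<times> tangent_space A y"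
    "\<And>\<alpha> \<beta>. \<alpha> \<in> cotangent_space A y \<Longrightarrow> \<beta> \<in> cotangent_space A y \<Longrightarrow>
      \<Lambda> y \<alpha> \<beta> = (\<Sum>(u, v)\<leftarrow>ps. \<alpha> u * \<beta> v - \<alpha> v * \<beta> u)"
  let ?h = "\<lambda>v f. v f - vproj v f"
  let ?qs = "map (\<lambda>(u, v). (?h u, ?h v)) ps"
  have "set ?qs \<subseteq> horizontal A \<Lambda> p y \<times> horizontal A \<Lambda> p y" using vproj_complement by auto
  moreover have "\<Lambda> y \<alpha> \<beta> - transverse y \<alpha> \<beta> = (\<Sum>(u, v)\<leftarrow>?qs. \<alpha> u * \<beta> v - \<alpha> v * \<beta> u)"
    if \<alpha>: "\<alpha> \<in> cotangent_space A y" and \<beta>: "\<beta> \<in> cotangent_space A y" for \<alpha> \<beta>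
  proof -
    let ?V = "vertical_covector y" and ?H = "\<lambda>\<alpha> v. \<alpha> v - vertical_covector y \<alpha> v"
    have V: "?V \<gamma> \<in> cotangent_space A y" if "\<gamma> \<in> cotangent_space A y" for \<gamma>
      by (rule vertical_covector_in_cotangent_space[OF that])
    have H: "?H \<gamma> \<in> cotangent_space A y" if "\<gamma> \<in> cotangent_space A y" for \<gamma>
      using that V[OF that] by (simp add: cotangent_space_def algebra_simps)
    have H_apply: "?H \<gamma> v = \<gamma> (?h v)" if "\<gamma> \<in> cotangent_space A y" "v \<in> tangent_space A y" for \<gamma> v
      using that by (simp add: vertical_covector_apply cotangent_diff[OF that(1)] vproj_in_tangent_space)
    have vproj_vertical_id: "vproj v = v" if v: "v \<in> vertical A p y" for v
      using v by (auto simp: vproj_def[abs_def] hcoeff_def vertical_iff[OF c yN])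
    have cross: "\<Lambda> y (?H \<gamma>) (?V \<delta>) = 0" if \<gamma>: "\<gamma> \<in> cotangent_space A y" and \<delta>: "\<delta> \<in> cotangent_space A y" for \<gamma> \<delta>
    proof -
      have "?H \<gamma> v = 0" if v: "v \<in> vertical A p y" for v
        using H_apply[OF \<gamma>, of v] v vproj_vertical_id[OF v] cotangent_zero[OF \<gamma>] by (simp add: vertical_def)
      then have "sharp A \<Lambda> y (?H \<gamma>) \<in> horizontal A \<Lambda> p y"
        using H[OF \<gamma>] by (auto simp: horizontal_def annihilator_def)
      then have h: "sharp A \<Lambda> y (?H \<gamma>) \<in> horizontal A \<Lambda> p y" "sharp A \<Lambda> y (?H \<gamma>) \<in> tangent_space A y"
        by (auto simp: horizontal_in_tangent_space)
      obtain a where a: "sharp A \<Lambda> y (?H \<gamma>) = (\<lambda>f. \<Sum>j<k. a j * ham (base X j) y f)"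
        using h(1) by (auto simp: horizontal_iff)
      have "vproj (sharp A \<Lambda> y (?H \<gamma>)) f = (\<Sum>j<k. (a j - hcoeff (sharp A \<Lambda> y (?H \<gamma>)) j) * ham (base X j) y f)" for f
        unfolding vproj_def by (simp add: left_diff_distrib sum_subtractf) (simp add: a)
      then have "vproj (sharp A \<Lambda> y (?H \<gamma>)) \<in> horizontal A \<Lambda> p y"
        unfolding horizontal_iff by (intro exI[of _ "\<lambda>j. a j - hcoeff (sharp A \<Lambda> y (?H \<gamma>)) j"]) (simp add: fun_eq_iff)
      then have "vproj (sharp A \<Lambda> y (?H \<gamma>)) = (\<lambda>f. 0)"
        using vproj_vertical[OF h(2)] by (rule horizontal_vertical_zero)
      then have "?V \<delta> (sharp A \<Lambda> y (?H \<gamma>)) = 0"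
        using cotangent_zero[OF \<delta>] by (simp add: vertical_covector_apply h(2))
      then show ?thesis using cotangent_sharp[OF UNIV_I H[OF \<gamma>] V[OF \<delta>]] by simp
    qed
    have split: "\<Lambda> y \<gamma> \<delta> = \<Lambda> y (?H \<gamma>) \<delta> + \<Lambda> y (?V \<gamma>) \<delta>"
      if \<gamma>: "\<gamma> \<in> cotangent_space A y" and \<delta>: "\<delta> \<in> cotangent_space A y" for \<gamma> \<delta>
      using bivector_skew[OF UNIV_I \<gamma> \<delta>] bivector_skew[OF UNIV_I H[OF \<gamma>] \<delta>] bivector_skew[OF UNIV_I V[OF \<gamma>] \<delta>]
        cotangent_sharp[OF UNIV_I \<delta> \<gamma>] cotangent_sharp[OF UNIV_I \<delta> H[OF \<gamma>]] cotangent_sharp[OF UNIV_I \<delta> V[OF \<gamma>]]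
      by linarith
    have split2: "\<Lambda> y \<gamma> \<delta> = \<Lambda> y \<gamma> (?H \<delta>) + \<Lambda> y \<gamma> (?V \<delta>)"
      if \<gamma>: "\<gamma> \<in> cotangent_space A y" and \<delta>: "\<delta> \<in> cotangent_space A y" for \<gamma> \<delta>
      using cotangent_sharp[OF UNIV_I \<gamma> \<delta>] cotangent_sharp[OF UNIV_I \<gamma> H[OF \<delta>]] cotangent_sharp[OF UNIV_I \<gamma> V[OF \<delta>]]
      by linarith
    have "\<Lambda> y (?V \<alpha>) (?H \<beta>) = 0"
      using cross[OF \<beta> \<alpha>] bivector_skew[OF UNIV_I V[OF \<alpha>] H[OF \<beta>]] by simp
    then have "\<Lambda> y \<alpha> \<beta> - transverse y \<alpha> \<beta> = \<Lambda> y (?H \<alpha>) (?H \<beta>)"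
      using split[OF \<alpha> \<beta>] split2[OF H[OF \<alpha>] \<beta>] split2[OF V[OF \<alpha>] \<beta>] cross[OF \<alpha> \<beta>]
      unfolding transverse_def by linarith
    also have "\<dots> = (\<Sum>(u, v)\<leftarrow>ps. ?H \<alpha> u * ?H \<beta> v - ?H \<alpha> v * ?H \<beta> u)"
      by (rule ps(2)[OF H[OF \<alpha>] H[OF \<beta>]])
    also have "\<dots> = (\<Sum>(u, v)\<leftarrow>?qs. \<alpha> u * \<beta> v - \<alpha> v * \<beta> u)"
      unfolding map_map o_def case_prod_beta fst_conv snd_conv
    proof (intro arg_cong[of _ _ sum_list] map_cong refl)
      fix q assume "q \<in> set ps"
      then have q: "fst q \<in> tangent_space A y" "snd q \<in> tangent_space A y" using ps(1) by auto
      show "?H \<alpha> (fst q) * ?H \<beta> (snd q) - ?H \<alpha> (snd q) * ?H \<beta> (fst q)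
          = \<alpha> (?h (fst q)) * \<beta> (?h (snd q)) - \<alpha> (?h (snd q)) * \<beta> (?h (fst q))"
        by (simp only: H_apply[OF \<alpha> q(1)] H_apply[OF \<alpha> q(2)] H_apply[OF \<beta> q(1)] H_apply[OF \<beta> q(2)])
    qed
    finally show ?thesis .
  qed
  ultimately show ?thesis
    unfolding bivectors_def mem_Collect_eq by (intro exI[of _ ?qs] conjI ballI)
qed

text \<open>At a point of the leaf, \<open>d.dham f y\<close> is the Hamiltonian vector of
  \<open>d.star y f\<close>, hence tangent to the leaf, and it also annihilates the functions
  \<open>base X i\<close>, which are coordinates on the leaf.\<close>

lemma transverse_vanishes:
  assumes "y \<in> S" and \<alpha>: "\<alpha> \<in> cotangent_space A y" and \<beta>: "\<beta> \<in> cotangent_space A y"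
  shows "transverse y \<alpha> \<beta> = 0"
proof -
  obtain f where f: "smooth_germ y f" "\<alpha> = differential A f y" by (rule cotangent_eq_differential[OF \<alpha>])
  obtain g where g: "smooth_germ y g" "\<beta> = differential A g y" by (rule cotangent_eq_differential[OF \<beta>])
  have yV: "y \<in> V" using yN p_id[OF assms(1)] by simp
  have "d.dham f y g' = ham (d.star y f) y g'" for g'
  proof (cases "smooth_germ y g'")
    case True
    then show ?thesis by (simp add: d.dham_apply[OF y True] d.pb_star_x[OF y f(1) True] ham_apply)
  next
    case False
    then show ?thesis by (simp add: tangent_not_smooth[OF d.dham_in_tangent_space[OF y]]
        tangent_not_smooth[OF ham_in_tangent_space[OF UNIV_I]])
  qed
  then have eq: "d.dham f y = ham (d.star y f) y" by (rule ext)
  have "d.dham f y = (\<lambda>f. 0)"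
  proof (rule tangent_leaf_eqI[OF c assms(1) yV _ zero_in_leaf])
    show "d.dham f y \<in> submanifold_tangent A S y" unfolding eq by (rule ham_in_leaf[OF c assms(1)])
    show "d.dham f y (base X i) = 0" if "i < k" for i by (rule d.dham_u[OF y that])
  qed (rule c)
  then have "d.db f g y = 0" using d.dham_apply[OF y g(1), of f] by simp
  then show ?thesis using transverse_bracket[OF f(1) g(1)] by (simp add: poisson_bracket_def f(2) g(2))
qed

end

end

section \<open>Poisson cohomology classes and the vanishing of the modular class\<close>

context smooth_mfd
begin

lemma differential_cong:
  assumes "\<forall>\<^sub>F y in nhds x. f y = g y"
  shows "differential A f x = differential A g x"
proof
  fix v
  show "differential A f x v = differential A g x v"
  proof (cases "v \<in> tangent_space A x")
    case True
    have "v f = v g"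
      using tangent_cong[OF True _ assms] tangent_not_smooth[OF True] smooth_germ_cong[OF assms] by metis
    then show ?thesis using True by (simp add: differential_apply)
  qed (simp add: differential_def)
qed

lemma poisson_fields_cong_imp:
  assumes W: "open W" and eq: "\<And>x. x \<in> W \<Longrightarrow> Y x = Z x" and Y: "Y \<in> poisson_fields A W \<Lambda>"
  shows "Z \<in> poisson_fields A W \<Lambda>"
proof -
  have ev: "\<forall>\<^sub>F y in nhds x. Y y f = Z y f" if "x \<in> W" for x f
    using eventually_nhds_in_open[OF W that] by (rule eventually_mono) (simp add: eq)
  have vY: "vector_field A W Y" using Y by (simp add: poisson_fields_def)
  have "vector_field A W Z"
    using vY smooth_germ_transform[OF _ ev] by (auto simp: vector_field_iff[OF W] eq[symmetric])
  moreover have "Z x (poisson_bracket A \<Lambda> f g) - poisson_bracket A \<Lambda> (\<lambda>y. Z y f) g x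
      - poisson_bracket A \<Lambda> f (\<lambda>y. Z y g) x = 0"
    if "open V" "V \<subseteq> W" "smooth_fun A V f" "smooth_fun A V g" "x \<in> V" for V f g x
  proof -
    have x: "x \<in> W" using that by auto
    have "Y x (poisson_bracket A \<Lambda> f g) - poisson_bracket A \<Lambda> (\<lambda>y. Y y f) g x
      - poisson_bracket A \<Lambda> f (\<lambda>y. Y y g) x = 0"
      using Y that by (auto simp: poisson_fields_def)
    then show ?thesis
      using differential_cong[OF ev[OF x, of f]] differential_cong[OF ev[OF x, of g]] eq[OF x]
      by (simp add: poisson_bracket_def)
  qed
  ultimately show ?thesis unfolding poisson_fields_def by blast
qed

text \<open>Fields are functions on the whole type, but only their values on \<open>W\<close> enter;
  a modular field that vanishes on \<open>W\<close> may thus be exchanged for the zero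
  field.\<close>

lemma poisson_class_cong:
  assumes W: "open W" and eq: "\<And>x. x \<in> W \<Longrightarrow> Y x = Z x"
  shows "poisson_class A W \<Lambda> Y = poisson_class A W \<Lambda> Z"
proof -
  have "Y \<in> poisson_fields A W \<Lambda> \<longleftrightarrow> Z \<in> poisson_fields A W \<Lambda>"
    using poisson_fields_cong_imp[OF W, of Y Z \<Lambda>] poisson_fields_cong_imp[OF W, of Z Y \<Lambda>] eq by metis
  then show ?thesis by (simp add: poisson_class_def cohomologous_def eq Image_def)
qed

end

context poisson_mfd
begin

lemma ham_zero: "x \<in> W \<Longrightarrow> ham (\<lambda>_. 0) x = (\<lambda>g. 0)"
proof
  fix g assume x: "x \<in> W"
  show "ham (\<lambda>_. 0) x g = 0"
  proof (cases "smooth_germ x g")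
    case True
    then show ?thesis using pb_skew[OF x, of "\<lambda>_. 0" g] pb_const[OF x, of g 0] by (simp add: ham_apply[OF x])
  qed (simp add: hamiltonian_field_def sharp_def)
qed

lemma zero_poisson_field:
  assumes "open U" "U \<subseteq> W"
  shows "(\<lambda>x f. 0) \<in> poisson_fields A U \<Lambda>"
proof -
  have "pb (\<lambda>_. 0) g x = 0" "pb g (\<lambda>_. 0) x = 0" if "x \<in> W" for g x
    using pb_skew[OF that, of "\<lambda>_. 0" g] pb_const[OF that, of g 0] by simp_all
  then show ?thesis using assms by (auto simp: poisson_fields_def vector_field_zero)
qed

text \<open>The zero field is cohomologous to itself, so it lies in its own class and thereby in the
  modular class; this membership provides the potential \<open>\<phi>\<close> of the modular
  field.\<close>

lemma modular_class_zeroD: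
  assumes U: "open U" "U \<subseteq> W"
    and 0: "modular_class A n U \<Lambda> \<Omega> = poisson_class A U \<Lambda> (\<lambda>x f. 0)"
  obtains \<phi> where "\<And>x. x \<in> U \<Longrightarrow> smooth_germ x \<phi>"
    "\<And>x g. x \<in> U \<Longrightarrow> smooth_germ x g \<Longrightarrow> divergence A n \<Omega> (ham g) x = pb \<phi> g x"
proof -
  have "((\<lambda>x f. 0), (\<lambda>x f. 0)) \<in> cohomologous A U \<Lambda>"
    using zero_poisson_field[OF U] ham_zero U(2) smooth_fun_iff[OF U(1), of "\<lambda>_. 0"]
    by (auto simp: cohomologous_def intro!: exI[of _ "\<lambda>_. 0"])
  then have "(\<lambda>x f. 0) \<in> modular_class A n U \<Lambda> \<Omega>" unfolding 0 by (simp add: poisson_class_def)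
  then have "(modular_field A n \<Lambda> \<Omega>, \<lambda>x f. 0) \<in> cohomologous A U \<Lambda>"
    by (simp add: modular_class_def poisson_class_def)
  then obtain \<phi> where \<phi>: "smooth_fun A U \<phi>"
      "\<And>x. x \<in> U \<Longrightarrow> (\<lambda>g. modular_field A n \<Lambda> \<Omega> x g - 0) = ham \<phi> x"
    by (auto simp: cohomologous_def)
  show ?thesis
  proof (rule that)
    show "smooth_germ x \<phi>" if "x \<in> U" for x using \<phi>(1) that by (simp add: smooth_fun_iff[OF U(1)])
    show "divergence A n \<Omega> (ham g) x = pb \<phi> g x" if "x \<in> U" "smooth_germ x g" for x g
      using fun_cong[OF \<phi>(2)[OF that(1)], of g] that U(2) by (simp add: modular_field_def ham_apply subsetD)
  qed
qed

end

section \<open>The coupling neighborhood and the density on it\<close>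

context leaf_nbhd
begin

text \<open>The union of all patches inside \<open>U\<close>. No single family of base functions
  serves all of it, so what is claimed on it has to be independent of coordinates.\<close>

definition "leaf_domain U = {y \<in> N0 \<inter> U. \<exists>V X D. adapted V X D \<and> y \<in> patch V X}"

lemma leaf_domainE:
  assumes "y \<in> leaf_domain U"
  obtains V X D where "adapted V X D" "y \<in> patch V X"
  using assms by (auto simp: leaf_domain_def)

lemma open_leaf_domain:
  assumes "open U"
  shows "open (leaf_domain U)"
proof -
  have "leaf_domain U = U \<inter> (\<Union>{patch V X |V X. \<exists>D. adapted V X D})"
    by (auto simp: leaf_domain_def patch_def)
  moreover have "open (\<Union>{patch V X |V X. \<exists>D. adapted V X D})"
    using open_patch by (intro open_Union) auto
  ultimately show ?thesis using assms by auto
qed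

lemma leaf_subset_domain:
  assumes "S \<subseteq> U"
  shows "S \<subseteq> leaf_domain U"
proof
  fix s assume s: "s \<in> S"
  obtain V X D where c: "adapted V X D" "s \<in> V" by (rule adapted_coordinates_exist[OF embedded s])
  have "s \<in> patch V X"
    using bmat_nondegenerate[OF c(1) s c(2)] c(2) s S_subset by (auto simp: patch_def p_id)
  then show "s \<in> leaf_domain U" using c s S_subset assms by (auto simp: leaf_domain_def)
qed

lemma coupling_leaf_domain:
  assumes U: "open U" "S \<subseteq> U"
  shows "coupling_neighborhood A \<Lambda> S (leaf_domain U) p"
  unfolding coupling_neighborhood_def
proof (intro conjI)
  let ?N = "leaf_domain U"
  have N: "?N \<subseteq> N0" by (auto simp: leaf_domain_def)
  show "open ?N" by (rule open_leaf_domain[OF U(1)])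
  show SN: "S \<subseteq> ?N" by (rule leaf_subset_domain[OF U(2)])
  show "smooth_self_map A ?N p"
    using N smooth_p by (intro smooth_self_map_if_germs open_leaf_domain U(1)) auto
  show "p ` ?N = S"
  proof
    show "p ` ?N \<subseteq> S" using N p_in_S by auto
    show "S \<subseteq> p ` ?N"
    proof
      fix s assume "s \<in> S"
      then show "s \<in> p ` ?N" using SN p_id[of s] by (intro image_eqI[of s p s]) auto
    qed
  qed
  show "\<forall>x\<in>S. p x = x" by (simp add: p_id)
  show "\<forall>x\<in>?N. pushforward A p x ` tangent_space A x = submanifold_tangent A S (p x)"
  proof
    fix x assume "x \<in> ?N"
    then show "pushforward A p x ` tangent_space A x = submanifold_tangent A S (p x)"
      by (rule leaf_domainE) (rule pushforward_surj)
  qed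
  show "\<forall>x\<in>?N. horizontal A \<Lambda> p x \<inter> vertical A p x = {\<lambda>f. 0} \<and>
    (\<forall>v\<in>tangent_space A x. \<exists>h\<in>horizontal A \<Lambda> p x. \<exists>w\<in>vertical A p x. v = (\<lambda>f. h f + w f))"
    by (intro ballI, erule leaf_domainE) (rule coupling_at)
qed

lemma bivectors_mono: "w \<in> bivectors A x E \<Longrightarrow> E \<subseteq> F \<Longrightarrow> w \<in> bivectors A x F"
  unfolding bivectors_def mem_Collect_eq by (elim exE conjE, rule exI, rule conjI) auto

context
  fixes V X D y
  assumes c: "adapted V X D" and y: "y \<in> patch V X"
begin

interpretation d: dirac_mfd n A "patch V X" \<Lambda> k "base X"
  by (rule dirac_patch[OF c])

lemma transverse_bracket_germ:
  assumes f: "smooth_germ y f" and g: "smooth_germ y g"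
  shows "\<forall>\<^sub>F z in nhds y. d.db f g z = poisson_bracket A transverse f g z"
  using smooth_germ_eventually[OF f] smooth_germ_eventually[OF g] d.eventually_in_W[OF y]
  by eventually_elim (simp add: transverse_bracket[OF c])

lemma smooth_germ_transverse_bracket:
  "smooth_germ y f \<Longrightarrow> smooth_germ y g \<Longrightarrow> smooth_germ y (poisson_bracket A transverse f g)"
  by (rule smooth_germ_transform[OF d.smooth_germ_db[OF y] transverse_bracket_germ])

lemma transverse_double_bracket:
  assumes f: "smooth_germ y f" and g: "smooth_germ y g" and h: "smooth_germ y h"
  shows "poisson_bracket A transverse f (poisson_bracket A transverse g h) y = d.db f (d.db g h) y"
proof -
  have "poisson_bracket A transverse f (poisson_bracket A transverse g h) y
      = poisson_bracket A transverse f (d.db g h) y"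
    using differential_cong[OF transverse_bracket_germ[OF g h]] by (simp add: poisson_bracket_def)
  also have "\<dots> = d.db f (d.db g h) y"
    by (rule transverse_bracket[OF c y f d.smooth_germ_db[OF y g h]])
  finally show ?thesis .
qed

lemma transverse_jacobi:
  assumes f: "smooth_germ y f" and g: "smooth_germ y g" and h: "smooth_germ y h"
  shows "poisson_bracket A transverse f (poisson_bracket A transverse g h) y
    + poisson_bracket A transverse g (poisson_bracket A transverse h f) y
    + poisson_bracket A transverse h (poisson_bracket A transverse f g) y = 0"
  using d.db_jacobi[OF y f g h] by (simp add: transverse_double_bracket assms)

end

lemma smooth_germ_transverse_domain:
  assumes "y \<in> leaf_domain U" "smooth_germ y f" "smooth_germ y g"
  shows "smooth_germ y (poisson_bracket A transverse f g)"
  using assms(1) by (rule leaf_domainE) (rule smooth_germ_transverse_bracket[OF _ _ assms(2,3)])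

lemma bivector_field_transverse:
  assumes U: "open U"
  shows "bivector_field A (leaf_domain U) transverse"
  unfolding bivector_field_def
proof (intro conjI ballI allI impI; (elim conjE)?)
  fix x assume "x \<in> leaf_domain U"
  then have "transverse x \<in> bivectors A x (vertical A p x)"
    by (rule leaf_domainE) (rule transverse_in_vertical)
  then show "transverse x \<in> bivectors A x (tangent_space A x)"
    by (rule bivectors_mono) (auto simp: vertical_def)
next
  fix V f g assume V: "open V" "V \<subseteq> leaf_domain U" "smooth_fun A V f" "smooth_fun A V g"
  then show "smooth_fun A V (poisson_bracket A transverse f g)"
    by (auto simp: smooth_fun_iff[OF V(1)] intro!: smooth_germ_transverse_domain[of _ U])
qed

lemma transverse_poisson_leaf_domain:
  assumes U: "open U" "S \<subseteq> U"
  shows "transverse_poisson A \<Lambda> S (leaf_domain U) p transverse"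
proof -
  let ?N = "leaf_domain U" and ?H = "\<lambda>z \<alpha> \<beta>. \<Lambda> z \<alpha> \<beta> - transverse z \<alpha> \<beta>"
  note oN = open_leaf_domain[OF U(1)]
  have vert: "transverse y \<in> bivectors A y (vertical A p y)" if "y \<in> ?N" for y
    using that by (rule leaf_domainE) (rule transverse_in_vertical)
  have hor: "?H y \<in> bivectors A y (horizontal A \<Lambda> p y)" if "y \<in> ?N" for y
    using that by (rule leaf_domainE) (rule horizontal_part_in_horizontal)
  have horT: "horizontal A \<Lambda> p y \<subseteq> tangent_space A y" if "y \<in> ?N" for y
    using that by (rule leaf_domainE) (use horizontal_in_tangent_space in blast)
  have germs: "smooth_germ x f" if "open V" "smooth_fun A V f" "x \<in> V" for V f x
    using that by (simp add: smooth_fun_iff)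
  have bT: "bivector_field A ?N transverse" by (rule bivector_field_transverse[OF U(1)])
  have "bivector_field A ?N ?H"
    unfolding bivector_field_def
  proof (intro conjI ballI allI impI; (elim conjE)?)
    show "?H x \<in> bivectors A x (tangent_space A x)" if "x \<in> ?N" for x
      by (rule bivectors_mono[OF hor[OF that] horT[OF that]])
    show "smooth_fun A V (poisson_bracket A ?H f g)"
      if V: "open V" "V \<subseteq> ?N" "smooth_fun A V f" "smooth_fun A V g" for V f g
      unfolding smooth_fun_iff[OF V(1)]
    proof
      fix x assume x: "x \<in> V"
      have "smooth_germ x (\<lambda>z. pb f g z - poisson_bracket A transverse f g z)"
        using x V(2) germs[OF V(1,3) x] germs[OF V(1,4) x]
        by (intro smooth_germ_diff smooth_germ_pb smooth_germ_transverse_domain[of _ U]) auto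
      then show "smooth_germ x (poisson_bracket A ?H f g)"
        by (simp add: poisson_bracket_def[abs_def])
    qed
  qed
  moreover have "poisson_bivector A ?N transverse"
    unfolding poisson_bivector_def
  proof (intro conjI bT allI impI ballI; (elim conjE)?)
    fix V f g h x
    assume V: "open V" "V \<subseteq> ?N" "smooth_fun A V f" "smooth_fun A V g" "smooth_fun A V h" and x: "x \<in> V"
    have "x \<in> ?N" using x V(2) by auto
    then show "poisson_bracket A transverse f (poisson_bracket A transverse g h) x
      + poisson_bracket A transverse g (poisson_bracket A transverse h f) x
      + poisson_bracket A transverse h (poisson_bracket A transverse f g) x = 0"
      by (rule leaf_domainE)
        (rule transverse_jacobi[OF _ _ germs[OF V(1,3) x] germs[OF V(1,4) x] germs[OF V(1,5) x]])
  qed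
  moreover have "transverse x \<alpha> \<beta> = 0"
    if x: "x \<in> S" and "\<alpha> \<in> cotangent_space A x" "\<beta> \<in> cotangent_space A x" for x \<alpha> \<beta>
    by (rule leaf_domainE[OF subsetD[OF leaf_subset_domain[OF U(2)] x]]) (rule transverse_vanishes[OF _ _ that])
  ultimately show ?thesis
    using vert hor unfolding transverse_poisson_def
    by (intro conjI exI[of _ ?H] ballI) auto
qed

text \<open>The logarithm of the density of the leafwise symplectic volume at \<open>p y\<close> relative to that of the horizontal
  bivector at \<open>y\<close>. Numerator and denominator scale by the same factor under a change of
  coordinates on the leaf.\<close>

definition logdet :: "'a \<Rightarrow> real" where
  "logdet y = (SOME r. \<exists>V X D. adapted V X D \<and> p y \<in> V \<and>
     2 * r = ln \<bar>ndet k (bmat X y)\<bar> - ln \<bar>ndet k (bmat X (p y))\<bar>)"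

text \<open>By the chain rule along \<open>p\<close>, the base functions are related by a Jacobian
  taken at \<open>p y\<close>. It is therefore the same at \<open>y\<close> and at
  \<open>p y\<close>, and its square cancels in the difference that defines
  \<open>logdet\<close>.\<close>

lemma bmat_change:
  assumes c: "adapted V X D" and c': "adapted V' X' D'" and y: "y \<in> N0" "p y \<in> V" "p y \<in> V'"
  shows "ndet k (bmat X' y) = (ndet k (\<lambda>i a. D a (p y) (X' i)))\<^sup>2 * ndet k (bmat X y)"
proof -
  let ?J = "\<lambda>i a. D a (p y) (X' i)"
  have kn: "i < n" if "i < k" for i using k_le_n[OF c] that by simp
  have b: "smooth_germ y (base X i)" "smooth_germ y (base X' i)" if "i < k" for i
    using smooth_base[OF c y(1,2) kn[OF that]] smooth_base[OF c' y(1,3) kn[OF that]] .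
  have change: "v (base X' i) = (\<Sum>a<k. v (base X a) * ?J i a)" if "v \<in> tangent_space A y" "i < k" for v i
    using tangent_pullback[OF c y(1,2) that(1) coordinatesD(2)[OF c_coord[OF c'] y(3) kn[OF that(2)]]]
    by (simp add: base_def[abs_def])
  have "bmat X' y i j = (\<Sum>a<k. \<Sum>b<k. ?J i a * bmat X y a b * ?J j b)" if ij: "i < k" "j < k" for i j
  proof -
    have "pb (base X' i) (base X b) y = (\<Sum>a<k. ?J i a * pb (base X a) (base X b) y)" if "b < k" for b
    proof -
      have "pb (base X' i) (base X b) y = - ham (base X b) y (base X' i)"
        using pb_skew[of y "base X' i" "base X b"] ham_apply[OF UNIV_I b(2)[OF ij(1)], of "base X b"] by simp
      also have "\<dots> = (\<Sum>a<k. ?J i a * - ham (base X b) y (base X a))"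
        unfolding change[OF ham_in_tangent_space[OF UNIV_I] ij(1)] by (simp add: sum_negf mult.commute)
      also have "\<dots> = (\<Sum>a<k. ?J i a * pb (base X a) (base X b) y)"
      proof (intro sum.cong refl)
        fix a assume "a \<in> {..<k}"
        then show "?J i a * - ham (base X b) y (base X a) = ?J i a * pb (base X a) (base X b) y"
          using pb_skew[of y "base X a" "base X b"] ham_apply[OF UNIV_I b(1)[of a], of "base X b"] by simp
      qed
      finally show ?thesis .
    qed
    moreover have "bmat X' y i j = (\<Sum>b<k. pb (base X' i) (base X b) y * ?J j b)"
      using change[OF ham_in_tangent_space[OF UNIV_I, of "base X' i"] ij(2)] b ij
      by (simp add: bmat_def ham_apply)
    ultimately have "bmat X' y i j = (\<Sum>b<k. \<Sum>a<k. ?J i a * bmat X y a b * ?J j b)"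
      by (simp add: bmat_def sum_distrib_right)
    then show ?thesis by (subst sum.swap)
  qed
  then have "ndet k (bmat X' y) = ndet k (\<lambda>i j. \<Sum>a<k. \<Sum>b<k. ?J i a * bmat X y a b * ?J j b)"
    by (intro ndet_cong)
  then show ?thesis by (simp only: ndet_congruence)
qed

lemma p_p: "y \<in> N0 \<Longrightarrow> p y \<in> N0" "y \<in> N0 \<Longrightarrow> p (p y) = p y"
  using p_in_S S_subset p_id by auto

lemma logdet_eq:
  assumes c: "adapted V X D" and y: "y \<in> patch V X"
  shows "2 * logdet y = ln \<bar>ndet k (bmat X y)\<bar> - ln \<bar>ndet k (bmat X (p y))\<bar>"
proof -
  have yN: "y \<in> N0" "p y \<in> V" "ndet k (bmat X y) \<noteq> 0" using y by (auto simp: patch_def)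
  have "\<exists>r. \<exists>V X D. adapted V X D \<and> p y \<in> V \<and>
      2 * r = ln \<bar>ndet k (bmat X y)\<bar> - ln \<bar>ndet k (bmat X (p y))\<bar>"
    using c yN by (intro exI[of _ "(ln \<bar>ndet k (bmat X y)\<bar> - ln \<bar>ndet k (bmat X (p y))\<bar>) / 2"]
        exI[of _ V] exI[of _ X] exI[of _ D]) simp
  from someI_ex[OF this] obtain V' X' D' where c': "adapted V' X' D'" "p y \<in> V'"
    and eq: "2 * logdet y = ln \<bar>ndet k (bmat X' y)\<bar> - ln \<bar>ndet k (bmat X' (p y))\<bar>"
    unfolding logdet_def[symmetric] by blast
  let ?j = "ndet k (\<lambda>i a. D a (p y) (X' i))"
  have py: "p y \<in> S" by (rule p_in_S[OF yN(1)])
  have 1: "ndet k (bmat X' y) = ?j\<^sup>2 * ndet k (bmat X y)"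
    by (rule bmat_change[OF c c'(1) yN(1,2) c'(2)])
  have 2: "ndet k (bmat X' (p y)) = ?j\<^sup>2 * ndet k (bmat X (p y))"
    using bmat_change[OF c c'(1) p_p(1)[OF yN(1)]] p_p(2)[OF yN(1)] yN(2) c'(2) by simp
  have nz: "ndet k (bmat X' (p y)) \<noteq> 0" "ndet k (bmat X (p y)) \<noteq> 0"
    using bmat_nondegenerate[OF c'(1) py c'(2)] bmat_nondegenerate[OF c py yN(2)] .
  then have "?j \<noteq> 0" using 2 by auto
  then show ?thesis
    using eq nz(2) yN(3) unfolding 1 2 by (simp add: abs_mult ln_mult)
qed

context
  fixes V X D y
  assumes c: "adapted V X D" and y: "y \<in> patch V X"
begin

interpretation d: dirac_mfd n A "patch V X" \<Lambda> k "base X"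
  by (rule dirac_patch[OF c])

lemma smooth_germ_ln_bmat: "smooth_germ y (\<lambda>z. ln \<bar>ndet k (bmat X z)\<bar>)"
  using smooth_germ_ln_abs[OF d.smooth_germ_ndet_M[OF y] d.ndet_M[OF y]]
  by (simp add: d.M_def[abs_def] bmat_def[abs_def])

lemma p_in_patch: "p y \<in> patch V X"
  using y bmat_nondegenerate[OF c p_in_S, of y] p_p[of y] by (auto simp: patch_def)

end

context
  fixes V X D y
  assumes c: "adapted V X D" and y: "y \<in> patch V X"
begin

interpretation d: dirac_mfd n A "patch V X" \<Lambda> k "base X"
  by (rule dirac_patch[OF c])

lemma eventually_logdet:
  "\<forall>\<^sub>F z in nhds y. (ln \<bar>ndet k (bmat X z)\<bar> - ln \<bar>ndet k (bmat X (p z))\<bar>) / 2 = logdet z"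
  using d.eventually_in_W[OF y]
  by (rule eventually_mono) (use logdet_eq[OF c] in \<open>simp add: field_simps\<close>)

lemma smooth_germ_ln_bmat_p: "smooth_germ y (\<lambda>z. ln \<bar>ndet k (bmat X (p z))\<bar>)"
proof (rule smooth_map_germ_pullback[OF smooth_p])
  show "y \<in> N0" using y by (simp add: patch_def)
  show "smooth_germ (p y) (\<lambda>s. ln \<bar>ndet k (bmat X s)\<bar>)"
    by (rule smooth_germ_ln_bmat[OF c p_in_patch[OF c y]])
qed

lemma smooth_germ_logdet: "smooth_germ y logdet"
  by (rule smooth_germ_transform[OF _ eventually_logdet])
    (intro smooth_germ_divide smooth_germ_diff smooth_germ_const smooth_germ_ln_bmat[OF c y]
      smooth_germ_ln_bmat_p, simp)

text \<open>The subtracted term is pulled back along \<open>p\<close>, and vertical vectors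
  annihilate such functions.\<close>

lemma vertical_logdet:
  assumes v: "v \<in> vertical A p y"
  shows "2 * v logdet = v (\<lambda>z. ln \<bar>ndet k (bmat X z)\<bar>)"
proof -
  have vT: "v \<in> tangent_space A y" and v0: "pushforward A p y v = (\<lambda>g. 0)"
    using v by (auto simp: vertical_def)
  let ?L = "\<lambda>z. ln \<bar>ndet k (bmat X z)\<bar>"
  have "v (\<lambda>z. ?L (p z)) = pushforward A p y v ?L"
    by (rule pushforward_apply[symmetric]) (rule smooth_germ_ln_bmat[OF c p_in_patch[OF c y]])
  then have Lp: "v (\<lambda>z. ?L (p z)) = 0" by (simp add: v0)
  have s: "smooth_germ y (\<lambda>z. ?L z - ?L (p z))"
    by (intro smooth_germ_diff smooth_germ_ln_bmat[OF c y] smooth_germ_ln_bmat_p)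
  have "\<forall>\<^sub>F z in nhds y. logdet z = (1 / 2) * (?L z - ?L (p z))"
    using eventually_logdet by (rule eventually_mono) simp
  then have "v logdet = v (\<lambda>z. (1 / 2) * (?L z - ?L (p z)))"
    by (rule tangent_cong[OF vT smooth_germ_logdet])
  also have "\<dots> = (1 / 2) * v (\<lambda>z. ?L z - ?L (p z))" by (rule tangent_scale[OF vT s])
  also have "v (\<lambda>z. ?L z - ?L (p z)) = v ?L"
    using tangent_diff[OF vT smooth_germ_ln_bmat[OF c y] smooth_germ_ln_bmat_p] Lp by simp
  finally show ?thesis by simp
qed

lemma ham_transverse:
  assumes f: "smooth_germ y f"
  shows "hamiltonian_field A transverse f y = d.dham f y"
proof
  fix g
  show "hamiltonian_field A transverse f y g = d.dham f y g"
  proof (cases "smooth_germ y g")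
    case True
    then show ?thesis using transverse_bracket[OF c y f True]
      by (simp add: d.dham_apply[OF y True] hamiltonian_field_def sharp_def poisson_bracket_def)
  next
    case False
    then show ?thesis
      using tangent_not_smooth[OF d.dham_in_tangent_space[OF y] False]
      by (simp add: hamiltonian_field_def sharp_def)
  qed
qed

text \<open>Here \<open>lw\<close> stands for the logarithm of the density of a volume form with respect to which all
  Hamiltonian vector fields of \<open>\<Lambda>\<close> are divergence free.\<close>

lemma dham_divergence:
  assumes Z: "coordinates V0 Z E" "y \<in> V0" and lw: "smooth_germ y lw"
    and div: "\<And>g. smooth_germ y g \<Longrightarrow> (\<Sum>i<n. E i y (pb g (Z i))) + pb g lw y = 0"
    and f: "smooth_germ y f"
  shows "(\<Sum>i<n. E i y (d.db f (Z i))) + d.dham f y (\<lambda>z. lw z + logdet z) = 0"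
proof -
  let ?u = "base X"
  have sZ: "smooth_germ y (Z i)" if "i < n" for i by (rule coordinatesD(2)[OF Z that])
  have E: "E i y \<in> tangent_space A y" if "i < n" for i by (rule coordinatesD(4)[OF Z that])
  have su: "smooth_germ y (?u j)" "smooth_germ y (d.co f j)" if "j < k" for j
    using d.smooth_u[OF y that] d.smooth_germ_co[OF y f that] .
  have spb: "smooth_germ y (pb g (Z i))" if "smooth_germ y g" "i < n" for g i
    by (rule smooth_germ_pb[OF UNIV_I that(1) sZ[OF that(2)]])
  have Edb: "E i y (d.db f (Z i)) = E i y (pb f (Z i))
      - (\<Sum>j<k. E i y (d.co f j) * pb (?u j) (Z i) y + d.co f j y * E i y (pb (?u j) (Z i)))" if i: "i < n" for i
  proof -
    have "E i y (d.db f (Z i)) = E i y (pb f (Z i)) - (\<Sum>j<k. E i y (\<lambda>z. d.co f j z * pb (?u j) (Z i) z))"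
      unfolding d.db_def[abs_def]
      using i by (subst tangent_diff[OF E[OF i] spb[OF f i]])
        (auto intro!: smooth_germ_sum smooth_germ_mult su spb tangent_sum[OF E[OF i]])
    also have "(\<Sum>j<k. E i y (\<lambda>z. d.co f j z * pb (?u j) (Z i) z))
        = (\<Sum>j<k. E i y (d.co f j) * pb (?u j) (Z i) y + d.co f j y * E i y (pb (?u j) (Z i)))"
      using i by (intro sum.cong refl tangent_mult[OF E[OF i]] su spb) auto
    finally show ?thesis .
  qed
  \<comment> \<open>The coordinate expression for the derivative of \<open>d.co f j\<close> along
    the Hamiltonian field of \<open>base X j\<close>. It is the extra term in the divergence of a
    vector field multiplied by a function.\<close>
  have co: "(\<Sum>i<n. E i y (d.co f j) * pb (?u j) (Z i) y) = pb (?u j) (d.co f j) y" if j: "j < k" for j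
    using tangent_coordinates[OF ham_in_tangent_space[OF UNIV_I] Z su(2)[OF j], of "?u j"]
    by (simp add: ham_apply su[OF j] sZ mult.commute)
  have "(\<Sum>i<n. E i y (d.db f (Z i))) = (\<Sum>i<n. E i y (pb f (Z i)))
      - (\<Sum>i<n. \<Sum>j<k. E i y (d.co f j) * pb (?u j) (Z i) y + d.co f j y * E i y (pb (?u j) (Z i)))"
    by (simp add: Edb sum_subtractf)
  also have "(\<Sum>i<n. \<Sum>j<k. E i y (d.co f j) * pb (?u j) (Z i) y + d.co f j y * E i y (pb (?u j) (Z i)))
      = (\<Sum>j<k. (\<Sum>i<n. E i y (d.co f j) * pb (?u j) (Z i) y) + d.co f j y * (\<Sum>i<n. E i y (pb (?u j) (Z i))))"
    by (subst sum.swap) (simp add: sum.distrib sum_distrib_left)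
  also have "\<dots> = (\<Sum>j<k. pb (?u j) (d.co f j) y - d.co f j y * pb (?u j) lw y)"
  proof (intro sum.cong refl)
    fix j assume "j \<in> {..<k}"
    then have j: "j < k" by simp
    have "(\<Sum>i<n. E i y (pb (?u j) (Z i))) = - pb (?u j) lw y" using div[OF su(1)[OF j]] by linarith
    then show "(\<Sum>i<n. E i y (d.co f j) * pb (?u j) (Z i) y) + d.co f j y * (\<Sum>i<n. E i y (pb (?u j) (Z i)))
        = pb (?u j) (d.co f j) y - d.co f j y * pb (?u j) lw y"
      by (simp add: co[OF j])
  qed
  finally have 1: "(\<Sum>i<n. E i y (d.db f (Z i))) = (\<Sum>i<n. E i y (pb f (Z i)))
      - ((\<Sum>j<k. pb (?u j) (d.co f j) y) - (\<Sum>j<k. d.co f j y * pb (?u j) lw y))"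
    by (simp add: sum_subtractf)
  have v: "d.dham f y \<in> vertical A p y"
    using y by (subst vertical_iff[OF c])
      (auto simp: patch_def intro: d.dham_in_tangent_space d.dham_u)
  have "d.dham f y (\<lambda>z. lw z + logdet z) = d.dham f y lw + d.dham f y logdet"
    by (rule tangent_add[OF d.dham_in_tangent_space[OF y] lw smooth_germ_logdet])
  also have "d.dham f y lw = pb f lw y - (\<Sum>j<k. d.co f j y * pb (?u j) lw y)"
    by (simp add: d.dham_apply[OF y lw] d.db_def)
  \<comment> \<open>The factors 2 in \<open>vertical_logdet\<close> and in
    \<open>d.sum_pb_co\<close> agree, so \<open>logdet\<close> compensates exactly the divergence
    that the varying coefficients \<open>d.co f j\<close> produce.\<close>
  also have "d.dham f y logdet = (\<Sum>j<k. pb (?u j) (d.co f j) y)"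
  proof -
    have "(\<lambda>z. ln \<bar>ndet k (d.M z)\<bar>) = (\<lambda>z. ln \<bar>ndet k (bmat X z)\<bar>)"
      by (simp add: d.M_def[abs_def] bmat_def[abs_def])
    then show ?thesis
      using vertical_logdet[OF v] d.sum_pb_co[OF y f] d.dham_apply[OF y smooth_germ_ln_bmat[OF c y], of f]
      by simp
  qed
  finally show ?thesis using 1 div[OF f] by linarith
qed

end

section \<open>Unimodularity of the transverse structure\<close>

lemma volume_form_scale:
  assumes vol: "volume_form A n U \<Omega>" and N: "open N" "N \<subseteq> U"
    and h: "\<And>x. x \<in> N \<Longrightarrow> smooth_germ x h"
  shows "volume_form A n N (\<lambda>x vs. exp (h x) * \<Omega> x vs)"
  unfolding volume_form_def
proof (intro conjI ballI allI impI; (elim conjE)?)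
  note V = vol[unfolded volume_form_def, THEN conjunct1, THEN bspec, THEN spec, THEN mp]
  fix x vs assume x: "x \<in> N" and vs: "length vs = n" "set vs \<subseteq> tangent_space A x"
  note F = V[OF subsetD[OF N(2) x] conjI[OF vs]]
  show "exp (h x) * \<Omega> x (vs[i := (\<lambda>f. u f + v f)]) = exp (h x) * \<Omega> x (vs[i := u]) + exp (h x) * \<Omega> x (vs[i := v])"
    if "i < n" "u \<in> tangent_space A x" "v \<in> tangent_space A x" for i u v
    using F[THEN conjunct1] that by (simp add: distrib_left)
  show "exp (h x) * \<Omega> x (vs[i := (\<lambda>f. r * v f)]) = r * (exp (h x) * \<Omega> x (vs[i := v]))"
    if "i < n" "v \<in> tangent_space A x" for i r v
    using F[THEN conjunct2, THEN conjunct1] that by simp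
  show "exp (h x) * \<Omega> x vs = 0" if "i < n" "j < n" "i \<noteq> j" "vs ! i = vs ! j" for i j
    using F[THEN conjunct2, THEN conjunct2] that by auto
next
  fix V Ys assume V: "open V" "V \<subseteq> N" and Ys: "length Ys = n" "\<forall>Y\<in>set Ys. vector_field A V Y"
  have "smooth_germ x (\<lambda>y. exp (h y) * \<Omega> y (map (\<lambda>Y. Y y) Ys))" if x: "x \<in> V" for x
    using x V N Ys by (intro smooth_germ_mult smooth_germ_exp h smooth_germ_vol[OF vol V(1)]) auto
  then show "smooth_fun A V (\<lambda>x. exp (h x) * \<Omega> x (map (\<lambda>Y. Y x) Ys))"
    by (simp add: smooth_fun_iff[OF V(1)])
next
  fix x assume "x \<in> N"
  then have "\<exists>vs. length vs = n \<and> set vs \<subseteq> tangent_space A x \<and> \<Omega> x vs \<noteq> 0"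
    using vol[unfolded volume_form_def, THEN conjunct2, THEN conjunct2, THEN bspec, of x] N(2) by auto
  then show "\<exists>vs. length vs = n \<and> set vs \<subseteq> tangent_space A x \<and> exp (h x) * \<Omega> x vs \<noteq> 0" by simp
qed

lemma unimodular_leaf_domain:
  assumes U: "open U" "S \<subseteq> U" and uni: "unimodular A n U \<Lambda>"
  shows "unimodular A n (leaf_domain U) transverse"
proof -
  let ?N = "leaf_domain U"
  note oN = open_leaf_domain[OF U(1)]
  have NU: "?N \<subseteq> U" by (auto simp: leaf_domain_def)
  obtain \<Omega> where vol: "volume_form A n U \<Omega>" and cls: "modular_class A n U \<Lambda> \<Omega> = poisson_class A U \<Lambda> (\<lambda>x f. 0)"
    using uni by (auto simp: unimodular_def)
  obtain \<phi> where \<phi>: "\<And>x. x \<in> U \<Longrightarrow> smooth_germ x \<phi>"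
    and div\<phi>: "\<And>x g. x \<in> U \<Longrightarrow> smooth_germ x g \<Longrightarrow> divergence A n \<Omega> (ham g) x = pb \<phi> g x"
    using modular_class_zeroD[OF U(1) subset_UNIV cls] by metis
  have slog: "smooth_germ x logdet" if "x \<in> ?N" for x
    using that by (rule leaf_domainE) (rule smooth_germ_logdet)
  \<comment> \<open>Rescaling by an exponential adds the derivative of the exponent to the
    divergence. The summand \<open>\<phi>\<close> adds \<open>pb g \<phi>\<close>, which cancels the
    divergence \<open>pb \<phi> g\<close> of \<open>ham g\<close>; the summand \<open>logdet\<close>
    removes what is then left for the fields of \<open>transverse\<close>.\<close>
  define \<Omega>' where "\<Omega>' = (\<lambda>x vs. exp (\<phi> x + logdet x) * \<Omega> x vs)"
  have vol': "volume_form A n ?N \<Omega>'"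
    unfolding \<Omega>'_def using NU by (intro volume_form_scale[OF vol oN NU] smooth_germ_add \<phi> slog) auto
  interpret P: bivector_mfd n A ?N transverse
    by unfold_locales (rule oN, rule bivector_field_transverse[OF U(1)])
  have div0: "divergence A n \<Omega>' (hamiltonian_field A transverse f) y = 0"
    if yN: "y \<in> ?N" and f: "smooth_germ y f" for y f
  proof -
    have yU: "y \<in> U" using yN NU by auto
    obtain V X D where c: "adapted V X D" and y: "y \<in> patch V X" using yN by (rule leaf_domainE)
    interpret d: dirac_mfd n A "patch V X" \<Lambda> k "base X" by (rule dirac_patch[OF c])
    obtain V0 Z E where Z: "coordinates V0 Z E" "y \<in> V0" by (rule coordinates_exist)
    have sZ: "smooth_germ y (Z i)" if "i < n" for i by (rule coordinatesD(2)[OF Z that])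
    have E: "E i y \<in> tangent_space A y" if "i < n" for i by (rule coordinatesD(4)[OF Z that])
    define w where "w z = \<Omega> z (map (\<lambda>i. E i z) [0..<n])" for z
    have w0: "w z \<noteq> 0" if "z \<in> U" "z \<in> V0" for z
      unfolding w_def by (rule vol_frame_nonzero[OF vol that(1) Z(1) that(2)])
    have sw: "smooth_germ y w"
    proof -
      have "smooth_germ y (\<lambda>z. \<Omega> z (map (\<lambda>Y. Y z) (map E [0..<n])))"
        using yU Z(2) coordinatesD(1)[OF Z(1)] U(1) vector_field_subset[OF coordinatesD(3)[OF Z(1)]]
        by (intro smooth_germ_vol[OF vol, of "U \<inter> V0"]) auto
      then show ?thesis by (simp add: w_def[abs_def] o_def)
    qed
    have slw: "smooth_germ y (\<lambda>z. ln \<bar>w z\<bar>)" by (rule smooth_germ_ln_abs[OF sw w0[OF yU Z(2)]])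
    have nbhd: "\<exists>V1. open V1 \<and> y \<in> V1 \<and> (\<forall>z\<in>V1. smooth_germ z g)" if "smooth_germ y g" for g
      using smooth_germ_eventually[OF that] by (auto simp: eventually_nhds)
    have div: "(\<Sum>i<n. E i y (pb g (Z i))) + pb g (\<lambda>z. ln \<bar>w z\<bar> + \<phi> z) y = 0" if g: "smooth_germ y g" for g
    proof -
      obtain V1 where V1: "open V1" "y \<in> V1" "\<And>z. z \<in> V1 \<Longrightarrow> smooth_germ z g" using nbhd[OF g] by blast
      have "pb \<phi> g y = (\<Sum>i<n. E i y (\<lambda>z. ham g z (Z i))) + ham g y (\<lambda>z. ln \<bar>w z\<bar>)"
        using divergence_coordinates[OF vol yU U(1) Z V1(1,2) vector_field_ham[OF V1(1) subset_UNIV V1(3)]]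
          div\<phi>[OF yU g] by (simp add: w_def)
      also have "(\<Sum>i<n. E i y (\<lambda>z. ham g z (Z i))) = (\<Sum>i<n. E i y (pb g (Z i)))"
      proof (intro sum.cong refl)
        fix i assume "i \<in> {..<n}"
        then have i: "i < n" by simp
        have "\<forall>\<^sub>F z in nhds y. pb g (Z i) z = ham g z (Z i)"
          using smooth_germ_eventually[OF sZ[OF i]] by (rule eventually_mono) (simp add: ham_apply)
        then show "E i y (\<lambda>z. ham g z (Z i)) = E i y (pb g (Z i))"
          by (rule tangent_cong[OF E[OF i] smooth_germ_pb[OF UNIV_I g sZ[OF i]], symmetric])
      qed
      finally show ?thesis
        using pb_skew[of y \<phi> g] by (simp add: ham_apply slw pb_add \<phi>[OF yU])
    qed
    obtain V1 where V1: "open V1" "y \<in> V1" "\<And>z. z \<in> V1 \<Longrightarrow> smooth_germ z f" using nbhd[OF f] by blast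
    let ?V = "V1 \<inter> ?N"
    have "divergence A n \<Omega>' (hamiltonian_field A transverse f) y
        = (\<Sum>i<n. E i y (\<lambda>z. hamiltonian_field A transverse f z (Z i)))
          + hamiltonian_field A transverse f y (\<lambda>z. ln \<bar>\<Omega>' z (map (\<lambda>i. E i z) [0..<n])\<bar>)"
      using V1 yN oN
      by (intro divergence_coordinates[OF vol' yN oN Z, of ?V] P.vector_field_ham) auto
    also have "(\<Sum>i<n. E i y (\<lambda>z. hamiltonian_field A transverse f z (Z i))) = (\<Sum>i<n. E i y (d.db f (Z i)))"
    proof (intro sum.cong refl)
      fix i assume "i \<in> {..<n}"
      then have i: "i < n" by simp
      have "\<forall>\<^sub>F z in nhds y. d.db f (Z i) z = hamiltonian_field A transverse f z (Z i)"
        using transverse_bracket_germ[OF c y f sZ[OF i]] smooth_germ_eventually[OF sZ[OF i]] P.eventually_in_W[OF yN]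
        by eventually_elim (simp add: P.ham_apply)
      then show "E i y (\<lambda>z. hamiltonian_field A transverse f z (Z i)) = E i y (d.db f (Z i))"
        by (rule tangent_cong[OF E[OF i] d.smooth_germ_db[OF y f sZ[OF i]], symmetric])
    qed
    also have "hamiltonian_field A transverse f y (\<lambda>z. ln \<bar>\<Omega>' z (map (\<lambda>i. E i z) [0..<n])\<bar>)
        = d.dham f y (\<lambda>z. (ln \<bar>w z\<bar> + \<phi> z) + logdet z)"
      unfolding ham_transverse[OF c y f]
    proof (rule tangent_cong[OF d.dham_in_tangent_space[OF y], symmetric])
      show "smooth_germ y (\<lambda>z. (ln \<bar>w z\<bar> + \<phi> z) + logdet z)"
        by (intro smooth_germ_add slw \<phi> yU slog yN)
      show "\<forall>\<^sub>F z in nhds y. (ln \<bar>w z\<bar> + \<phi> z) + logdet z = ln \<bar>\<Omega>' z (map (\<lambda>i. E i z) [0..<n])\<bar>"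
        using eventually_nhds_in_open[OF U(1) yU] eventually_nhds_in_open[OF coordinatesD(1)[OF Z(1)] Z(2)]
      proof eventually_elim
        case (elim z)
        have "ln \<bar>exp (\<phi> z + logdet z) * w z\<bar> = \<phi> z + logdet z + ln \<bar>w z\<bar>"
          using w0[OF elim] by (simp add: abs_mult ln_mult)
        then show ?case by (simp add: \<Omega>'_def w_def)
      qed
    qed
    also have "(\<Sum>i<n. E i y (d.db f (Z i))) + \<dots> = 0"
      by (rule dham_divergence[OF c y Z _ div f]) (intro smooth_germ_add slw \<phi> yU)
    finally show ?thesis .
  qed
  have "modular_field A n transverse \<Omega>' x = (\<lambda>f. 0)" if "x \<in> ?N" for x
    using div0[OF that] by (simp add: modular_field_def fun_eq_iff)
  then have "modular_class A n ?N transverse \<Omega>' = poisson_class A ?N transverse (\<lambda>x f. 0)"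
    unfolding modular_class_def by (intro poisson_class_cong oN)
  with vol' show ?thesis unfolding unimodular_def by blast
qed

end

theorem proposition8p1:
  fixes A :: "('a::{t2_space, second_countable_topology}, 'e::euclidean_space) chart set"
    and n :: nat and \<Lambda> :: "'a bivfield" and S :: "'a set"
  assumes "smooth_manifold n A"
    and "poisson_bivector A UNIV \<Lambda>"
    and "embedded_symplectic_leaf n A \<Lambda> S"
    and "\<exists>U. open U \<and> S \<subseteq> U \<and> unimodular A n U \<Lambda>"
  shows "\<exists>N p P. coupling_neighborhood A \<Lambda> S N p \<and> transverse_poisson A \<Lambda> S N p P \<and>
           unimodular A n N P"
proof -
  interpret smooth_mfd n A by unfold_locales (rule assms(1))
  obtain k where k: "embedded_submanifold n k A S"
    and char: "\<And>x. x \<in> S \<Longrightarrow> submanifold_tangent A S x = sharp A \<Lambda> x ` cotangent_space A x"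
    using assms(3) by (auto simp: embedded_symplectic_leaf_def)
  obtain N0 p where p: "retraction_germ S N0 p" "S \<subseteq> N0" by (rule retraction_exists[OF k])
  interpret leaf_nbhd n A \<Lambda> S N0 p k
    by unfold_locales (use assms(2) k char p in \<open>auto simp: poisson_bivector_def\<close>)
  obtain U where U: "open U" "S \<subseteq> U" "unimodular A n U \<Lambda>" using assms(4) by blast
  show ?thesis
    using coupling_leaf_domain[OF U(1,2)] transverse_poisson_leaf_domain[OF U(1,2)]
      unimodular_leaf_domain[OF U] by blast
qed

end
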